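(* Let $x\in\mathbb{R}^N$, $r_1,r_2>0$, $m>0$, and let an ODE solver be given that consists of $S$ compositions of a Runge-Kutta method $\Phi_h$ of order $p\ge 1$, i.e. $\mathrm{ODESolve}(\cdot,g,T)=(\Phi_{h,g})^S(\cdot)$ with $T=Sh$. Let $f$ be the target vector field and $f_{net}$ the learned vector field, and denote $$\mathcal{L}=\frac1T\left\|\mathrm{ODESolve}(\cdot,f_{net},T)-\phi_{Sh,f}(\cdot)\right\|_{\mathcal{B}(x,r_1)}.$$ Suppose $f$ and $f_{net}$ are real analytic and bounded by $m$ on $\mathcal{B}(x,r_1+r_2)$, i.e. $$\|f\|_{\mathcal{B}(x,r_1+r_2)}\le m,\qquad \|f_{net}\|_{\mathcal{B}(x,r_1+r_2)}\le m.$$ Then there exist an integer $K=K(T)$ and positive constants $T_0,q,\gamma,c_1,c_2,C$ that depend on $m$, $r_1$, $r_2$ and the ODE solver, such that, if $0<T<T_0$, $$\|f_{net}(x)-f_h^K(x)\|\le c_1e^{-\gamma/T^{1/q}}+C\mathcal{L},$$ $$\|f_{net}(x)-f(x)\|\le c_2h^p+C\mathcal{L},$$ where $h=T/S$ and $f_h^K$ is the truncated vector field of the inverse modified differential equation (IMDE) of $\Phi_{h,f}$.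
   Context: Notation. $\|\cdot\|=\|\cdot\|_\infty$ is the $l_\infty$-norm on $\mathbb{C}^N$. $\mathcal{B}(x,r)\subset\mathbb{C}^N$ is the complex ball of radius $r$ centered at $x$ in this norm. For a set $\mathcal{K}\subset\mathbb{C}^N$, $\|g\|_{\mathcal{K}}=\sup_{y\in\mathcal{K}}\|g(y)\|$. A vector field $f$ being real analytic on a complex ball means that it is a real analytic vector field which extends to a (complex) analytic function on this ball; the same letter denotes the extension. Flow. $\phi_{t,f}(y_0)$ is the exact solution at time $t$ of $\frac{d}{dt}y=f(y)$, $y(0)=y_0$. Runge-Kutta method. Given real numbers $b_i,a_{ij}$ ($i,j=1,\dots,s$), the method with step $h$ applied to $\frac{d}{dt}y=g(y)$ is $\Phi_{h,g}(y_0)=y_0+h\sum_{i=1}^s b_ik_i$, where $k_i=g\big(y_0+h\sum_{j=1}^s a_{ij}k_j\big)$, $i=1,\dots,s$ (for implicit methods and small $h$, the $k_i$ are the local solutions close to $g(y_0)$ given by the Implicit Function Theorem). It has order $p$ if $\Phi_{h,g}(y)=\phi_{h,g}(y)+O(h^{p+1})$ for every sufficiently smooth $g$ and every $y$. $(\Phi_{h,g})^S$ is the $S$-fold composition of $\Phi_{h,g}$ with itself. IMDE. The inverse modified differential equation of $\Phi_{h,f}$ is the formal equation $\frac{d}{dt}\tilde y=f_h(\tilde y)=f_0(\tilde y)+hf_1(\tilde y)+h^2f_2(\tilde y)+\cdots$, with $h$-independent functions $f_k$, such that $\Phi_{h,f_h}(y)=\phi_{h,f}(y)$ as formal power series in $h$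 for arbitrary $y$. The $f_k$ are determined uniquely and recursively by comparing coefficients of like powers of $h$; equivalently $f_0=f$ and $f_k=\lim_{h\to0}\big(\phi_{h,f}-\Phi_{h,f_h^{k-1}}\big)/h^{k+1}$ for $k\ge1$. Its truncation is $f_h^K=\sum_{k=0}^K h^kf_k$. *)

theory Defs
  imports "HOL-Analysis.Analysis" "HOL-Library.Landau_Symbols"
begin

text \<open>
  The dimension \<open>N\<close> is a natural number, and \<open>\<complex>\<^sup>N\<close> with the \<open>l\<^sub>\<infinity>\<close>-norm is represented as the
  subspace of those bounded sequences (with the library's supremum norm) that vanish from index
  \<open>N\<close> on.  With a type-indexed space such as \<open>complex ^ 'n\<close>, constants that are uniform in the
  dimension could not be expressed, and the library norm would be the Euclidean one.
\<close>

type_synonym cseq = "(nat, complex) bcontfun"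

definition cvec :: "nat \<Rightarrow> cseq set" where
  "cvec N = {v. \<forall>i\<ge>N. apply_bcontfun v i = 0}"

definition rvec :: "nat \<Rightarrow> cseq set" where
  "rvec N = {v \<in> cvec N. \<forall>i. apply_bcontfun v i \<in> \<real>}"

lemma cvec_ex1: "\<exists>!v. v \<in> cvec N \<and> (\<forall>i<N. apply_bcontfun v i = u i)"
proof -
  let ?w = "\<lambda>i. if i < N then u i else 0"
  have "range ?w \<subseteq> insert 0 (u ` {..<N})" by auto
  then have "finite (range ?w)" by (rule finite_subset) simp
  then have "?w \<in> bcontfun" by (simp add: bcontfun_def finite_imp_bounded)
  then have *: "apply_bcontfun (Bcontfun ?w) = ?w" by (rule Bcontfun_inverse)
  show ?thesis
  proof (rule ex1I[of _ "Bcontfun ?w"])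
    show "Bcontfun ?w \<in> cvec N \<and> (\<forall>i<N. apply_bcontfun (Bcontfun ?w) i = u i)"
      by (simp add: cvec_def *)
  next
    fix v assume v: "v \<in> cvec N \<and> (\<forall>i<N. apply_bcontfun v i = u i)"
    show "v = Bcontfun ?w"
      by (rule bcontfun_eqI) (use v in \<open>auto simp: * cvec_def\<close>)
  qed
qed

lemma norm_cvec:
  assumes "v \<in> cvec N" "N \<ge> 1"
  shows "norm v = (MAX i\<in>{..<N}. cmod (apply_bcontfun v i))"
proof (rule antisym)
  have ne: "{..<N} \<noteq> {}" using assms(2) by (simp add: lessThan_empty_iff)
  show "norm v \<le> (MAX i\<in>{..<N}. cmod (apply_bcontfun v i))"
  proof (rule norm_bound)
    fix i
    have 0: "0 \<le> (MAX i\<in>{..<N}. cmod (apply_bcontfun v i))"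
      using assms(2) by (intro order_trans[OF norm_ge_zero Max_ge[of _ "cmod (apply_bcontfun v 0)"]]) auto
    show "cmod (apply_bcontfun v i) \<le> (MAX i\<in>{..<N}. cmod (apply_bcontfun v i))"
    proof (cases "i < N")
      case True
      then show ?thesis by (intro Max_ge) auto
    next
      case False
      then show ?thesis using assms(1) 0 by (simp add: cvec_def)
    qed
  qed
  show "(MAX i\<in>{..<N}. cmod (apply_bcontfun v i)) \<le> norm v"
    using ne by (auto intro: norm_bounded)
qed

definition complex_ball :: "nat \<Rightarrow> cseq \<Rightarrow> real \<Rightarrow> cseq set" where
  "complex_ball N x r = {y \<in> cvec N. norm (y - x) < r}"

definition cscale :: "complex \<Rightarrow> cseq \<Rightarrow> cseq" where
  "cscale c v = Bcontfun (\<lambda>i. c * apply_bcontfun v i)"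

lemma apply_cscale: "apply_bcontfun (cscale c v) i = c * apply_bcontfun v i"
proof -
  have "(\<lambda>i. c * apply_bcontfun v i) \<in> bcontfun"
  proof (rule bcontfun_normI)
    show "norm (c * apply_bcontfun v i) \<le> norm c * norm v" for i
      by (simp add: norm_mult mult_left_mono norm_bounded)
  qed simp
  then show ?thesis by (simp add: cscale_def Bcontfun_inverse)
qed

text \<open>
  As for the library's one-variable predicate \<open>analytic_on\<close>, complex analyticity is complex
  differentiability on an open set: \<open>U\<close> is always relatively open in \<open>\<complex>\<^sup>N\<close>, and the derivative is
  required to be \<open>\<complex>\<close>-linear on \<open>\<complex>\<^sup>N\<close>.
\<close>

definition complex_analytic_on :: "nat \<Rightarrow> cseq set \<Rightarrow> (cseq \<Rightarrow> cseq) \<Rightarrow> bool" where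
  "complex_analytic_on N U f \<longleftrightarrow>
     (\<forall>y\<in>U. f y \<in> cvec N \<and>
        (\<exists>D. (f has_derivative D) (at y within U) \<and>
             (\<forall>c. \<forall>v\<in>cvec N. D (cscale c v) = cscale c (D v))))"

text \<open>
  A real analytic vector field together with its complex analytic extension to \<open>U\<close>: the extension
  takes real values at real points, and its restriction to them is then real analytic.
\<close>

definition real_analytic_ext_on :: "nat \<Rightarrow> cseq set \<Rightarrow> (cseq \<Rightarrow> cseq) \<Rightarrow> bool" where
  "real_analytic_ext_on N U f \<longleftrightarrow>
     complex_analytic_on N U f \<and> (\<forall>y \<in> U \<inter> rvec N. f y \<in> rvec N)"

text \<open>
  Vector fields are functions on the whole type, of which only the values on the domain \<open>U\<close> count.
  Hence the solution curve here and the stage points below have to stay in \<open>U\<close>.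
\<close>

definition flow :: "cseq set \<Rightarrow> real \<Rightarrow> (cseq \<Rightarrow> cseq) \<Rightarrow> cseq \<Rightarrow> cseq" where
  "flow U t f y0 =
     (THE z. \<exists>y. y 0 = y0 \<and> y t = z \<and>
        (\<forall>\<tau>\<in>closed_segment 0 t. y \<tau> \<in> U \<and>
           (y has_vector_derivative f (y \<tau>)) (at \<tau> within closed_segment 0 t)))"

definition rk_stages ::
  "cseq set \<Rightarrow> nat \<Rightarrow> (nat \<Rightarrow> nat \<Rightarrow> real) \<Rightarrow> real \<Rightarrow> (cseq \<Rightarrow> cseq) \<Rightarrow> cseq \<Rightarrow> (nat \<Rightarrow> cseq) \<Rightarrow> bool"
where
  "rk_stages U s a h g y0 k \<longleftrightarrow>
     (\<forall>i<s. y0 + h *\<^sub>R (\<Sum>j<s. a i j *\<^sub>R k j) \<in> U \<and>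
            k i = g (y0 + h *\<^sub>R (\<Sum>j<s. a i j *\<^sub>R k j)))"

text \<open>
  For an implicit method the stage equations may have several solutions.  The one provided by the
  implicit function theorem is selected as the end point of a branch \<open>k\<close> of solutions that depends
  continuously on the step size \<open>\<tau>\<close> between \<open>0\<close> and \<open>h\<close>, with \<open>g\<close> fixed; at \<open>\<tau> = 0\<close> the stage
  equations force \<open>k i 0 = g y0\<close>.
\<close>

definition rk_step ::
  "cseq set \<Rightarrow> nat \<Rightarrow> (nat \<Rightarrow> nat \<Rightarrow> real) \<Rightarrow> (nat \<Rightarrow> real) \<Rightarrow> real \<Rightarrow> (cseq \<Rightarrow> cseq) \<Rightarrow> cseq \<Rightarrow> cseq"
where
  "rk_step U s a b h g y0 =
     (THE z. \<exists>k :: nat \<Rightarrow> real \<Rightarrow> cseq.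
        (\<forall>i<s. continuous_on (closed_segment 0 h) (k i)) \<and>
        (\<forall>\<tau>\<in>closed_segment 0 h. rk_stages U s a \<tau> g y0 (\<lambda>i. k i \<tau>)) \<and>
        z = y0 + h *\<^sub>R (\<Sum>i<s. b i *\<^sub>R k i h))"

definition ode_solve ::
  "cseq set \<Rightarrow> nat \<Rightarrow> (nat \<Rightarrow> nat \<Rightarrow> real) \<Rightarrow> (nat \<Rightarrow> real) \<Rightarrow> nat \<Rightarrow> (cseq \<Rightarrow> cseq) \<Rightarrow> real \<Rightarrow> cseq \<Rightarrow> cseq"
where
  "ode_solve U s a b S g T = (rk_step U s a b (T / real S) g) ^^ S"

text \<open>Functions of class \<open>C\<^sup>n\<close> on an open \<open>U \<subseteq> \<real>\<^sup>N\<close>, by iterated directional derivatives.\<close>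

primrec class_C :: "nat \<Rightarrow> nat \<Rightarrow> cseq set \<Rightarrow> (cseq \<Rightarrow> cseq) \<Rightarrow> bool" where
  "class_C N 0 U g \<longleftrightarrow> continuous_on U g"
| "class_C N (Suc n) U g \<longleftrightarrow> continuous_on U g \<and>
     (\<forall>v\<in>rvec N. \<exists>g'. class_C N n U g' \<and>
        (\<forall>y\<in>U. ((\<lambda>t. g (y + t *\<^sub>R v)) has_vector_derivative g' y) (at 0)))"

definition smooth_field :: "nat \<Rightarrow> cseq set \<Rightarrow> (cseq \<Rightarrow> cseq) \<Rightarrow> bool" where
  "smooth_field N U g \<longleftrightarrow>
     openin (top_of_set (rvec N)) U \<and> (\<forall>y\<in>U. g y \<in> rvec N) \<and> (\<forall>n. class_C N n U g)"

definition rk_order :: "nat \<Rightarrow> (nat \<Rightarrow> nat \<Rightarrow> real) \<Rightarrow> (nat \<Rightarrow> real) \<Rightarrow> nat \<Rightarrow> bool" where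
  "rk_order s a b p \<longleftrightarrow>
     (\<forall>N U g. smooth_field N U g \<longrightarrow>
        (\<forall>y\<in>U. (\<lambda>h. norm (rk_step U s a b h g y - flow U h g y)) \<in> O[at 0](\<lambda>h. h ^ (p + 1))))"

text \<open>
  The formal identity \<open>\<Phi>\<^bsub>h,f_h\<^esub> = \<phi>\<^bsub>h,f\<^esub>\<close>, with \<open>f_h = f 0 + h f 1 + h\<^sup>2 f 2 + \<dots>\<close>, is solved for
  its coefficients: adding \<open>h\<^sup>k f k\<close> to the truncation of \<open>f_h\<close> below \<open>k\<close> changes a step of a consistent
  method by \<open>h\<^bsup>k+1\<^esup> f k\<close> to leading order, so \<open>f k\<close> is the coefficient of \<open>h\<^bsup>k+1\<^esup>\<close> in the defect of
  that truncation.
\<close>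

fun imde ::
  "cseq set \<Rightarrow> nat \<Rightarrow> (nat \<Rightarrow> nat \<Rightarrow> real) \<Rightarrow> (nat \<Rightarrow> real) \<Rightarrow> (cseq \<Rightarrow> cseq) \<Rightarrow> nat \<Rightarrow> cseq \<Rightarrow> cseq"
where
  "imde U s a b f 0 = f"
| "imde U s a b f (Suc n) = (\<lambda>y. Lim (at 0) (\<lambda>h.
     (1 / h ^ (n + 2)) *\<^sub>R
       (flow U h f y - rk_step U s a b h (\<lambda>z. \<Sum>j\<le>n. h ^ j *\<^sub>R imde U s a b f j z) y)))"

definition imde_trunc ::
  "cseq set \<Rightarrow> nat \<Rightarrow> (nat \<Rightarrow> nat \<Rightarrow> real) \<Rightarrow> (nat \<Rightarrow> real) \<Rightarrow> (cseq \<Rightarrow> cseq) \<Rightarrow> nat \<Rightarrow> real \<Rightarrow> cseq \<Rightarrow> cseq"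
where
  "imde_trunc U s a b f K h y = (\<Sum>k\<le>K. h ^ k *\<^sub>R imde U s a b f k y)"

text \<open>The supremum is real-valued; for small \<open>T\<close> the set is bounded, as steps and flow stay in \<open>U\<close>.\<close>

definition train_loss ::
  "cseq set \<Rightarrow> cseq set \<Rightarrow> nat \<Rightarrow> (nat \<Rightarrow> nat \<Rightarrow> real) \<Rightarrow> (nat \<Rightarrow> real) \<Rightarrow> nat \<Rightarrow>
     (cseq \<Rightarrow> cseq) \<Rightarrow> (cseq \<Rightarrow> cseq) \<Rightarrow> real \<Rightarrow> real"
where
  "train_loss B U s a b S fnet f T =
     (1 / T) * (SUP y\<in>B. norm (ode_solve U s a b S fnet T y - flow U T f y))"

end

theory Submission
  imports Defs "HOL-Complex_Analysis.Conformal_Mappings"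
begin

text \<open>
  The stages of the method and the flow extend holomorphically to complex step sizes \<open>h\<close>. Starting
  from \<open>F\<^sub>0 = f\<close>, the iteration \<open>F\<^sub>n\<^sub>+\<^sub>1 = F\<^sub>n + (\<phi>\<^sub>h - \<Phi>\<^sub>h(F\<^sub>n)) / h\<close> solves \<open>\<Phi>\<^sub>h(F) = \<phi>\<^sub>h\<close> up to an error
  \<open>O(h\<^sup>n)\<close>: it is a contraction with factor \<open>O(h / \<delta>)\<close> when the radius of the ball shrinks by \<open>\<delta>\<close>,
  because \<open>g \<mapsto> (\<Phi>\<^sub>h(g) - id) / h\<close> differs from the identity by a Lipschitz map of that size. On the
  disc \<open>|h| < const / n\<close> the fields \<open>F\<^sub>n\<close> are thus bounded by \<open>2m\<close>; their Taylor coefficients in \<open>h\<close> up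
  to index \<open>n\<close> are the coefficients of the inverse modified equation, so Cauchy's estimates on this
  disc replace any recursion for the \<open>f\<^sub>k\<close>. For \<open>n\<close> of size \<open>1 / h\<close> both \<open>F\<^sub>n - f\<^sub>h\<^sup>n\<close> and the defect
  \<open>\<phi>\<^sub>h - \<Phi>\<^sub>h(F\<^sub>n)\<close> are exponentially small, with \<open>q = 1\<close>.

  Two fields whose \<open>S\<close>-fold steps are close on the ball of radius \<open>r1\<close> are close at its centre, by
  the same contraction on balls shrinking from \<open>r1\<close> to \<open>0\<close>. This is applied to \<open>fnet\<close> and \<open>F\<^sub>n\<close> for the
  first estimate, and to \<open>fnet\<close> and \<open>f\<close> for the second one, where the order conditions pass from real
  to complex points by the identity theorem.
\<close>

subsection \<open>Coordinates\<close>

text \<open>The constants have to be chosen before the dimension \<open>N\<close>. Hence all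
  analysis runs along complex lines and curves: Cauchy's estimates hold in every coordinate with the
  same constant, and the supremum norm takes them over without a factor. The price is paid in
  domain: a field bounded by \<open>M\<close> has a Lipschitz constant of size
  \<open>M / \<delta>\<close> only after a loss of radius \<open>\<delta>\<close>, and every
  contraction pays such a loss. If \<open>n\<close> contractions share a fixed total loss, then
  \<open>\<delta>\<close> is of size \<open>1 / n\<close> and each factor of size
  \<open>n * h\<close>; keeping the factors below 1/2 restricts \<open>n\<close> to the size
  \<open>1 / h\<close>, which is the origin of the exponential rate.

  Steps and flow are definite descriptions for real step sizes. The proof works instead with the
  quotients \<open>rk_mean\<close> and \<open>flow_mean\<close>, which stand for (new point - y) /
  h, make sense at \<open>h = 0\<close> and for complex \<open>h\<close>, and are limits of explicit
  iterations. The agreement with the definite descriptions rests on uniqueness among all competing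
  branches of stages and all competing solutions.\<close>

abbreviation coord :: "cseq \<Rightarrow> nat \<Rightarrow> complex" where
  "coord \<equiv> apply_bcontfun"

lemma coord_sum: "coord (\<Sum>i\<in>I. v i) j = (\<Sum>i\<in>I. coord (v i) j)"
  by (induction I rule: infinite_finite_induct) auto

lemma bounded_linear_coord: "bounded_linear (\<lambda>v. coord v i)"
  by (rule bounded_linear_intro[where K = 1]) (auto intro: norm_bounded)

lemma norm_cscale: "norm (cscale c v) = cmod c * norm v"
proof (rule antisym)
  show "norm (cscale c v) \<le> cmod c * norm v"
    by (rule norm_bound) (simp add: apply_cscale norm_mult mult_left_mono norm_bounded)
  show "cmod c * norm v \<le> norm (cscale c v)"
  proof (cases "c = 0")
    case False
    have "norm v \<le> norm (cscale c v) / cmod c"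
    proof (rule norm_bound)
      fix i
      have "cmod (c * coord v i) \<le> norm (cscale c v)"
        using norm_bounded[of "cscale c v" i] by (simp add: apply_cscale)
      then show "cmod (coord v i) \<le> norm (cscale c v) / cmod c"
        using False by (simp add: norm_mult field_simps)
    qed
    then show ?thesis using False by (simp add: field_simps)
  qed simp
qed

lemma cscale_of_real: "cscale (of_real r) v = r *\<^sub>R v"
  by (rule bcontfun_eqI) (simp add: apply_cscale scaleR_conv_of_real)

lemma cscale_add_right: "cscale c (v + w) = cscale c v + cscale c w"
  and cscale_diff_right: "cscale c (v - w) = cscale c v - cscale c w"
  and cscale_add_left: "cscale (c + d) v = cscale c v + cscale d v"
  and cscale_diff_left: "cscale (c - d) v = cscale c v - cscale d v"
  and cscale_cscale: "cscale c (cscale d v) = cscale (c * d) v"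
  and cscale_scaleR: "cscale c (r *\<^sub>R v) = r *\<^sub>R cscale c v"
  and cscale_0_left [simp]: "cscale 0 v = 0"
  and cscale_0_right [simp]: "cscale c 0 = 0"
  and cscale_1_left [simp]: "cscale 1 v = v"
  by (auto intro!: bcontfun_eqI simp: apply_cscale algebra_simps)

lemma cscale_sum_right: "cscale c (\<Sum>i\<in>I. v i) = (\<Sum>i\<in>I. cscale c (v i))"
  by (rule bcontfun_eqI) (simp add: apply_cscale coord_sum sum_distrib_left)

lemma bounded_linear_cscale_left: "bounded_linear (\<lambda>c. cscale c v)"
  by (rule bounded_linear_intro[where K = "norm v"])
    (auto simp: cscale_add_left norm_cscale intro!: bcontfun_eqI simp: apply_cscale)

lemma subspace_cvec: "subspace (cvec N)"
  by (auto simp: subspace_def cvec_def)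

lemma subspace_rvec: "subspace (rvec N)"
  by (auto simp: subspace_def rvec_def cvec_def scaleR_conv_of_real)

lemma cvec_cscale: "v \<in> cvec N \<Longrightarrow> cscale c v \<in> cvec N"
  by (simp add: cvec_def apply_cscale)

lemmas cvec_intros =
  subspace_0[OF subspace_cvec] subspace_add[OF subspace_cvec] subspace_diff[OF subspace_cvec]
  subspace_scale[OF subspace_cvec] subspace_sum[OF subspace_cvec] cvec_cscale

lemmas rvec_intros =
  subspace_0[OF subspace_rvec] subspace_add[OF subspace_rvec] subspace_diff[OF subspace_rvec]
  subspace_scale[OF subspace_rvec] subspace_sum[OF subspace_rvec]

lemma rvec_subset_cvec: "rvec N \<subseteq> cvec N"
  by (auto simp: rvec_def)

lemma continuous_on_coord: "continuous_on S (\<lambda>v. coord v i)"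
  by (simp add: linear_continuous_on bounded_linear_coord)

lemma closed_cvec: "closed (cvec N)"
proof -
  have "cvec N = (\<Inter>i\<in>{N..}. (\<lambda>v. coord v i) -` {0})"
    by (auto simp: cvec_def)
  moreover have "closed ((\<lambda>v. coord v i) -` {0})" for i
    by (intro closed_vimage) (auto simp: continuous_on_coord)
  ultimately show ?thesis by auto
qed

lemma closed_rvec: "closed (rvec N)"
proof -
  have "rvec N = cvec N \<inter> (\<Inter>i. (\<lambda>v. coord v i) -` \<real>)"
    by (auto simp: rvec_def)
  moreover have "closed ((\<lambda>v. coord v i) -` \<real>)" for i
    by (intro closed_vimage closed_complex_Reals) (auto simp: continuous_on_coord)
  ultimately show ?thesis using closed_cvec by (metis closed_Int closed_INT)
qed

lemma in_complex_ball: "z \<in> complex_ball N y r \<longleftrightarrow> z \<in> cvec N \<and> norm (z - y) < r"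
  by (simp add: complex_ball_def)

lemma complex_ball_mono:
  assumes "norm (z - y) + r \<le> r'"
  shows "complex_ball N z r \<subseteq> complex_ball N y r'"
proof
  fix w assume "w \<in> complex_ball N z r"
  then show "w \<in> complex_ball N y r'"
    using assms norm_triangle_ineq[of "w - z" "z - y"] by (auto simp: complex_ball_def)
qed

subsection \<open>Holomorphic curves\<close>

text \<open>
  Joint holomorphy in \<open>h\<close> and \<open>y\<close> is expressed by testing against holomorphic curves. The notion is
  stable under composition and locally uniform limits by one-variable function theory alone, so that
  no theory of several complex variables is needed.
\<close>

definition hcurve :: "nat \<Rightarrow> complex set \<Rightarrow> (complex \<Rightarrow> cseq) \<Rightarrow> bool" where
  "hcurve N W c \<longleftrightarrow> (\<forall>\<zeta>\<in>W. c \<zeta> \<in> cvec N) \<and> (\<forall>i. (\<lambda>\<zeta>. coord (c \<zeta>) i) holomorphic_on W)"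

definition jhol :: "nat \<Rightarrow> complex set \<Rightarrow> cseq set \<Rightarrow> (complex \<Rightarrow> cseq \<Rightarrow> cseq) \<Rightarrow> bool" where
  "jhol N D U G \<longleftrightarrow> (\<forall>W \<eta> c. open W \<longrightarrow> \<eta> holomorphic_on W \<longrightarrow> \<eta> ` W \<subseteq> D \<longrightarrow>
     hcurve N W c \<longrightarrow> c ` W \<subseteq> U \<longrightarrow> hcurve N W (\<lambda>\<zeta>. G (\<eta> \<zeta>) (c \<zeta>)))"

abbreviation chol :: "nat \<Rightarrow> cseq set \<Rightarrow> (cseq \<Rightarrow> cseq) \<Rightarrow> bool" where
  "chol N U g \<equiv> jhol N UNIV U (\<lambda>_. g)"

lemma jholI:
  assumes "\<And>W \<eta> c. open W \<Longrightarrow> \<eta> holomorphic_on W \<Longrightarrow> \<eta> ` W \<subseteq> D \<Longrightarrow> hcurve N W c \<Longrightarrow> c ` W \<subseteq> U \<Longrightarrow>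
    hcurve N W (\<lambda>\<zeta>. G (\<eta> \<zeta>) (c \<zeta>))"
  shows "jhol N D U G"
  using assms by (auto simp: jhol_def)

lemma jholD:
  assumes "jhol N D U G" "open W" "\<eta> holomorphic_on W" "\<eta> ` W \<subseteq> D" "hcurve N W c" "c ` W \<subseteq> U"
  shows "hcurve N W (\<lambda>\<zeta>. G (\<eta> \<zeta>) (c \<zeta>))"
  using assms by (auto simp: jhol_def)

lemma hcurve_const: "v \<in> cvec N \<Longrightarrow> hcurve N W (\<lambda>_. v)"
  by (auto simp: hcurve_def)

lemma hcurve_add: "hcurve N W c \<Longrightarrow> hcurve N W d \<Longrightarrow> hcurve N W (\<lambda>\<zeta>. c \<zeta> + d \<zeta>)"
  and hcurve_diff: "hcurve N W c \<Longrightarrow> hcurve N W d \<Longrightarrow> hcurve N W (\<lambda>\<zeta>. c \<zeta> - d \<zeta>)"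
  and hcurve_cscale: "\<eta> holomorphic_on W \<Longrightarrow> hcurve N W c \<Longrightarrow> hcurve N W (\<lambda>\<zeta>. cscale (\<eta> \<zeta>) (c \<zeta>))"
  and hcurve_scaleR: "hcurve N W c \<Longrightarrow> hcurve N W (\<lambda>\<zeta>. r *\<^sub>R c \<zeta>)"
  by (auto simp: hcurve_def cvec_intros apply_cscale scaleR_conv_of_real intro!: holomorphic_intros)

lemma hcurve_sum: "(\<And>i. i \<in> I \<Longrightarrow> hcurve N W (c i)) \<Longrightarrow> hcurve N W (\<lambda>\<zeta>. \<Sum>i\<in>I. c i \<zeta>)"
  by (auto simp: hcurve_def coord_sum intro!: cvec_intros holomorphic_intros)

lemmas hcurve_intros = hcurve_const hcurve_add hcurve_diff hcurve_cscale hcurve_scaleR hcurve_sum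

lemma hcurve_cong: "(\<And>\<zeta>. \<zeta> \<in> W \<Longrightarrow> c \<zeta> = d \<zeta>) \<Longrightarrow> hcurve N W c \<longleftrightarrow> hcurve N W d"
  unfolding hcurve_def by (auto cong: holomorphic_cong)

lemma hcurve_subset: "hcurve N W c \<Longrightarrow> W' \<subseteq> W \<Longrightarrow> hcurve N W' c"
  by (auto simp: hcurve_def intro: holomorphic_on_subset)

lemma hcurve_local:
  assumes "\<And>\<zeta>. \<zeta> \<in> W \<Longrightarrow> \<exists>V. open V \<and> \<zeta> \<in> V \<and> V \<subseteq> W \<and> hcurve N V c"
  shows "hcurve N W c"
  unfolding hcurve_def
proof (intro conjI ballI allI)
  fix \<zeta> assume "\<zeta> \<in> W"
  from assms[OF this] show "c \<zeta> \<in> cvec N" by (auto simp: hcurve_def)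
next
  fix i
  show "(\<lambda>\<zeta>. coord (c \<zeta>) i) holomorphic_on W"
    unfolding holomorphic_on_def
  proof
    fix \<zeta> assume "\<zeta> \<in> W"
    from assms[OF this] obtain V where V: "open V" "\<zeta> \<in> V" "hcurve N V c" by blast
    then have "(\<lambda>\<zeta>. coord (c \<zeta>) i) holomorphic_on V" by (simp add: hcurve_def)
    with V have "(\<lambda>\<zeta>. coord (c \<zeta>) i) field_differentiable (at \<zeta>)"
      using holomorphic_on_imp_differentiable_at by blast
    then show "(\<lambda>\<zeta>. coord (c \<zeta>) i) field_differentiable (at \<zeta> within W)"
      by (rule field_differentiable_at_within)
  qed
qed

text \<open>Weierstrass' theorem in every coordinate; that the limit stays in \<open>cvec N\<close>
  is closedness of that subspace.\<close>

lemma hcurve_uniform_limit: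
  assumes "open W" and c: "\<And>l. hcurve N W (c l)"
    and lim: "uniform_limit W c d sequentially"
  shows "hcurve N W d"
  unfolding hcurve_def
proof (intro conjI ballI allI)
  fix \<zeta> assume "\<zeta> \<in> W"
  then have "(\<lambda>l. c l \<zeta>) \<longlonglongrightarrow> d \<zeta>" using lim by (rule tendsto_uniform_limitI[rotated])
  moreover have "\<forall>l. c l \<zeta> \<in> cvec N" using c \<open>\<zeta> \<in> W\<close> by (auto simp: hcurve_def)
  ultimately show "d \<zeta> \<in> cvec N"
    using closed_sequentially[OF closed_cvec, of "\<lambda>l. c l \<zeta>"] by blast
next
  fix i
  show "(\<lambda>\<zeta>. coord (d \<zeta>) i) holomorphic_on W"
  proof (rule holomorphic_uniform_sequence[OF \<open>open W\<close>])
    show "(\<lambda>\<zeta>. coord (c l \<zeta>) i) holomorphic_on W" for l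
      using c by (auto simp: hcurve_def)
    fix \<zeta> assume "\<zeta> \<in> W"
    then obtain r where r: "r > 0" "cball \<zeta> r \<subseteq> W"
      using \<open>open W\<close> open_contains_cball by blast
    have "uniform_limit W (\<lambda>l \<zeta>. coord (c l \<zeta>) i) (\<lambda>\<zeta>. coord (d \<zeta>) i) sequentially"
      by (rule bounded_linear.uniform_limit[OF bounded_linear_coord lim])
    then show "\<exists>r>0. cball \<zeta> r \<subseteq> W \<and>
        uniform_limit (cball \<zeta> r) (\<lambda>l \<zeta>. coord (c l \<zeta>) i) (\<lambda>\<zeta>. coord (d \<zeta>) i) sequentially"
      using r uniform_limit_on_subset by blast
  qed
qed

lemma jhol_maps_cvec:
  assumes "jhol N D U G" "h \<in> D" "y \<in> U" "y \<in> cvec N"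
  shows "G h y \<in> cvec N"
proof -
  have "hcurve N UNIV (\<lambda>_. G h y)"
    by (rule jholD[OF assms(1), of UNIV "\<lambda>_. h" "\<lambda>_. y"]) (use assms in \<open>auto intro: hcurve_const\<close>)
  then show ?thesis by (auto simp: hcurve_def)
qed

lemma jhol_subset: "jhol N D U G \<Longrightarrow> D' \<subseteq> D \<Longrightarrow> U' \<subseteq> U \<Longrightarrow> jhol N D' U' G"
  unfolding jhol_def by (meson order_trans)

lemma jhol_fix: "jhol N D U G \<Longrightarrow> h \<in> D \<Longrightarrow> chol N U (G h)"
  by (rule jholI, drule jholD[where \<eta> = "\<lambda>_. h"]) auto

lemma jhol_hcurve: "jhol N D U G \<Longrightarrow> open D \<Longrightarrow> y \<in> U \<Longrightarrow> y \<in> cvec N \<Longrightarrow> hcurve N D (\<lambda>h. G h y)"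
  using jholD[of N D U G D "\<lambda>h. h" "\<lambda>_. y"] by (auto intro: hcurve_const holomorphic_on_ident)

lemma chol_jhol: "chol N U g \<Longrightarrow> jhol N D U (\<lambda>_. g)"
  by (rule jhol_subset) auto

lemma chol_hcurve: "chol N U g \<Longrightarrow> open W \<Longrightarrow> hcurve N W c \<Longrightarrow> c ` W \<subseteq> U \<Longrightarrow> hcurve N W (\<lambda>\<zeta>. g (c \<zeta>))"
  using jholD[where \<eta> = "\<lambda>_. 0" and G = "\<lambda>_. g" and D = UNIV] by auto

lemma jhol_add: "jhol N D U G \<Longrightarrow> jhol N D U H \<Longrightarrow> jhol N D U (\<lambda>h y. G h y + H h y)"
  and jhol_diff: "jhol N D U G \<Longrightarrow> jhol N D U H \<Longrightarrow> jhol N D U (\<lambda>h y. G h y - H h y)"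
  and jhol_scaleR: "jhol N D U G \<Longrightarrow> jhol N D U (\<lambda>h y. r *\<^sub>R G h y)"
  and jhol_cscale: "jhol N D U G \<Longrightarrow> jhol N D U (\<lambda>h y. cscale c (G h y))"
  and jhol_cscale_param: "jhol N D U G \<Longrightarrow> jhol N D U (\<lambda>h y. cscale h (G h y))"
  by (auto simp: jhol_def intro!: hcurve_intros)

lemma jhol_ident: "jhol N D U (\<lambda>h y. y)"
  by (auto simp: jhol_def)

lemma jhol_zero: "jhol N D U (\<lambda>h y. 0)"
  by (auto simp: jhol_def intro!: hcurve_intros cvec_intros)

lemma jhol_sum: "(\<And>i. i \<in> I \<Longrightarrow> jhol N D U (G i)) \<Longrightarrow> jhol N D U (\<lambda>h y. \<Sum>i\<in>I. G i h y)"
  by (auto simp: jhol_def intro!: hcurve_intros)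

lemmas jhol_intros = jhol_add jhol_diff jhol_scaleR jhol_cscale jhol_cscale_param jhol_ident jhol_zero jhol_sum

lemma jhol_cong:
  assumes G: "jhol N D U G" and eq: "\<And>h y. h \<in> D \<Longrightarrow> y \<in> U \<Longrightarrow> H h y = G h y"
  shows "jhol N D U H"
proof (rule jholI)
  fix W \<eta> c assume *: "open W" "\<eta> holomorphic_on W" "\<eta> ` W \<subseteq> D" "hcurve N W c" "c ` W \<subseteq> U"
  have "hcurve N W (\<lambda>\<zeta>. H (\<eta> \<zeta>) (c \<zeta>)) \<longleftrightarrow> hcurve N W (\<lambda>\<zeta>. G (\<eta> \<zeta>) (c \<zeta>))"
    by (rule hcurve_cong, rule eq) (use * in blast)+
  then show "hcurve N W (\<lambda>\<zeta>. H (\<eta> \<zeta>) (c \<zeta>))" using jholD[OF G *] by simp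
qed

text \<open>The image of a test curve under \<open>Y\<close> is again a test curve, so composition
  needs no chain rule in several variables.\<close>

lemma jhol_compose:
  assumes G: "jhol N D U' G" and Y: "jhol N D U Y"
    and maps: "\<And>h y. h \<in> D \<Longrightarrow> y \<in> U \<Longrightarrow> Y h y \<in> U'"
  shows "jhol N D U (\<lambda>h y. G h (Y h y))"
proof (rule jholI)
  fix W \<eta> c assume *: "open W" "\<eta> holomorphic_on W" "\<eta> ` W \<subseteq> D" "hcurve N W c" "c ` W \<subseteq> U"
  show "hcurve N W (\<lambda>\<zeta>. G (\<eta> \<zeta>) (Y (\<eta> \<zeta>) (c \<zeta>)))"
  proof (rule jholD[OF G *(1-3) jholD[OF Y *]])
    show "(\<lambda>\<zeta>. Y (\<eta> \<zeta>) (c \<zeta>)) ` W \<subseteq> U'"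
      by (rule image_subsetI, rule maps) (use * in blast)+
  qed
qed

text \<open>The stages, the flow and the Taylor coefficients in \<open>h\<close> all become
  holomorphic through this lemma, as limits of explicit expressions at a rate \<open>e\<close>
  common to all \<open>h\<close> and \<open>y\<close>.\<close>

lemma jhol_uniform_limit:
  assumes G: "\<And>l. jhol N D U (G l)"
    and lim: "\<And>h y l. h \<in> D \<Longrightarrow> y \<in> U \<Longrightarrow> norm (G l h y - H h y) \<le> e l"
    and e: "e \<longlonglongrightarrow> 0"
  shows "jhol N D U H"
proof (rule jholI)
  fix W \<eta> c assume *: "open W" "\<eta> holomorphic_on W" "\<eta> ` W \<subseteq> D" "hcurve N W c" "c ` W \<subseteq> U"
  show "hcurve N W (\<lambda>\<zeta>. H (\<eta> \<zeta>) (c \<zeta>))"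
  proof (rule hcurve_uniform_limit[OF \<open>open W\<close>])
    show "hcurve N W (\<lambda>\<zeta>. G l (\<eta> \<zeta>) (c \<zeta>))" for l by (rule jholD[OF G *])
    show "uniform_limit W (\<lambda>l \<zeta>. G l (\<eta> \<zeta>) (c \<zeta>)) (\<lambda>\<zeta>. H (\<eta> \<zeta>) (c \<zeta>)) sequentially"
    proof (rule uniform_limitI)
      fix \<epsilon> :: real assume "\<epsilon> > 0"
      with e have "\<forall>\<^sub>F l in sequentially. e l < \<epsilon>" by (rule order_tendstoD)
      then show "\<forall>\<^sub>F l in sequentially. \<forall>\<zeta>\<in>W. dist (G l (\<eta> \<zeta>) (c \<zeta>)) (H (\<eta> \<zeta>) (c \<zeta>)) < \<epsilon>"
      proof eventually_elim
        case (elim l)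
        show ?case
        proof
          fix \<zeta> assume "\<zeta> \<in> W"
          then have "norm (G l (\<eta> \<zeta>) (c \<zeta>) - H (\<eta> \<zeta>) (c \<zeta>)) \<le> e l"
            using * by (intro lim) auto
          then show "dist (G l (\<eta> \<zeta>) (c \<zeta>)) (H (\<eta> \<zeta>) (c \<zeta>)) < \<epsilon>"
            using elim by (simp add: dist_norm)
        qed
      qed
    qed
  qed
qed


section \<open>Curves and fields in terms of complex derivatives\<close>

definition cunit :: "nat \<Rightarrow> cseq" where
  "cunit i = Bcontfun (\<lambda>j. if j = i then 1 else 0)"

lemma coord_cunit: "coord (cunit i) j = (if j = i then 1 else 0)"
proof -
  have "(\<lambda>j. if j = i then 1 else 0 :: complex) \<in> bcontfun"
    by (rule bcontfun_normI[where b = 1]) auto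
  then show ?thesis by (simp add: cunit_def Bcontfun_inverse)
qed

lemma cvec_expansion: "v \<in> cvec N \<Longrightarrow> v = (\<Sum>i<N. cscale (coord v i) (cunit i))"
proof (rule bcontfun_eqI)
  fix j assume v: "v \<in> cvec N"
  have "coord (\<Sum>i<N. cscale (coord v i) (cunit i)) j = (\<Sum>i<N. if i = j then coord v j else 0)"
    unfolding coord_sum apply_cscale coord_cunit by (intro sum.cong) auto
  then show "coord v j = coord (\<Sum>i<N. cscale (coord v i) (cunit i)) j"
    using v by (simp add: cvec_def)
qed

lemma cunit_in_cvec: "i < N \<Longrightarrow> cunit i \<in> cvec N"
  by (auto simp: cvec_def coord_cunit)

text \<open>The norm is a supremum over all indices, so derivatives of the single coordinates do not
  by themselves give a derivative of the curve. They do here because the expansion in unit vectors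
  is a finite sum.\<close>

lemma hcurve_has_derivative:
  assumes "open W" "hcurve N W c" "\<zeta> \<in> W"
  obtains v where "v \<in> cvec N" "(c has_derivative (\<lambda>t. cscale t v)) (at \<zeta> within W)"
proof -
  define c' where "c' i = deriv (\<lambda>\<zeta>. coord (c \<zeta>) i) \<zeta>" for i
  define v where "v = (\<Sum>i<N. cscale (c' i) (cunit i))"
  have d: "((\<lambda>\<zeta>. coord (c \<zeta>) i) has_derivative (\<lambda>t. t * c' i)) (at \<zeta> within W)" for i
    using assms holomorphic_derivI[of "\<lambda>\<zeta>. coord (c \<zeta>) i" W \<zeta>]
    by (auto simp: hcurve_def c'_def has_field_derivative_def mult.commute[of _ "deriv _ _"]
        intro: has_derivative_at_withinI)
  have "((\<lambda>\<zeta>. \<Sum>i<N. cscale (coord (c \<zeta>) i) (cunit i)) has_derivative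
      (\<lambda>t. \<Sum>i<N. cscale (t * c' i) (cunit i))) (at \<zeta> within W)"
    by (intro has_derivative_sum bounded_linear.has_derivative[OF bounded_linear_cscale_left] d)
  moreover have "(\<lambda>t. \<Sum>i<N. cscale (t * c' i) (cunit i)) = (\<lambda>t. cscale t v)"
    by (simp add: v_def cscale_sum_right cscale_cscale)
  ultimately have "((\<lambda>\<zeta>. \<Sum>i<N. cscale (coord (c \<zeta>) i) (cunit i)) has_derivative
      (\<lambda>t. cscale t v)) (at \<zeta> within W)" by simp
  then have "(c has_derivative (\<lambda>t. cscale t v)) (at \<zeta> within W)"
    by (rule has_derivative_transform[OF \<open>\<zeta> \<in> W\<close>, rotated])
      (rule cvec_expansion, use assms(2) in \<open>simp add: hcurve_def\<close>)
  moreover have "v \<in> cvec N" by (auto simp: v_def intro!: cvec_intros cunit_in_cvec)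
  ultimately show ?thesis using that by blast
qed

lemma hcurve_continuous_on:
  assumes "open W" "hcurve N W c"
  shows "continuous_on W c"
  unfolding continuous_on_eq_continuous_within
proof
  fix \<zeta> assume "\<zeta> \<in> W"
  from hcurve_has_derivative[OF assms this] show "continuous (at \<zeta> within W) c"
    using has_derivative_continuous by metis
qed

text \<open>A test curve is continuous, so near each parameter value it stays in one of the given
  balls, and holomorphy of a curve is a local matter.\<close>

lemma chol_local:
  assumes "\<And>y. y \<in> U \<Longrightarrow> \<exists>r>0. chol N (complex_ball N y r) g"
  shows "chol N U g"
proof (rule jholI)
  fix W and \<eta> :: "complex \<Rightarrow> complex" and c
  assume *: "open W" "hcurve N W c" "c ` W \<subseteq> U"
  show "hcurve N W (\<lambda>\<zeta>. g (c \<zeta>))"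
  proof (rule hcurve_local)
    fix \<zeta> assume "\<zeta> \<in> W"
    with * have "c \<zeta> \<in> U" by blast
    from assms[OF this] obtain r where r: "r > 0" "chol N (complex_ball N (c \<zeta>) r) g" by blast
    let ?V = "W \<inter> c -` ball (c \<zeta>) r"
    have V: "open ?V"
      using continuous_open_preimage[OF hcurve_continuous_on] * by auto
    have "hcurve N ?V (\<lambda>\<zeta>. g (c \<zeta>))"
      by (rule chol_hcurve[OF r(2) V hcurve_subset[OF *(2)]])
        (use *(2) in \<open>auto simp: complex_ball_def hcurve_def dist_norm norm_minus_commute\<close>)
    then show "\<exists>V. open V \<and> \<zeta> \<in> V \<and> V \<subseteq> W \<and> hcurve N V (\<lambda>\<zeta>. g (c \<zeta>))"
      using V \<open>\<zeta> \<in> W\<close> r by (intro exI[of _ ?V]) auto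
  qed
qed

text \<open>Chain rule along a test curve: complex linearity of \<open>D\<close> turns the
  derivative of the composition into multiplication by \<open>coord (D v) i\<close>. From here on,
  analyticity of a field enters only as \<open>chol\<close>.\<close>

lemma chol_if_analytic:
  assumes "complex_analytic_on N U f"
  shows "chol N U f"
proof (rule jholI)
  fix W and \<eta> :: "complex \<Rightarrow> complex" and c
  assume *: "open W" "hcurve N W c" "c ` W \<subseteq> U"
  have "(\<lambda>\<zeta>. coord (f (c \<zeta>)) i) holomorphic_on W" for i
    unfolding holomorphic_on_def
  proof
    fix \<zeta> assume "\<zeta> \<in> W"
    obtain v where v: "v \<in> cvec N" "(c has_derivative (\<lambda>t. cscale t v)) (at \<zeta> within W)"
      by (rule hcurve_has_derivative[OF *(1,2) \<open>\<zeta> \<in> W\<close>])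
    from *(3) \<open>\<zeta> \<in> W\<close> have "c \<zeta> \<in> U" by blast
    with assms have "\<exists>D. (f has_derivative D) (at (c \<zeta>) within U) \<and>
        (\<forall>c. \<forall>v\<in>cvec N. D (cscale c v) = cscale c (D v))"
      by (simp add: complex_analytic_on_def)
    then obtain D where D: "(f has_derivative D) (at (c \<zeta>) within U)"
      "\<And>c v. v \<in> cvec N \<Longrightarrow> D (cscale c v) = cscale c (D v)"
      by auto
    have "((\<lambda>\<zeta>. f (c \<zeta>)) has_derivative (\<lambda>t. D (cscale t v))) (at \<zeta> within W)"
      by (rule has_derivative_in_compose[OF v(2) has_derivative_subset[OF D(1) *(3)]])
    then have "((\<lambda>\<zeta>. coord (f (c \<zeta>)) i) has_derivative (\<lambda>t. coord (D (cscale t v)) i)) (at \<zeta> within W)"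
      by (rule bounded_linear.has_derivative[OF bounded_linear_coord])
    then have "((\<lambda>\<zeta>. coord (f (c \<zeta>)) i) has_derivative (\<lambda>t. coord (D v) i * t)) (at \<zeta> within W)"
      by (simp add: D(2) v(1) apply_cscale mult.commute[of _ "coord (D v) i"])
    then have "((\<lambda>\<zeta>. coord (f (c \<zeta>)) i) has_field_derivative coord (D v) i) (at \<zeta> within W)"
      by (simp add: has_field_derivative_def)
    then show "(\<lambda>\<zeta>. coord (f (c \<zeta>)) i) field_differentiable (at \<zeta> within W)"
      unfolding field_differentiable_def by (rule exI)
  qed
  moreover have "f (c \<zeta>) \<in> cvec N" if "\<zeta> \<in> W" for \<zeta>
  proof -
    have "c \<zeta> \<in> U" using that *(3) by blast
    with assms show ?thesis by (simp add: complex_analytic_on_def)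
  qed
  ultimately show "hcurve N W (\<lambda>\<zeta>. f (c \<zeta>))" by (simp add: hcurve_def)
qed

subsection \<open>Taylor expansions and Cauchy estimates\<close>

text \<open>The \<open>k\<close>-th Taylor coefficient at 0, taken coordinate by coordinate.
  \<open>Bcontfun\<close> is meaningful only for a bounded sequence, which Cauchy's estimate
  supplies in \<open>coord_tcoef\<close>.\<close>

definition tcoef :: "(complex \<Rightarrow> cseq) \<Rightarrow> nat \<Rightarrow> cseq" where
  "tcoef c k = Bcontfun (\<lambda>i. (deriv ^^ k) (\<lambda>\<zeta>. coord (c \<zeta>) i) 0 / fact k)"

text \<open>The function need not extend continuously to the closed disc. Cauchy's inequality is
  therefore applied on circles of radius \<open>r < R\<close>, and \<open>r\<close> tends to
  \<open>R\<close>.\<close>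

lemma taylor_coeff_bound:
  assumes hol: "f holomorphic_on ball 0 R" and "R > 0"
    and M: "\<And>\<zeta>. \<zeta> \<in> ball 0 R \<Longrightarrow> cmod (f \<zeta>) \<le> M"
  shows "cmod ((deriv ^^ k) f 0 / fact k) \<le> M / R ^ k"
proof -
  have *: "cmod ((deriv ^^ k) f 0 / fact k) * r ^ k \<le> M" if r: "0 < r" "r < R" for r
  proof -
    have "cmod ((deriv ^^ k) f 0) \<le> fact k * M / r ^ k"
    proof (rule Cauchy_inequality[of f 0 r])
      show "f holomorphic_on ball 0 r"
        using hol by (rule holomorphic_on_subset) (use r in auto)
      show "continuous_on (cball 0 r) f"
        using holomorphic_on_imp_continuous_on[OF hol] by (rule continuous_on_subset) (use r in auto)
      show "cmod (f x) \<le> M" if "cmod (0 - x) = r" for x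
        using M that r by simp
    qed (use r in auto)
    then show ?thesis using r by (simp add: norm_divide field_simps)
  qed
  have lim: "((\<lambda>r. cmod ((deriv ^^ k) f 0 / fact k) * r ^ k) \<longlongrightarrow>
      cmod ((deriv ^^ k) f 0 / fact k) * R ^ k) (at_left R)"
    by (intro tendsto_intros)
  have "cmod ((deriv ^^ k) f 0 / fact k) * R ^ k \<le> M"
  proof (rule tendsto_upperbound[OF lim])
    have "\<forall>\<^sub>F r in at_left R. r \<in> {0<..<R}"
      using \<open>R > 0\<close> eventually_at_left_real by blast
    then show "\<forall>\<^sub>F r in at_left R. cmod ((deriv ^^ k) f 0 / fact k) * r ^ k \<le> M"
      by (rule eventually_mono) (rule *, auto)
  qed simp
  then show ?thesis using \<open>R > 0\<close> by (simp add: field_simps)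
qed

text \<open>The tail is dominated by a geometric series of ratio \<open>cmod \<zeta> / R\<close>; on
  half the radius the sum of that series costs the factor 2.\<close>

lemma taylor_remainder_bound:
  assumes hol: "f holomorphic_on ball 0 R" and "R > 0"
    and M: "\<And>\<zeta>. \<zeta> \<in> ball 0 R \<Longrightarrow> cmod (f \<zeta>) \<le> M"
    and \<zeta>: "cmod \<zeta> \<le> R / 2"
  shows "cmod (f \<zeta> - (\<Sum>k<n. (deriv ^^ k) f 0 / fact k * \<zeta> ^ k)) \<le> 2 * M * (cmod \<zeta> / R) ^ n"
proof -
  define t where "t k = (deriv ^^ k) f 0 / fact k * \<zeta> ^ k" for k
  define q where "q = cmod \<zeta> / R"
  have q: "0 \<le> q" "q \<le> 1/2" using \<zeta> \<open>R > 0\<close> by (auto simp: q_def field_simps)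
  have "0 \<in> ball (0::complex) R" using \<open>R > 0\<close> by simp
  from M[OF this] have "M \<ge> 0" by (rule order_trans[OF norm_ge_zero])
  have "\<zeta> \<in> ball 0 R" using \<zeta> \<open>R > 0\<close> by simp
  from holomorphic_power_series[OF hol this] have "t sums f \<zeta>" by (simp only: t_def[abs_def] diff_zero)
  then have "(\<lambda>k. t (k + n)) sums (f \<zeta> - (\<Sum>k<n. t k))"
    by (rule sums_split_initial_segment)
  then have "f \<zeta> - (\<Sum>k<n. t k) = (\<Sum>k. t (k + n))" by (simp add: sums_iff)
  also have "cmod \<dots> \<le> (\<Sum>k. M * q ^ n * q ^ k)"
  proof (rule norm_suminf_le)
    fix k
    have "cmod (t (k + n)) = cmod ((deriv ^^ (k+n)) f 0 / fact (k+n)) * cmod \<zeta> ^ (k + n)"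
      by (simp add: t_def norm_mult norm_power norm_divide)
    also have "\<dots> \<le> M / R ^ (k+n) * cmod \<zeta> ^ (k + n)"
      by (intro mult_right_mono taylor_coeff_bound[OF hol \<open>R > 0\<close> M]) auto
    also have "\<dots> = M * q ^ n * q ^ k"
      using \<open>R > 0\<close> by (simp add: q_def power_divide power_add mult_ac)
    finally show "cmod (t (k + n)) \<le> M * q ^ n * q ^ k" .
  next
    show "summable (\<lambda>k. M * q ^ n * q ^ k)"
      using q by (intro summable_mult summable_geometric) auto
  qed
  also have "\<dots> = M * q ^ n * (1 / (1 - q))"
    using q by (subst suminf_mult) (auto simp: suminf_geometric intro: summable_geometric)
  also have "\<dots> \<le> M * q ^ n * 2"
    using q \<open>M \<ge> 0\<close> by (intro mult_left_mono) (auto simp: field_simps)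
  finally show ?thesis by (simp add: t_def q_def mult_ac)
qed

text \<open>The bound \<open>M\<close> holds for every coordinate, so the scalar estimates pass to
  the supremum norm without a factor depending on \<open>N\<close>.\<close>

locale bounded_hcurve =
  fixes N :: nat and R M :: real and c :: "complex \<Rightarrow> cseq"
  assumes hcurve: "hcurve N (ball 0 R) c" and R: "R > 0"
    and bound: "\<And>\<zeta>. \<zeta> \<in> ball 0 R \<Longrightarrow> norm (c \<zeta>) \<le> M"
begin

lemma M_nonneg: "M \<ge> 0"
  by (rule order_trans[OF norm_ge_zero bound[of 0]]) (simp add: R)

lemma coord_bound: "\<zeta> \<in> ball 0 R \<Longrightarrow> cmod (coord (c \<zeta>) i) \<le> M"
  by (rule order_trans[OF norm_bounded bound])

lemma hol: "(\<lambda>\<zeta>. coord (c \<zeta>) i) holomorphic_on ball 0 R"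
  using hcurve by (simp add: hcurve_def)

lemma coord_tcoef: "coord (tcoef c k) i = (deriv ^^ k) (\<lambda>\<zeta>. coord (c \<zeta>) i) 0 / fact k"
proof -
  have "(\<lambda>i. (deriv ^^ k) (\<lambda>\<zeta>. coord (c \<zeta>) i) 0 / fact k) \<in> bcontfun"
    by (rule bcontfun_normI[where b = "M / R ^ k"])
      (auto intro: taylor_coeff_bound[OF hol R coord_bound])
  then show ?thesis by (simp add: tcoef_def Bcontfun_inverse)
qed

lemma norm_tcoef: "norm (tcoef c k) \<le> M / R ^ k"
  by (rule norm_bound) (simp only: coord_tcoef taylor_coeff_bound[OF hol R coord_bound])

lemma tcoef_remainder:
  assumes "cmod \<zeta> \<le> R / 2"
  shows "norm (c \<zeta> - (\<Sum>k<n. cscale (\<zeta> ^ k) (tcoef c k))) \<le> 2 * M * (cmod \<zeta> / R) ^ n"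
proof (rule norm_bound)
  fix i
  have "coord (c \<zeta> - (\<Sum>k<n. cscale (\<zeta> ^ k) (tcoef c k))) i =
      coord (c \<zeta>) i - (\<Sum>k<n. (deriv ^^ k) (\<lambda>\<zeta>. coord (c \<zeta>) i) 0 / fact k * \<zeta> ^ k)"
    by (simp add: coord_sum apply_cscale coord_tcoef mult.commute)
  then show "cmod (coord (c \<zeta> - (\<Sum>k<n. cscale (\<zeta> ^ k) (tcoef c k))) i) \<le> 2 * M * (cmod \<zeta> / R) ^ n"
    using taylor_remainder_bound[OF hol R coord_bound assms] by simp
qed

lemma tcoef_remainder_real:
  assumes "\<bar>h\<bar> \<le> R / 2"
  shows "norm (c (of_real h) - (\<Sum>k<n. h ^ k *\<^sub>R tcoef c k)) \<le> 2 * M * (\<bar>h\<bar> / R) ^ n"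
  using tcoef_remainder[of "of_real h" n] assms by (simp flip: of_real_power add: cscale_of_real)

lemma tcoef_0: "tcoef c 0 = c 0"
  using tcoef_remainder[of 0 1] R by simp

text \<open>Smallness for positive real \<open>h\<close> suffices: once the lower coefficients
  vanish, division by \<open>h ^ k\<close> leaves coefficient \<open>k\<close> up to an error of
  size \<open>h\<close>, because \<open>k < n\<close>.\<close>

lemma tcoef_eq_0:
  assumes "\<epsilon> > 0" and small: "\<And>h. 0 < h \<Longrightarrow> h < \<epsilon> \<Longrightarrow> norm (c (of_real h)) \<le> C * h ^ n"
  shows "k < n \<Longrightarrow> tcoef c k = 0"
proof (induction k rule: less_induct)
  case (less k)
  have ev: "norm (tcoef c k) \<le> (\<bar>C\<bar> + 2 * M / R ^ Suc k) * h"
    if h: "0 < h" "h < min 1 (min \<epsilon> (R / 2))" for h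
  proof -
    have "(\<Sum>j<Suc k. h ^ j *\<^sub>R tcoef c j) = h ^ k *\<^sub>R tcoef c k"
      using less by simp
    then have "norm (h ^ k *\<^sub>R tcoef c k) \<le> norm (c (of_real h)) +
        norm (c (of_real h) - (\<Sum>j<Suc k. h ^ j *\<^sub>R tcoef c j))"
      using norm_triangle_sub[of "h ^ k *\<^sub>R tcoef c k" "c (of_real h)"]
      by (simp add: norm_minus_commute)
    also have "\<dots> \<le> C * h ^ n + 2 * M * (\<bar>h\<bar> / R) ^ Suc k"
      by (intro add_mono small tcoef_remainder_real) (use h in auto)
    also have "\<dots> \<le> \<bar>C\<bar> * h ^ Suc k + 2 * M * (\<bar>h\<bar> / R) ^ Suc k"
    proof (intro add_right_mono mult_mono)
      show "h ^ n \<le> h ^ Suc k"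
        using h less.prems by (intro power_decreasing) auto
    qed (use h in auto)
    also have "\<dots> = h ^ k * ((\<bar>C\<bar> + 2 * M / R ^ Suc k) * h)"
      using h by (simp add: power_divide algebra_simps)
    finally show ?thesis using h by simp
  qed
  have "norm (tcoef c k) \<le> 0"
  proof (rule tendsto_lowerbound)
    show "((\<lambda>h. (\<bar>C\<bar> + 2 * M / R ^ Suc k) * h) \<longlongrightarrow> 0) (at_right 0)"
      by (auto intro!: tendsto_eq_intros)
    have "\<forall>\<^sub>F h in at_right 0. h \<in> {0<..<min 1 (min \<epsilon> (R / 2))}"
      using \<open>\<epsilon> > 0\<close> R by (intro eventually_at_right_real) auto
    then show "\<forall>\<^sub>F h in at_right 0. norm (tcoef c k) \<le> (\<bar>C\<bar> + 2 * M / R ^ Suc k) * h"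
      by (rule eventually_mono) (rule ev, auto)
  qed simp
  then show ?case by simp
qed

lemma bound_if_tcoef_0:
  assumes "\<And>k. k < n \<Longrightarrow> tcoef c k = 0" "cmod \<zeta> \<le> R / 2"
  shows "norm (c \<zeta>) \<le> 2 * M * (cmod \<zeta> / R) ^ n"
  using tcoef_remainder[OF assms(2), of n] assms(1) by simp

end

lemma tcoef_diff:
  assumes c: "bounded_hcurve N R M c" and d: "bounded_hcurve N R M' d"
  shows "tcoef (\<lambda>\<zeta>. c \<zeta> - d \<zeta>) k = tcoef c k - tcoef d k"
proof -
  interpret c: bounded_hcurve N R M c by (rule c)
  interpret d: bounded_hcurve N R M' d by (rule d)
  interpret e: bounded_hcurve N R "M + M'" "\<lambda>\<zeta>. c \<zeta> - d \<zeta>"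
  proof
    show "hcurve N (ball 0 R) (\<lambda>\<zeta>. c \<zeta> - d \<zeta>)" by (intro hcurve_intros c.hcurve d.hcurve)
    show "R > 0" by (rule c.R)
    show "norm (c \<zeta> - d \<zeta>) \<le> M + M'" if "\<zeta> \<in> ball 0 R" for \<zeta>
      using c.bound[OF that] d.bound[OF that] norm_triangle_ineq4[of "c \<zeta>" "d \<zeta>"] by linarith
  qed
  show ?thesis
  proof (rule bcontfun_eqI)
    fix i
    have "(deriv ^^ k) (\<lambda>\<zeta>. coord (c \<zeta>) i - coord (d \<zeta>) i) 0 =
        (deriv ^^ k) (\<lambda>\<zeta>. coord (c \<zeta>) i) 0 - (deriv ^^ k) (\<lambda>\<zeta>. coord (d \<zeta>) i) 0"
      by (rule higher_deriv_diff[OF c.hol d.hol]) (use c.R in auto)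
    then show "coord (tcoef (\<lambda>\<zeta>. c \<zeta> - d \<zeta>) k) i = coord (tcoef c k - tcoef d k) i"
      by (simp add: e.coord_tcoef c.coord_tcoef d.coord_tcoef diff_divide_distrib)
  qed
qed

text \<open>One-variable Cauchy estimate on the complex line through \<open>y\<close> and
  \<open>z\<close>. The line stays in the ball for parameters in the disc of radius
  \<open>R = \<delta> / norm (z - y)\<close>, and \<open>z\<close> is the parameter 1. For
  \<open>R \<ge> 2\<close> the remainder after the constant term is at most
  \<open>2 * M / R\<close>; otherwise the trivial bound \<open>2 * M\<close> is below
  \<open>4 * M / R\<close>.\<close>

lemma chol_lipschitz_center:
  assumes g: "chol N (complex_ball N y \<delta>) g"
    and M: "\<And>w. w \<in> complex_ball N y \<delta> \<Longrightarrow> norm (g w) \<le> M"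
    and y: "y \<in> cvec N" and z: "z \<in> complex_ball N y \<delta>"
  shows "norm (g z - g y) \<le> 4 * M / \<delta> * norm (z - y)"
proof (cases "z = y")
  case False
  have \<delta>: "\<delta> > 0"
    using z norm_ge_zero[of "z - y"] unfolding in_complex_ball by linarith
  define R where "R = \<delta> / norm (z - y)"
  have R: "R > 0" using \<delta> False by (simp add: R_def)
  define c where "c \<zeta> = y + cscale \<zeta> (z - y)" for \<zeta>
  have zc: "z \<in> cvec N" using z by (simp add: complex_ball_def)
  have in_ball: "c \<zeta> \<in> complex_ball N y \<delta>" if "\<zeta> \<in> ball 0 R" for \<zeta>
    using that False y zc
    by (auto simp: c_def complex_ball_def R_def norm_cscale field_simps intro!: cvec_intros)
  have c1: "c 1 = z" "c 0 = y" by (auto simp: c_def)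
  interpret bounded_hcurve N R M "\<lambda>\<zeta>. g (c \<zeta>)"
  proof
    have "hcurve N (ball 0 R) c"
      unfolding c_def by (intro hcurve_intros cvec_intros y zc holomorphic_intros)
    then show "hcurve N (ball 0 R) (\<lambda>\<zeta>. g (c \<zeta>))"
      by (rule chol_hcurve[OF g open_ball]) (use in_ball in auto)
  qed (use R M in_ball in auto)
  have M0: "M \<ge> 0" by (rule M_nonneg)
  show ?thesis
  proof (cases "R \<ge> 2")
    case True
    have "norm (g (c 1) - g (c 0)) \<le> 2 * M * (1 / R)"
      using tcoef_remainder[of 1 1] True by (simp add: tcoef_0)
    also have "\<dots> = 2 * M / \<delta> * norm (z - y)" using False \<delta> by (simp add: R_def)
    also have "\<dots> \<le> 4 * M / \<delta> * norm (z - y)"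
      using M0 \<delta> by (intro mult_right_mono divide_right_mono) auto
    finally show ?thesis by (simp add: c1)
  next
    case False
    have "norm (g z - g y) \<le> M + M"
      using M[OF z] M[of y] y \<delta> norm_triangle_ineq4[of "g z" "g y"]
      by (simp add: complex_ball_def)
    also have "\<dots> = M * 2" by simp
    also have "\<dots> \<le> M * (4 / R)"
      using False R M0 by (intro mult_left_mono) (auto simp: field_simps)
    also have "\<dots> = 4 * M / \<delta> * norm (z - y)" by (simp add: R_def)
    finally show ?thesis .
  qed
qed simp

text \<open>If the points are closer than \<open>\<delta> / 2\<close>, the ball of that radius about
  \<open>w\<close> fits into the large one; if not, the trivial bound \<open>2 * M\<close>
  suffices.\<close>

lemma chol_lipschitz_half_ball:
  assumes g: "chol N (complex_ball N y \<delta>) g"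
    and M: "\<And>w. w \<in> complex_ball N y \<delta> \<Longrightarrow> norm (g w) \<le> M"
    and z: "z \<in> complex_ball N y (\<delta>/2)" and w: "w \<in> complex_ball N y (\<delta>/2)"
  shows "norm (g z - g w) \<le> 8 * M / \<delta> * norm (z - w)"
proof -
  have \<delta>: "\<delta> > 0"
    using z norm_ge_zero[of "z - y"] unfolding in_complex_ball by linarith
  have sub: "complex_ball N w (\<delta>/2) \<subseteq> complex_ball N y \<delta>"
    by (rule complex_ball_mono) (use w in \<open>auto simp: complex_ball_def\<close>)
  have zw: "z \<in> complex_ball N y \<delta>" "w \<in> complex_ball N y \<delta>"
    using z w \<delta> by (auto simp: complex_ball_def)
  have M0: "M \<ge> 0" using M[OF zw(1)] norm_ge_zero[of "g z"] by linarith
  show ?thesis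
  proof (cases "norm (z - w) < \<delta>/2")
    case True
    have "norm (g z - g w) \<le> 4 * M / (\<delta>/2) * norm (z - w)"
      by (rule chol_lipschitz_center[OF jhol_subset[OF g order_refl sub]])
        (use sub M True z w in \<open>auto simp: complex_ball_def\<close>)
    then show ?thesis by (simp add: mult_ac)
  next
    case False
    have "norm (g z - g w) \<le> M * 2"
      using M[OF zw(1)] M[OF zw(2)] norm_triangle_ineq4[of "g z" "g w"] by simp
    also have "\<dots> \<le> M * (8 / \<delta> * norm (z - w))"
      using False \<delta> M0 by (intro mult_left_mono) (auto simp: field_simps)
    finally show ?thesis by (simp add: mult_ac)
  qed
qed

text \<open>By induction, coefficient \<open>k\<close> is the limit of (G h - lower terms) / h ^ k
  along real \<open>h\<close> tending to 0. The remainder estimate makes this limit uniform in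
  \<open>y\<close>, so it preserves holomorphy.\<close>

lemma jhol_tcoef:
  assumes G: "jhol N (ball 0 R) U G" and "R > 0" and U: "U \<subseteq> cvec N"
    and M: "\<And>h y. h \<in> ball 0 R \<Longrightarrow> y \<in> U \<Longrightarrow> norm (G h y) \<le> M"
  shows "chol N U (\<lambda>y. tcoef (\<lambda>h. G h y) k)"
proof (induction k rule: less_induct)
  case (less k)
  \<comment> \<open>The sequence starts at \<open>R / 2\<close>, the largest step covered by the
    remainder estimate.\<close>
  define h where "h l = R / 2 / real (Suc l)" for l
  have h: "0 < h l" "h l \<le> R / 2" for l
    using \<open>R > 0\<close> by (auto simp: h_def field_simps)
  have in_ball: "of_real (h l) \<in> ball (0::complex) R" for l
    using h[of l] \<open>R > 0\<close> by simp
  define H where "H l y = (1 / h l ^ k) *\<^sub>R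
    (G (of_real (h l)) y - (\<Sum>j<k. h l ^ j *\<^sub>R tcoef (\<lambda>h. G h y) j))" for l y
  show ?case
  proof (rule jhol_uniform_limit)
    show "chol N U (H l)" for l
      unfolding H_def by (intro jhol_intros jhol_fix[OF G in_ball] less) auto
  next
    fix l :: nat and y assume y: "y \<in> U"
    interpret bounded_hcurve N R M "\<lambda>h. G h y"
      by unfold_locales (use y U M G \<open>R > 0\<close> in \<open>auto intro: jhol_hcurve\<close>)
    define Z where "Z = G (of_real (h l)) y - (\<Sum>j<Suc k. h l ^ j *\<^sub>R tcoef (\<lambda>h. G h y) j)"
    have "norm Z \<le> 2 * M * (h l / R) ^ Suc k"
      using tcoef_remainder_real[of "h l" "Suc k"] h[of l] by (simp add: Z_def)
    have "H l y - tcoef (\<lambda>h. G h y) k = (1 / h l ^ k) *\<^sub>R Z"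
      using h[of l] by (simp add: H_def Z_def algebra_simps)
    also have "norm \<dots> = (1 / h l ^ k) * norm Z"
      using h[of l] by simp
    also have "\<dots> \<le> (1 / h l ^ k) * (2 * M * (h l / R) ^ Suc k)"
      using \<open>norm Z \<le> _\<close> h[of l] by (intro mult_left_mono) auto
    also have "\<dots> = 2 * M / R ^ Suc k * h l"
      using h[of l] by (simp add: field_simps)
    finally show "norm (H l y - tcoef (\<lambda>h. G h y) k) \<le> 2 * M / R ^ Suc k * h l" .
  next
    have "h \<longlonglongrightarrow> 0"
      unfolding h_def
      by (rule real_tendsto_divide_at_top[OF tendsto_const filterlim_compose[OF filterlim_real_sequentially filterlim_Suc]])
    then show "(\<lambda>l. 2 * M / R ^ Suc k * h l) \<longlonglongrightarrow> 0"
      by (rule tendsto_mult_right_zero)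
  qed
qed

section \<open>Smoothness and the identity theorem at real points\<close>

definition loc_bounded_chol :: "nat \<Rightarrow> cseq set \<Rightarrow> (cseq \<Rightarrow> cseq) \<Rightarrow> bool" where
  "loc_bounded_chol N U g \<longleftrightarrow> U \<subseteq> cvec N \<and> chol N U g \<and>
     (\<forall>y\<in>U. \<exists>r>0. \<exists>M. complex_ball N y r \<subseteq> U \<and> (\<forall>z\<in>complex_ball N y r. norm (g z) \<le> M))"

lemma loc_bounded_cholE:
  assumes "loc_bounded_chol N U g" "y \<in> U"
  obtains r M where "r > 0" "complex_ball N y r \<subseteq> U" "chol N (complex_ball N y r) g"
    "\<And>z. z \<in> complex_ball N y r \<Longrightarrow> norm (g z) \<le> M" "y \<in> cvec N"
proof -
  from assms obtain r M where *: "r > 0" "complex_ball N y r \<subseteq> U"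
    "\<forall>z\<in>complex_ball N y r. norm (g z) \<le> M"
    unfolding loc_bounded_chol_def by meson
  have "chol N (complex_ball N y r) g"
    using assms(1) jhol_subset[OF _ order_refl *(2)] by (simp add: loc_bounded_chol_def)
  moreover have "y \<in> cvec N" using assms by (auto simp: loc_bounded_chol_def)
  ultimately show ?thesis using *(3) by (intro that[OF *(1,2)]) auto
qed

lemma loc_bounded_chol_continuous_on:
  assumes "loc_bounded_chol N U g"
  shows "continuous_on U g"
  unfolding continuous_on_iff
proof (intro ballI allI impI)
  fix y and e :: real assume "y \<in> U" "e > 0"
  from assms \<open>y \<in> U\<close> obtain r M where r: "r > 0" and sub: "complex_ball N y r \<subseteq> U"
    and g: "chol N (complex_ball N y r) g"
    and M: "\<And>z. z \<in> complex_ball N y r \<Longrightarrow> norm (g z) \<le> M" and y: "y \<in> cvec N"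
    by (rule loc_bounded_cholE) blast
  have "y \<in> complex_ball N y r" using y r by (simp add: complex_ball_def)
  from M[OF this] have "M \<ge> 0" by (rule order_trans[OF norm_ge_zero])
  define d where "d = min r (e / (4 * M / r + 1))"
  have pos: "4 * M / r + 1 > 0" using r \<open>M \<ge> 0\<close> by (simp add: add_nonneg_pos)
  have "d > 0" using r \<open>e > 0\<close> pos by (simp add: d_def)
  moreover have "dist (g z) (g y) < e" if z: "z \<in> U" "dist z y < d" for z
  proof -
    have zb: "z \<in> complex_ball N y r"
      using z assms by (auto simp: complex_ball_def loc_bounded_chol_def d_def dist_norm)
    have "norm (g z - g y) \<le> 4 * M / r * norm (z - y)"
      by (rule chol_lipschitz_center[OF g M y zb])
    also have "\<dots> \<le> (4 * M / r + 1) * norm (z - y)"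
      by (intro mult_right_mono) auto
    also have "\<dots> < (4 * M / r + 1) * (e / (4 * M / r + 1))"
      using z pos by (intro mult_strict_left_mono) (auto simp: d_def dist_norm)
    finally show ?thesis using pos by (simp add: dist_norm)
  qed
  ultimately show "\<exists>d>0. \<forall>x'\<in>U. dist x' y < d \<longrightarrow> dist (g x') (g y) < e" by blast
qed

text \<open>The derivative is the first Taylor coefficient of
  \<open>h \<mapsto> g (y + cscale h v)\<close>. So \<open>jhol_tcoef\<close> makes it holomorphic
  in \<open>y\<close> and Cauchy's estimate bounds it locally: the class is closed under directional
  derivatives and can be iterated.\<close>

lemma loc_bounded_chol_directional_derivative:
  assumes g: "loc_bounded_chol N U g" and v: "v \<in> cvec N"
  obtains g' where "loc_bounded_chol N U g'"
    "\<And>y. y \<in> U \<Longrightarrow> ((\<lambda>t. g (y + t *\<^sub>R v)) has_vector_derivative g' y) (at 0)"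
proof -
  define g' where "g' y = tcoef (\<lambda>h. g (y + cscale h v)) 1" for y
  have *: "\<exists>r>0. complex_ball N y r \<subseteq> U \<and> chol N (complex_ball N y r) g' \<and>
      (\<exists>M. \<forall>z\<in>complex_ball N y r. norm (g' z) \<le> M) \<and>
      ((\<lambda>t. g (y + t *\<^sub>R v)) has_vector_derivative g' y) (at 0)" if "y \<in> U" for y
  proof -
    from g \<open>y \<in> U\<close> obtain r M where r: "r > 0" and sub: "complex_ball N y r \<subseteq> U"
      and hol: "chol N (complex_ball N y r) g"
      and M: "\<And>z. z \<in> complex_ball N y r \<Longrightarrow> norm (g z) \<le> M" and y: "y \<in> cvec N"
      by (rule loc_bounded_cholE) blast
    \<comment> \<open>Half of the radius \<open>r\<close> is left for the base point
      \<open>z\<close>; the summand 1 keeps the denominator positive when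
      \<open>v = 0\<close>.\<close>
    define R where "R = r / (2 * (norm v + 1))"
    have nv: "norm v + 1 > 0" by (simp add: add_nonneg_pos)
    have R: "R > 0" using r nv by (simp add: R_def)
    have in_ball: "z + cscale h v \<in> complex_ball N y r"
      if "h \<in> ball 0 R" "z \<in> complex_ball N y (r/2)" for h z
    proof -
      have "cmod h * norm v \<le> R * (norm v + 1)"
        using that R by (intro mult_mono) auto
      also have "\<dots> = r / 2" using nv by (simp add: R_def field_simps)
      finally have "norm (cscale h v) \<le> r / 2" by (simp add: norm_cscale)
      moreover have "norm (z + cscale h v - y) \<le> norm (z - y) + norm (cscale h v)"
        using norm_triangle_ineq[of "z - y" "cscale h v"] by (simp add: algebra_simps)
      ultimately show ?thesis
        using that v unfolding complex_ball_def by (auto intro!: cvec_intros)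
    qed
    have jh: "jhol N (ball 0 R) (complex_ball N y (r/2)) (\<lambda>h z. g (z + cscale h v))"
    proof (rule jhol_compose[OF chol_jhol[OF hol]])
      show "jhol N (ball 0 R) (complex_ball N y (r/2)) (\<lambda>h z. z + cscale h v)"
        by (auto simp: jhol_def intro!: hcurve_intros v)
    qed (rule in_ball)
    have bd: "bounded_hcurve N R M (\<lambda>h. g (z + cscale h v))" if "z \<in> complex_ball N y (r/2)" for z
    proof
      show "hcurve N (ball 0 R) (\<lambda>h. g (z + cscale h v))"
        using jhol_hcurve[OF jh open_ball that] that by (simp add: complex_ball_def)
    qed (use R M in_ball that in auto)
    have "complex_ball N y (r/2) \<subseteq> complex_ball N y r" using r by (auto simp: complex_ball_def)
    moreover have "chol N (complex_ball N y (r/2)) g'"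
      unfolding g'_def
      by (rule jhol_tcoef[OF jh R]) (auto simp: complex_ball_def intro!: M in_ball)
    moreover have "norm (g' z) \<le> M / R ^ 1" if "z \<in> complex_ball N y (r/2)" for z
      unfolding g'_def by (rule bounded_hcurve.norm_tcoef[OF bd[OF that]])
    moreover have "((\<lambda>t. g (y + t *\<^sub>R v)) has_vector_derivative g' y) (at 0)"
      unfolding has_vector_derivative_def
    proof (rule has_derivativeI_sandwich[of "R / 2"])
      have yb: "y \<in> complex_ball N y (r/2)" using y r by (simp add: complex_ball_def)
      interpret bounded_hcurve N R M "\<lambda>h. g (y + cscale h v)" by (rule bd[OF yb])
      show "norm (g (y + t *\<^sub>R v) - g (y + 0 *\<^sub>R v) - (t - 0) *\<^sub>R g' y) / norm (t - 0) \<le> 2 * M / R\<^sup>2 * \<bar>t\<bar>"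
        if "t \<noteq> 0" "dist t 0 < R / 2" for t
      proof -
        have "norm (g (y + t *\<^sub>R v) - g y - t *\<^sub>R g' y) \<le> 2 * M * (\<bar>t\<bar> / R) ^ 2"
          using tcoef_remainder_real[of t 2] that
          by (simp add: cscale_of_real lessThan_nat_numeral tcoef_0 g'_def numeral_2_eq_2 algebra_simps)
        then have "norm (g (y + t *\<^sub>R v) - g y - t *\<^sub>R g' y) / \<bar>t\<bar> \<le> 2 * M * (\<bar>t\<bar> / R) ^ 2 / \<bar>t\<bar>"
          by (rule divide_right_mono) simp
        also have "\<dots> = 2 * M / R\<^sup>2 * \<bar>t\<bar>" using that by (simp add: power2_eq_square field_simps)
        finally show ?thesis by simp
      qed
      show "((\<lambda>t. 2 * M / R\<^sup>2 * \<bar>t\<bar>) \<longlongrightarrow> 0) (at 0)"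
        using R by (auto intro!: tendsto_eq_intros)
    qed (use R bounded_linear_scaleR_left in auto)
    ultimately show ?thesis using r sub by (intro exI[of _ "r/2"]) auto
  qed
  have "loc_bounded_chol N U g'"
    unfolding loc_bounded_chol_def
  proof (intro conjI ballI)
    show "U \<subseteq> cvec N" using g by (simp add: loc_bounded_chol_def)
    show "chol N U g'" by (rule chol_local) (use * in meson)
    show "\<exists>r>0. \<exists>M. complex_ball N y r \<subseteq> U \<and> (\<forall>z\<in>complex_ball N y r. norm (g' z) \<le> M)" if "y \<in> U" for y
      using *[OF that] by meson
  qed
  then show ?thesis using * that by meson
qed

text \<open>This brings analytic fields into the scope of \<open>rk_order\<close>, which quantifies
  over smooth fields on open sets of real points.\<close>

lemma loc_bounded_chol_class_C: "loc_bounded_chol N U g \<Longrightarrow> class_C N n (U \<inter> rvec N) g"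
proof (induction n arbitrary: g)
  case 0
  then show ?case using loc_bounded_chol_continuous_on continuous_on_subset by (auto intro: continuous_on_subset)
next
  case (Suc n)
  have "\<exists>g'. class_C N n (U \<inter> rvec N) g' \<and>
      (\<forall>y\<in>U \<inter> rvec N. ((\<lambda>t. g (y + t *\<^sub>R v)) has_vector_derivative g' y) (at 0))" if "v \<in> rvec N" for v
  proof -
    have "v \<in> cvec N" using that rvec_subset_cvec by blast
    from loc_bounded_chol_directional_derivative[OF Suc.prems this]
    obtain g' where "loc_bounded_chol N U g'" and
      "\<And>y. y \<in> U \<Longrightarrow> ((\<lambda>t. g (y + t *\<^sub>R v)) has_vector_derivative g' y) (at 0)" by metis
    with Suc.IH show ?thesis by (intro exI[of _ g']) simp
  qed
  moreover have "continuous_on (U \<inter> rvec N) g"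
    using loc_bounded_chol_continuous_on[OF Suc.prems] by (rule continuous_on_subset) simp
  ultimately show ?case by simp
qed

text \<open>Write \<open>y = u + \<i> w\<close> with real \<open>u\<close> and \<open>w\<close>. The
  curve \<open>\<zeta> \<mapsto> u + \<zeta> w\<close> is real for real \<open>\<zeta>\<close> and
  passes through \<open>y\<close> at \<open>\<zeta> = \<i>\<close>. Its parameters inside the ball
  form a convex set containing 0 and \<open>\<i>\<close>, so the one-variable identity theorem
  carries the zeros from the real axis to \<open>\<i>\<close>.\<close>

lemma chol_zero_if_zero_on_rvec:
  assumes g: "chol N (complex_ball N x r) g" and x: "x \<in> rvec N"
    and zero: "\<And>y. y \<in> complex_ball N x r \<Longrightarrow> y \<in> rvec N \<Longrightarrow> g y = 0"
    and y: "y \<in> complex_ball N x r"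
  shows "g y = 0"
proof -
  define u where "u = Bcontfun (\<lambda>i. of_real (Re (coord y i)) :: complex)"
  define w where "w = Bcontfun (\<lambda>i. of_real (Im (coord y i)) :: complex)"
  have cu: "coord u i = of_real (Re (coord y i))" for i
  proof -
    have "(\<lambda>i. of_real (Re (coord y i)) :: complex) \<in> bcontfun"
      by (rule bcontfun_normI[where b = "norm y"])
        (auto intro: order_trans[OF abs_Re_le_cmod norm_bounded])
    then show ?thesis by (simp add: u_def Bcontfun_inverse)
  qed
  have cw: "coord w i = of_real (Im (coord y i))" for i
  proof -
    have "(\<lambda>i. of_real (Im (coord y i)) :: complex) \<in> bcontfun"
      by (rule bcontfun_normI[where b = "norm y"])
        (auto intro: order_trans[OF abs_Im_le_cmod norm_bounded])
    then show ?thesis by (simp add: w_def Bcontfun_inverse)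
  qed
  define c where "c \<zeta> = u + cscale \<zeta> w" for \<zeta>
  have yc: "y \<in> cvec N" using y by (simp add: complex_ball_def)
  have u: "u \<in> rvec N" and w: "w \<in> rvec N"
    using yc by (auto simp: rvec_def cvec_def cu cw)
  have ci: "c \<i> = y"
    by (rule bcontfun_eqI) (simp add: c_def cu cw apply_cscale complex_eq_iff)
  \<comment> \<open>Since \<open>x\<close> is real, passing to the real part does not increase the
    distance to \<open>x\<close>; this puts the parameter 0 into \<open>W\<close>.\<close>
  have norm_u: "norm (u - x) \<le> norm (y - x)"
  proof (rule norm_bound)
    fix i
    have "coord x i \<in> \<real>" using x by (simp add: rvec_def)
    then have "coord (u - x) i = of_real (Re (coord (y - x) i))" by (auto simp: cu elim!: Reals_cases)
    then have "cmod (coord (u - x) i) \<le> cmod (coord (y - x) i)"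
      using abs_Re_le_cmod[of "coord (y - x) i"] by (simp only: norm_of_real)
    also have "\<dots> \<le> norm (y - x)" by (rule norm_bounded)
    finally show "cmod (coord (u - x) i) \<le> norm (y - x)" .
  qed
  define W where "W = {\<zeta>. norm (c \<zeta> - x) < r}"
  have cont: "continuous_on UNIV (\<lambda>\<zeta>. norm (c \<zeta> - x))"
    unfolding c_def by (intro continuous_intros linear_continuous_on bounded_linear_cscale_left)
  have oW: "open W" unfolding W_def by (rule open_Collect_less[OF cont]) simp
  have "convex W"
  proof (rule convexI)
    fix \<zeta> \<xi> :: complex and s t :: real
    assume *: "\<zeta> \<in> W" "\<xi> \<in> W" "0 \<le> s" "0 \<le> t" "s + t = 1"
    have "c (s *\<^sub>R \<zeta> + t *\<^sub>R \<xi>) - x = s *\<^sub>R (c \<zeta> - x) + t *\<^sub>R (c \<xi> - x)"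
    proof -
      have "s *\<^sub>R (u - x) + t *\<^sub>R (u - x) = u - x"
        using * by (simp flip: scaleR_left_distrib)
      moreover have "cscale (s *\<^sub>R \<zeta> + t *\<^sub>R \<xi>) w = s *\<^sub>R cscale \<zeta> w + t *\<^sub>R cscale \<xi> w"
        by (rule bcontfun_eqI) (simp add: apply_cscale algebra_simps scaleR_conv_of_real)
      ultimately show ?thesis by (simp add: c_def algebra_simps)
    qed
    then have "norm (c (s *\<^sub>R \<zeta> + t *\<^sub>R \<xi>) - x) \<le> s * norm (c \<zeta> - x) + t * norm (c \<xi> - x)"
      using norm_triangle_ineq[of "s *\<^sub>R (c \<zeta> - x)" "t *\<^sub>R (c \<xi> - x)"] * by simp
    also have "\<dots> < r" by (rule convex_bound_lt) (use * in \<open>auto simp: W_def\<close>)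
    finally show "s *\<^sub>R \<zeta> + t *\<^sub>R \<xi> \<in> W" by (simp add: W_def)
  qed
  have W0: "0 \<in> W" and Wi: "\<i> \<in> W"
    using norm_u y by (auto simp: W_def ci) (simp_all add: c_def complex_ball_def)
  have cW: "c \<zeta> \<in> complex_ball N x r" if "\<zeta> \<in> W" for \<zeta>
    using that u w rvec_subset_cvec unfolding complex_ball_def W_def c_def
    by (auto intro!: cvec_intros)
  have hc: "hcurve N W (\<lambda>\<zeta>. g (c \<zeta>))"
  proof (rule chol_hcurve[OF g oW])
    show "hcurve N W c"
      using u w rvec_subset_cvec unfolding c_def by (intro hcurve_intros holomorphic_intros) auto
  qed (use cW in auto)
  obtain e where e: "e > 0" "ball 0 e \<subseteq> W" using oW W0 open_contains_ball by blast
  show ?thesis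
  proof (rule bcontfun_eqI)
    fix i
    have "coord (g (c \<i>)) i = 0"
    proof (rule analytic_continuation[of "\<lambda>\<zeta>. coord (g (c \<zeta>)) i" W "W \<inter> \<real>" 0])
      show "(\<lambda>\<zeta>. coord (g (c \<zeta>)) i) holomorphic_on W" using hc by (simp add: hcurve_def)
      show "connected W" using \<open>convex W\<close> by (rule convex_connected)
      show "0 islimpt W \<inter> \<real>"
        unfolding islimpt_approachable
      proof (intro allI impI)
        fix d :: real assume "d > 0"
        let ?t = "min d e / 2"
        have "of_real ?t \<in> ball (0::complex) e" using e \<open>d > 0\<close> by simp
        then show "\<exists>x'\<in>W \<inter> \<real>. x' \<noteq> 0 \<and> dist x' 0 < d"
          using e \<open>d > 0\<close> by (intro bexI[of _ "of_real ?t"]) auto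
      qed
      fix \<zeta> assume \<zeta>: "\<zeta> \<in> W \<inter> \<real>"
      then obtain t where t: "\<zeta> = of_real t" by (auto elim: Reals_cases)
      have "c \<zeta> \<in> rvec N" unfolding c_def t cscale_of_real by (intro rvec_intros u w)
      then show "coord (g (c \<zeta>)) i = 0" using zero cW \<zeta> by simp
    qed (use oW W0 Wi in auto)
    then show "coord (g y) i = coord 0 i" by (simp add: ci)
  qed
qed

subsection \<open>Stages of a Runge-Kutta method with complex step size\<close>

text \<open>
  The library has this instance only for metric domains, and so not for the domain \<open>nat\<close> of
  \<^typ>\<open>cseq\<close>.
\<close>

instance bcontfun :: (topological_space, complete_space) complete_space
proof
  fix f :: "nat \<Rightarrow> ('a, 'b) bcontfun"
  assume f: "Cauchy f"
  have "uniformly_Cauchy_on UNIV (\<lambda>n. apply_bcontfun (f n))"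
    unfolding uniformly_Cauchy_on_def
  proof (intro allI impI)
    fix e :: real assume "e > 0"
    then obtain M where "\<And>m n. m \<ge> M \<Longrightarrow> n \<ge> M \<Longrightarrow> dist (f m) (f n) < e"
      using metric_CauchyD[OF f] by blast
    then show "\<exists>M. \<forall>x\<in>UNIV. \<forall>m\<ge>M. \<forall>n\<ge>M.
        dist (apply_bcontfun (f m) x) (apply_bcontfun (f n) x) < e"
      using dist_fun_lt_imp_dist_val_lt by meson
  qed
  then obtain l where "uniform_limit UNIV (\<lambda>n. apply_bcontfun (f n)) l sequentially"
    using Cauchy_uniformly_convergent unfolding uniformly_convergent_on_def by blast
  then obtain l' where "f \<longlonglongrightarrow> l'"
    by (rule uniform_limit_bcontfunE) auto
  then show "convergent f" by (rule convergentI)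
qed

instance bcontfun :: (topological_space, banach) banach ..

lemma geometric_increments_limit:
  fixes u :: "nat \<Rightarrow> 'a::banach"
  assumes step: "\<And>l. norm (u (Suc l) - u l) \<le> M / 2 ^ l"
  shows "u \<longlonglongrightarrow> lim u" and "norm (lim u - u l) \<le> 2 * M / 2 ^ l"
proof -
  have "norm (u (Suc 0) - u 0) \<le> M" using step[of 0] by simp
  then have M: "M \<ge> 0" by (rule order_trans[OF norm_ge_zero])
  \<comment> \<open>The subtracted term is the part of the geometric series not yet consumed; with
    it the induction closes.\<close>
  have far: "norm (u (l + n) - u l) \<le> 2 * M / 2 ^ l - 2 * M / 2 ^ (l + n)" for l n
  proof (induction n)
    case (Suc n)
    have "norm (u (l + Suc n) - u l) \<le> norm (u (Suc (l + n)) - u (l + n)) + norm (u (l + n) - u l)"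
      using norm_triangle_ineq[of "u (Suc (l + n)) - u (l + n)" "u (l + n) - u l"] by simp
    also have "\<dots> \<le> M / 2 ^ (l + n) + (2 * M / 2 ^ l - 2 * M / 2 ^ (l + n))"
      by (intro add_mono step Suc.IH)
    also have "\<dots> = 2 * M / 2 ^ l - 2 * M / 2 ^ (l + Suc n)" by simp
    finally show ?case .
  qed simp
  have far': "norm (u (l + n) - u l) \<le> 2 * M / 2 ^ l" for l n
    using far[of l n] M by (smt (verit) divide_nonneg_pos zero_less_power)
  have zero: "(\<lambda>l. 2 * M / 2 ^ l) \<longlonglongrightarrow> 0"
    by (rule LIMSEQ_divide_realpow_zero) simp
  have "Cauchy u"
  proof (rule metric_CauchyI)
    fix e :: real assume "e > 0"
    then obtain L where L: "2 * M / 2 ^ L < e / 2"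
      using order_tendstoD(2)[OF zero, of "e/2"] by (auto simp: eventually_sequentially)
    have "norm (u m - u n) < e" if "m \<ge> L" "n \<ge> L" for m n
    proof -
      have "norm (u m - u L) < e/2" "norm (u n - u L) < e/2"
        using far'[of L "m - L"] far'[of L "n - L"] L that by auto
      then show ?thesis using norm_triangle_ineq4[of "u m - u L" "u n - u L"] by simp
    qed
    then show "\<exists>L. \<forall>m\<ge>L. \<forall>n\<ge>L. dist (u m) (u n) < e" by (auto simp: dist_norm)
  qed
  then show lim: "u \<longlonglongrightarrow> lim u" using Cauchy_convergent convergent_LIMSEQ_iff by blast
  have "(\<lambda>n. norm (u (n + l) - u l)) \<longlonglongrightarrow> norm (lim u - u l)"
    using LIMSEQ_ignore_initial_segment[OF lim, of l] by (intro tendsto_intros)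
  then show "norm (lim u - u l) \<le> 2 * M / 2 ^ l"
    by (rule LIMSEQ_le_const2) (use far'[of l] in \<open>auto simp: add.commute\<close>)
qed

text \<open>Taking for \<open>\<kappa>\<close> the maximum of \<open>d\<close> gives max \<le> c +
  max / 2. In this form a coupled system of stages is treated at once, without a norm on the tuple
  of stages.\<close>

lemma half_contraction_bound:
  fixes d :: "'i \<Rightarrow> real"
  assumes "finite I" and "i \<in> I"
    and step: "\<And>i \<kappa>. i \<in> I \<Longrightarrow> (\<And>j. j \<in> I \<Longrightarrow> d j \<le> \<kappa>) \<Longrightarrow> d i \<le> c + \<kappa> / 2"
  shows "d i \<le> 2 * c"
proof -
  let ?m = "Max (d ` I)"
  have le: "d j \<le> ?m" if "j \<in> I" for j using assms(1) that by simp
  have "?m \<in> d ` I" using assms(1,2) by (intro Max_in) auto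
  then obtain j where "j \<in> I" "?m = d j" by auto
  then have "?m \<le> c + ?m / 2" using step[of j ?m] le by simp
  then show ?thesis using le[OF assms(2)] by simp
qed

text \<open>One constant \<open>A\<close> controls the coefficients. \<open>consistent\<close> is
  the first order condition: at step size 0 every stage equals \<open>g y\<close>, and so does their
  weighted mean.\<close>

locale rk =
  fixes s :: nat and a :: "nat \<Rightarrow> nat \<Rightarrow> real" and b :: "nat \<Rightarrow> real" and A :: real
  assumes A_ge_1: "A \<ge> 1"
    and row_sum: "i < s \<Longrightarrow> (\<Sum>j<s. \<bar>a i j\<bar>) \<le> A"
    and weight_sum: "(\<Sum>j<s. \<bar>b j\<bar>) \<le> A"
    and consistent: "(\<Sum>j<s. b j) = 1"
begin

definition stage_point :: "complex \<Rightarrow> cseq \<Rightarrow> (nat \<Rightarrow> cseq) \<Rightarrow> nat \<Rightarrow> cseq" where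
  "stage_point h y k i = y + cscale h (\<Sum>j<s. a i j *\<^sub>R k j)"

text \<open>Fixed-point iteration for the stage equations. In contrast to an implicitly given
  solution, every iterate is visibly holomorphic in \<open>h\<close> and \<open>y\<close>
  jointly.\<close>

primrec stage_iter :: "complex \<Rightarrow> (cseq \<Rightarrow> cseq) \<Rightarrow> cseq \<Rightarrow> nat \<Rightarrow> nat \<Rightarrow> cseq" where
  "stage_iter h g y 0 = (\<lambda>i. 0)"
| "stage_iter h g y (Suc l) = (\<lambda>i. g (stage_point h y (stage_iter h g y l) i))"

definition stage :: "complex \<Rightarrow> (cseq \<Rightarrow> cseq) \<Rightarrow> cseq \<Rightarrow> nat \<Rightarrow> cseq" where
  "stage h g y i = lim (\<lambda>l. stage_iter h g y l i)"

text \<open>The increment function: a step is \<open>y + h * rk_mean h g y\<close>. The division by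
  \<open>h\<close> is built in, so it is meaningful at \<open>h = 0\<close> and for complex
  \<open>h\<close>.\<close>

definition rk_mean :: "complex \<Rightarrow> (cseq \<Rightarrow> cseq) \<Rightarrow> cseq \<Rightarrow> cseq" where
  "rk_mean h g y = (\<Sum>i<s. b i *\<^sub>R stage h g y i)"

lemma norm_weighted_sum_le:
  fixes v :: "nat \<Rightarrow> cseq"
  assumes "(\<Sum>j<s. \<bar>w j\<bar>) \<le> A" "\<kappa> \<ge> 0" "\<And>j. j < s \<Longrightarrow> norm (v j) \<le> \<kappa>"
  shows "norm (\<Sum>j<s. w j *\<^sub>R v j) \<le> A * \<kappa>"
proof -
  have "norm (\<Sum>j<s. w j *\<^sub>R v j) \<le> (\<Sum>j<s. \<bar>w j\<bar> * \<kappa>)"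
    by (rule sum_norm_le) (use assms in \<open>auto intro: mult_left_mono\<close>)
  also have "\<dots> \<le> A * \<kappa>" unfolding sum_distrib_right[symmetric] by (rule mult_right_mono) (use assms in auto)
  finally show ?thesis .
qed

lemma stage_point_diff:
  "stage_point h y k i - stage_point h y' k' i = (y - y') + cscale h (\<Sum>j<s. a i j *\<^sub>R (k j - k' j))"
  by (simp add: stage_point_def scaleR_diff_right sum_subtractf cscale_diff_right)

lemma norm_stage_point_diff:
  assumes "i < s" "\<kappa> \<ge> 0" "\<And>j. j < s \<Longrightarrow> norm (k j - k' j) \<le> \<kappa>"
  shows "norm (stage_point h y k i - stage_point h y k' i) \<le> cmod h * (A * \<kappa>)"
  unfolding stage_point_diff
  using norm_weighted_sum_le[OF row_sum[OF assms(1)] assms(2), of "\<lambda>j. k j - k' j"] assms(3)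
  by (simp add: norm_cscale mult_left_mono)

lemma norm_stage_point_center:
  assumes "i < s" "\<kappa> \<ge> 0" "\<And>j. j < s \<Longrightarrow> norm (k j) \<le> \<kappa>"
  shows "norm (stage_point h y k i - y) \<le> cmod h * (A * \<kappa>)"
  using norm_weighted_sum_le[OF row_sum[OF assms(1)] assms(2), of k] assms(3)
  by (simp add: stage_point_def norm_cscale mult_left_mono)

end

text \<open>The constant 16 serves two purposes. Stage points built from values bounded by
  \<open>M\<close> move by at most \<open>\<delta> / 16\<close>, and the Lipschitz constant
  \<open>8 * M / \<delta>\<close> on the half ball, times \<open>A * cmod h\<close>, is at most 1/2.
  The gap between \<open>\<delta> / 16\<close> and \<open>\<delta> / 2\<close> later separates the
  right branch of stages from all others.\<close>

locale rk_local = rk +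
  fixes N :: nat and y :: cseq and g :: "cseq \<Rightarrow> cseq" and \<delta> M :: real and h :: complex
  assumes center: "y \<in> cvec N" and \<delta>: "\<delta> > 0"
    and chol_g: "chol N (complex_ball N y \<delta>) g"
    and bound_g: "\<And>z. z \<in> complex_ball N y \<delta> \<Longrightarrow> norm (g z) \<le> M"
    and small_h: "16 * A * M * cmod h \<le> \<delta>"
begin

lemma M_nonneg: "M \<ge> 0"
  by (rule order_trans[OF norm_ge_zero bound_g[of y]]) (simp add: complex_ball_def center \<delta>)

lemma half_subset: "complex_ball N y (\<delta>/2) \<subseteq> complex_ball N y \<delta>"
  using \<delta> by (auto simp: complex_ball_def)

lemma stage_point_in_ball:
  assumes "i < s" "\<And>j. j < s \<Longrightarrow> k j \<in> cvec N" "\<And>j. j < s \<Longrightarrow> norm (k j) \<le> M"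
  shows "stage_point h y k i \<in> complex_ball N y (\<delta>/2)"
    and "norm (stage_point h y k i - y) \<le> \<delta>/16"
proof -
  have "norm (stage_point h y k i - y) \<le> cmod h * (A * M)"
    by (rule norm_stage_point_center) (use assms M_nonneg in auto)
  also have "\<dots> \<le> \<delta> / 16" using small_h by (simp add: mult_ac)
  finally show *: "norm (stage_point h y k i - y) \<le> \<delta> / 16" .
  moreover have "stage_point h y k i \<in> cvec N"
    unfolding stage_point_def by (intro cvec_intros center) (use assms in auto)
  ultimately show "stage_point h y k i \<in> complex_ball N y (\<delta>/2)"
    using \<delta> by (simp add: complex_ball_def)
qed

lemma stage_contraction:
  assumes "i < s" and "stage_point h y k i \<in> complex_ball N y (\<delta>/2)"
    and "stage_point h y k' i \<in> complex_ball N y (\<delta>/2)"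
    and "\<And>j. j < s \<Longrightarrow> norm (k j - k' j) \<le> \<kappa>"
  shows "norm (g (stage_point h y k i) - g (stage_point h y k' i)) \<le> \<kappa> / 2"
proof -
  have \<kappa>: "\<kappa> \<ge> 0" by (rule order_trans[OF norm_ge_zero assms(4)[OF assms(1)]])
  have "norm (g (stage_point h y k i) - g (stage_point h y k' i)) \<le>
      8 * M / \<delta> * norm (stage_point h y k i - stage_point h y k' i)"
    by (rule chol_lipschitz_half_ball[OF chol_g bound_g assms(2,3)])
  also have "\<dots> \<le> 8 * M / \<delta> * (cmod h * (A * \<kappa>))"
    using M_nonneg \<delta> \<kappa> assms by (intro mult_left_mono norm_stage_point_diff) auto
  also have "\<dots> = (16 * A * M * cmod h) * \<kappa> / (2 * \<delta>)" by (simp add: mult_ac)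
  also have "\<dots> \<le> \<delta> * \<kappa> / (2 * \<delta>)"
    by (intro divide_right_mono mult_right_mono small_h) (use \<kappa> \<delta> in auto)
  finally show ?thesis using \<delta> by simp
qed

lemma stage_iter_bound:
  "i < s \<Longrightarrow> stage_iter h g y l i \<in> cvec N \<and> norm (stage_iter h g y l i) \<le> M"
proof (induction l arbitrary: i)
  case 0
  then show ?case by (simp add: M_nonneg cvec_intros)
next
  case (Suc l)
  have "stage_point h y (stage_iter h g y l) i \<in> complex_ball N y \<delta>"
    using stage_point_in_ball(1)[of i "stage_iter h g y l"] Suc half_subset by blast
  moreover from this have "stage_point h y (stage_iter h g y l) i \<in> cvec N"
    by (simp add: complex_ball_def)
  ultimately show ?case
    using bound_g jhol_maps_cvec[OF chol_g UNIV_I] by simp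
qed

lemma stage_iter_in_ball:
  "i < s \<Longrightarrow> stage_point h y (stage_iter h g y l) i \<in> complex_ball N y (\<delta>/2)"
  by (rule stage_point_in_ball(1)) (auto simp: stage_iter_bound)

lemma stage_iter_step:
  "i < s \<Longrightarrow> norm (stage_iter h g y (Suc l) i - stage_iter h g y l i) \<le> M / 2 ^ l"
proof (induction l arbitrary: i)
  case 0
  then show ?case using stage_iter_bound[of i "Suc 0"] by simp
next
  case (Suc l)
  have "norm (g (stage_point h y (stage_iter h g y (Suc l)) i) - g (stage_point h y (stage_iter h g y l) i))
      \<le> M / 2 ^ l / 2"
    by (rule stage_contraction[OF Suc.prems stage_iter_in_ball[OF Suc.prems] stage_iter_in_ball[OF Suc.prems]
        Suc.IH])
  then show ?case by (simp add: mult_ac)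
qed

lemma stage_iter_limit: "i < s \<Longrightarrow> (\<lambda>l. stage_iter h g y l i) \<longlonglongrightarrow> stage h g y i"
  unfolding stage_def
  using geometric_increments_limit(1)[of "\<lambda>l. stage_iter h g y l i" M] stage_iter_step by simp

lemma stage_iter_error: "i < s \<Longrightarrow> norm (stage h g y i - stage_iter h g y l i) \<le> 2 * M / 2 ^ l"
  unfolding stage_def
  using geometric_increments_limit(2)[of "\<lambda>l. stage_iter h g y l i" M] stage_iter_step by simp

lemma stage_in_cvec: "i < s \<Longrightarrow> stage h g y i \<in> cvec N"
  using closed_sequentially[OF closed_cvec _ stage_iter_limit] stage_iter_bound by blast

lemma norm_stage: "i < s \<Longrightarrow> norm (stage h g y i) \<le> M"
  by (rule LIMSEQ_le_const2[OF tendsto_norm[OF stage_iter_limit]]) (auto simp: stage_iter_bound)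

lemma stage_in_ball:
  "i < s \<Longrightarrow> stage_point h y (stage h g y) i \<in> complex_ball N y (\<delta>/2)"
  by (rule stage_point_in_ball(1)) (auto simp: stage_in_cvec norm_stage)

lemma stage_eq:
  assumes "i < s"
  shows "stage h g y i = g (stage_point h y (stage h g y) i)"
proof -
  have "norm (g (stage_point h y (stage h g y) i) - stage_iter h g y (Suc l) i) \<le> 2 * M / 2 ^ l / 2" for l
    using stage_contraction[OF assms stage_in_ball[OF assms] stage_iter_in_ball[OF assms] stage_iter_error]
    by simp
  then have *: "norm (stage_iter h g y (Suc l) i - g (stage_point h y (stage h g y) i)) \<le> M / 2 ^ l" for l
    by (simp add: norm_minus_commute)
  have "(\<lambda>l. M / 2 ^ l) \<longlonglongrightarrow> 0"
    by (rule LIMSEQ_divide_realpow_zero) simp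
  then have "(\<lambda>l. stage_iter h g y (Suc l) i - g (stage_point h y (stage h g y) i)) \<longlonglongrightarrow> 0"
    by (rule Lim_null_comparison[rotated]) (use * in simp)
  then have "(\<lambda>l. stage_iter h g y (Suc l) i) \<longlonglongrightarrow> g (stage_point h y (stage h g y) i)"
    by (simp add: LIM_zero_iff)
  moreover have "(\<lambda>l. stage_iter h g y (Suc l) i) \<longlonglongrightarrow> stage h g y i"
    by (rule LIMSEQ_Suc[OF stage_iter_limit[OF assms]])
  ultimately show ?thesis by (rule LIMSEQ_unique[rotated])
qed

text \<open>Two solutions with stage points in the half ball satisfy the contraction with error term
  0. Only the stage points are confined, not the values \<open>k\<close>, because that is all the
  connectedness argument in \<open>rk_step_eq\<close> provides.\<close>

lemma stage_unique:
  assumes "\<And>i. i < s \<Longrightarrow> stage_point h y k i \<in> complex_ball N y (\<delta>/2)"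
    and "\<And>i. i < s \<Longrightarrow> k i = g (stage_point h y k i)" and "i < s"
  shows "k i = stage h g y i"
proof -
  have "norm (k i - stage h g y i) \<le> 2 * 0"
  proof (rule half_contraction_bound[of "{..<s}" _ "\<lambda>i. norm (k i - stage h g y i)"])
    fix i \<kappa> assume i: "i \<in> {..<s}" and \<kappa>: "\<And>j. j \<in> {..<s} \<Longrightarrow> norm (k j - stage h g y j) \<le> \<kappa>"
    have "norm (g (stage_point h y k i) - g (stage_point h y (stage h g y) i)) \<le> \<kappa> / 2"
      using i \<kappa> by (intro stage_contraction assms stage_in_ball) auto
    then show "norm (k i - stage h g y i) \<le> 0 + \<kappa> / 2"
      using assms(2)[of i] stage_eq[of i] i by simp
  qed (use assms in auto)
  then show ?thesis by simp
qed

lemma norm_rk_mean: "norm (rk_mean h g y) \<le> A * M"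
  unfolding rk_mean_def by (rule norm_weighted_sum_le[OF weight_sum M_nonneg norm_stage])

lemma rk_mean_in_cvec: "rk_mean h g y \<in> cvec N"
  unfolding rk_mean_def by (intro cvec_intros stage_in_cvec) auto

end

section \<open>Holomorphy in the step size, and agreement with \<open>rk_step\<close>\<close>

context rk
begin

lemma rk_localI:
  assumes "chol N (complex_ball N x \<rho>) g" "\<And>z. z \<in> complex_ball N x \<rho> \<Longrightarrow> norm (g z) \<le> M"
    and "\<delta> > 0" "16 * A * M * cmod h \<le> \<delta>" "y \<in> complex_ball N x (\<rho> - \<delta>)"
  shows "rk_local s a b A N y g \<delta> M h"
proof unfold_locales
  have sub: "complex_ball N y \<delta> \<subseteq> complex_ball N x \<rho>"
    by (rule complex_ball_mono) (use assms(5) in \<open>simp add: complex_ball_def\<close>)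
  show "chol N (complex_ball N y \<delta>) g" by (rule jhol_subset[OF assms(1) order_refl sub])
  show "norm (g z) \<le> M" if "z \<in> complex_ball N y \<delta>" for z using assms(2) sub that by blast
qed (use assms in \<open>auto simp: complex_ball_def\<close>)

text \<open>The field may itself depend on \<open>h\<close>, as the iterates of the modified field
  do. Each iterate of the stage equations is a composition, and the geometric convergence is
  uniform.\<close>

lemma jhol_rk_mean:
  assumes G: "jhol N D (complex_ball N x \<rho>) G"
    and M: "\<And>h z. h \<in> D \<Longrightarrow> z \<in> complex_ball N x \<rho> \<Longrightarrow> norm (G h z) \<le> M"
    and "\<delta> > 0" and small: "\<And>h. h \<in> D \<Longrightarrow> 16 * A * M * cmod h \<le> \<delta>"
  shows "jhol N D (complex_ball N x (\<rho> - \<delta>)) (\<lambda>h. rk_mean h (G h))"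
proof -
  have loc: "rk_local s a b A N y (G h) \<delta> M h" if "h \<in> D" "y \<in> complex_ball N x (\<rho> - \<delta>)" for h y
    by (rule rk_localI[OF jhol_fix[OF G that(1)] M]) (use that small \<open>\<delta> > 0\<close> in auto)
  have iter: "jhol N D (complex_ball N x (\<rho> - \<delta>)) (\<lambda>h y. stage_iter h (G h) y l i)" if "i < s" for l i
    using that
  proof (induction l arbitrary: i)
    case 0
    then show ?case by (simp add: jhol_zero)
  next
    case (Suc l)
    have "jhol N D (complex_ball N x (\<rho> - \<delta>)) (\<lambda>h y. stage_point h y (stage_iter h (G h) y l) i)"
      unfolding stage_point_def by (intro jhol_intros Suc.IH) auto
    then have "jhol N D (complex_ball N x (\<rho> - \<delta>)) (\<lambda>h y. G h (stage_point h y (stage_iter h (G h) y l) i))"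
    proof (rule jhol_compose[OF G])
      fix h y assume hy: "h \<in> D" "y \<in> complex_ball N x (\<rho> - \<delta>)"
      have "complex_ball N y (\<delta>/2) \<subseteq> complex_ball N x \<rho>"
        by (rule complex_ball_mono) (use hy \<open>\<delta> > 0\<close> in \<open>simp add: complex_ball_def\<close>)
      then show "stage_point h y (stage_iter h (G h) y l) i \<in> complex_ball N x \<rho>"
        using rk_local.stage_iter_in_ball[OF loc[OF hy] Suc.prems] by blast
    qed
    then show ?case by simp
  qed
  have "jhol N D (complex_ball N x (\<rho> - \<delta>)) (\<lambda>h y. stage h (G h) y i)" if "i < s" for i
  proof (rule jhol_uniform_limit[OF iter[OF that]])
    show "norm (stage_iter h (G h) y l i - stage h (G h) y i) \<le> 2 * M / 2 ^ l"
      if "h \<in> D" "y \<in> complex_ball N x (\<rho> - \<delta>)" for h y l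
      using rk_local.stage_iter_error[OF loc[OF that] \<open>i < s\<close>] by (simp add: norm_minus_commute)
    show "(\<lambda>l. 2 * M / 2 ^ l) \<longlonglongrightarrow> 0"
      by (rule LIMSEQ_divide_realpow_zero) simp
  qed
  then show ?thesis unfolding rk_mean_def by (intro jhol_intros) auto
qed

text \<open>The point \<open>?q\<close> combines the step size \<open>\<tau>'\<close> with the
  stages for \<open>\<tau>\<close>. Passing from \<open>?p\<close> to \<open>?q\<close> costs a
  multiple of the change of step size, and from \<open>?q\<close> to \<open>?r\<close> the
  contraction applies.\<close>

lemma continuous_on_stage:
  assumes loc: "\<And>\<tau>. \<tau> \<in> T \<Longrightarrow> rk_local s a b A N y g \<delta> M (of_real \<tau>)" and "i < s"
  shows "continuous_on T (\<lambda>\<tau>. stage (of_real \<tau>) g y i)"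
proof (rule lipschitz_on_continuous_on[OF lipschitz_onI])
  fix \<tau> \<tau>' assume \<tau>: "\<tau> \<in> T" "\<tau>' \<in> T"
  interpret l1: rk_local s a b A N y g \<delta> M "of_real \<tau>" by (rule loc[OF \<tau>(1)])
  interpret l2: rk_local s a b A N y g \<delta> M "of_real \<tau>'" by (rule loc[OF \<tau>(2)])
  let ?k = "stage (of_real \<tau>) g y" and ?k' = "stage (of_real \<tau>') g y"
  have "norm (?k i - ?k' i) \<le> 2 * (8 * M / \<delta> * (\<bar>\<tau> - \<tau>'\<bar> * (A * M)))"
  proof (rule half_contraction_bound[of "{..<s}" _ "\<lambda>i. norm (?k i - ?k' i)"])
    fix i \<kappa> assume "i \<in> {..<s}" and \<kappa>: "\<And>j. j \<in> {..<s} \<Longrightarrow> norm (?k j - ?k' j) \<le> \<kappa>"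
    then have i: "i < s" by simp
    let ?p = "stage_point (of_real \<tau>) y ?k i" and ?q = "stage_point (of_real \<tau>') y ?k i"
      and ?r = "stage_point (of_real \<tau>') y ?k' i"
    have q: "?q \<in> complex_ball N y (\<delta>/2)"
      by (rule l2.stage_point_in_ball(1)[OF i]) (auto simp: l1.stage_in_cvec l1.norm_stage)
    have "?p - ?q = cscale (of_real (\<tau> - \<tau>')) (\<Sum>j<s. a i j *\<^sub>R ?k j)"
      by (simp add: stage_point_def cscale_diff_left)
    then have "norm (?p - ?q) \<le> \<bar>\<tau> - \<tau>'\<bar> * (A * M)"
      using norm_weighted_sum_le[OF row_sum[OF i] l1.M_nonneg l1.norm_stage]
      by (simp add: norm_cscale mult_left_mono del: of_real_diff)
    moreover have "norm (g ?p - g ?q) \<le> 8 * M / \<delta> * norm (?p - ?q)"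
      by (rule chol_lipschitz_half_ball[OF l1.chol_g l1.bound_g l1.stage_in_ball[OF i] q])
    ultimately have 1: "norm (g ?p - g ?q) \<le> 8 * M / \<delta> * (\<bar>\<tau> - \<tau>'\<bar> * (A * M))"
      using l1.M_nonneg l1.\<delta> by (smt (verit) divide_nonneg_pos mult_left_mono)
    have 2: "norm (g ?q - g ?r) \<le> \<kappa> / 2"
      by (rule l2.stage_contraction[OF i q l2.stage_in_ball[OF i]]) (use \<kappa> in auto)
    have "norm (?k i - ?k' i) = norm (g ?p - g ?r)"
      using l1.stage_eq[OF i] l2.stage_eq[OF i] by simp
    also have "\<dots> \<le> norm (g ?p - g ?q) + norm (g ?q - g ?r)"
      using norm_triangle_ineq[of "g ?p - g ?q" "g ?q - g ?r"] by simp
    finally show "norm (?k i - ?k' i) \<le> 8 * M / \<delta> * (\<bar>\<tau> - \<tau>'\<bar> * (A * M)) + \<kappa> / 2"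
      using 1 2 by linarith
  qed (use \<open>i < s\<close> in auto)
  \<comment> \<open>Absolute values, because the Lipschitz constant must be nonnegative even if
    \<open>T\<close> is empty, when the locale tells nothing about the signs of \<open>M\<close> and
    \<open>\<delta>\<close>.\<close>
  then show "dist (?k i) (?k' i) \<le> (16 * \<bar>M\<bar> / \<bar>\<delta>\<bar> * (A * \<bar>M\<bar>)) * dist \<tau> \<tau>'"
    using l1.M_nonneg l1.\<delta> by (simp add: dist_norm mult_ac)
next
  show "0 \<le> 16 * \<bar>M\<bar> / \<bar>\<delta>\<bar> * (A * \<bar>M\<bar>)" using A_ge_1 by simp
qed

text \<open>For the definite description every continuous branch of stages has to end at the
  constructed one. A branch starts with all stage points at \<open>y\<close> and cannot leave the
  half ball, where stages are unique. The set \<open>U\<close> is required to contain only the stage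
  points, not a ball, because the order conditions use a \<open>U\<close> of real points.\<close>

lemma rk_step_eq:
  assumes loc: "rk_local s a b A N y g \<delta> M (of_real h)" and U: "U \<subseteq> cvec N"
    and stays: "\<And>\<tau> i. \<tau> \<in> closed_segment 0 h \<Longrightarrow> i < s \<Longrightarrow>
      stage_point (of_real \<tau>) y (stage (of_real \<tau>) g y) i \<in> U"
  shows "rk_step U s a b h g y = y + h *\<^sub>R rk_mean (of_real h) g y"
proof -
  interpret lh: rk_local s a b A N y g \<delta> M "of_real h" by (rule loc)
  have \<tau>: "\<bar>\<tau>\<bar> \<le> \<bar>h\<bar>" if "\<tau> \<in> closed_segment 0 h" for \<tau>
    using that by (auto simp: closed_segment_eq_real_ivl split: if_splits)
  have loc\<tau>: "rk_local s a b A N y g \<delta> M (of_real \<tau>)" if "\<tau> \<in> closed_segment 0 h" for \<tau>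
  proof unfold_locales
    have "16 * A * M * \<bar>\<tau>\<bar> \<le> 16 * A * M * \<bar>h\<bar>"
      using \<tau>[OF that] lh.M_nonneg A_ge_1 by (intro mult_left_mono) auto
    then show "16 * A * M * cmod (of_real \<tau>) \<le> \<delta>" using lh.small_h by simp
  qed (use lh.center lh.\<delta> lh.chol_g lh.bound_g in auto)
  have rks: "rk_stages V s a \<tau> g y k \<longleftrightarrow>
      (\<forall>i<s. stage_point (of_real \<tau>) y k i \<in> V \<and> k i = g (stage_point (of_real \<tau>) y k i))" for V \<tau> k
    by (simp add: rk_stages_def stage_point_def cscale_of_real)
  show ?thesis
    unfolding rk_step_def
  proof (rule the_equality)
    show "\<exists>k. (\<forall>i<s. continuous_on (closed_segment 0 h) (k i)) \<and>
        (\<forall>\<tau>\<in>closed_segment 0 h. rk_stages U s a \<tau> g y (\<lambda>i. k i \<tau>)) \<and>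
        y + h *\<^sub>R rk_mean (of_real h) g y = y + h *\<^sub>R (\<Sum>i<s. b i *\<^sub>R k i h)"
    proof (intro exI conjI ballI allI impI)
      show "continuous_on (closed_segment 0 h) (\<lambda>\<tau>. stage (of_real \<tau>) g y i)" if "i < s" for i
        by (rule continuous_on_stage[OF loc\<tau> that])
      show "rk_stages U s a \<tau> g y (\<lambda>i. stage (of_real \<tau>) g y i)" if "\<tau> \<in> closed_segment 0 h" for \<tau>
        unfolding rks using stays[OF that] rk_local.stage_eq[OF loc\<tau>[OF that]] by blast
    qed (simp add: rk_mean_def)
  next
    fix z assume "\<exists>k. (\<forall>i<s. continuous_on (closed_segment 0 h) (k i)) \<and>
        (\<forall>\<tau>\<in>closed_segment 0 h. rk_stages U s a \<tau> g y (\<lambda>i. k i \<tau>)) \<and>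
        z = y + h *\<^sub>R (\<Sum>i<s. b i *\<^sub>R k i h)"
    then obtain k where cont: "\<And>i. i < s \<Longrightarrow> continuous_on (closed_segment 0 h) (k i)"
      and k: "\<And>\<tau> i. \<tau> \<in> closed_segment 0 h \<Longrightarrow> i < s \<Longrightarrow>
        stage_point (of_real \<tau>) y (\<lambda>i. k i \<tau>) i \<in> U \<and>
        k i \<tau> = g (stage_point (of_real \<tau>) y (\<lambda>i. k i \<tau>) i)"
      and z: "z = y + h *\<^sub>R (\<Sum>i<s. b i *\<^sub>R k i h)"
      unfolding rks by blast
    define d where "d i \<tau> = norm (stage_point (of_real \<tau>) y (\<lambda>i. k i \<tau>) i - y)" for i \<tau>
    \<comment> \<open>Self-improvement: stage points within \<open>\<delta> / 2\<close> give values
      bounded by \<open>M\<close>, which bring the stage points back within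
      \<open>\<delta> / 16\<close>.\<close>
    have d_small: "d i \<tau> \<le> \<delta>/16"
      if t: "\<tau> \<in> closed_segment 0 h" "\<And>j. j < s \<Longrightarrow> d j \<tau> < \<delta>/2" "i < s" for i \<tau>
    proof -
      have k': "k j \<tau> \<in> cvec N \<and> norm (k j \<tau>) \<le> M" if "j < s" for j
      proof -
        have p: "stage_point (of_real \<tau>) y (\<lambda>i. k i \<tau>) j \<in> complex_ball N y \<delta>"
          using k[OF t(1) that] t(2)[OF that] U lh.\<delta> by (auto simp: complex_ball_def d_def)
        then have "stage_point (of_real \<tau>) y (\<lambda>i. k i \<tau>) j \<in> cvec N" by (simp add: complex_ball_def)
        with p show ?thesis
          using k[OF t(1) that] lh.bound_g jhol_maps_cvec[OF lh.chol_g UNIV_I] by metis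
      qed
      show ?thesis
        unfolding d_def by (rule rk_local.stage_point_in_ball(2)[OF loc\<tau>[OF t(1)] t(3)]) (use k' in auto)
    qed
    have cont_d: "continuous_on (closed_segment 0 h) (d i)" if "i < s" for i
      unfolding d_def stage_point_def cscale_of_real
      by (intro continuous_intros cont) auto
    \<comment> \<open>Two disjoint closed sets of step sizes: all displacements at most
      \<open>\<delta> / 16\<close>, or some displacement at least \<open>\<delta> / 2\<close>. By
      \<open>d_small\<close> they cover the segment, and 0 lies in the former, so by connectedness
      the latter is empty.\<close>
    let ?A = "closed_segment 0 h \<inter> (\<Inter>i<s. closed_segment 0 h \<inter> d i -` {..\<delta>/16})"
    let ?B = "\<Union>i<s. closed_segment 0 h \<inter> d i -` {\<delta>/2..}"
    have dist: "d i \<tau> < \<delta>/2" if "i < s" "\<tau> \<in> closed_segment 0 h" for i \<tau>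
    proof (rule ccontr)
      assume neg: "\<not> d i \<tau> < \<delta>/2"
      have cA: "closed ?A"
        by (intro closed_Int closed_INT ballI continuous_closed_preimage cont_d) auto
      have cB: "closed ?B"
        by (intro closed_UN ballI continuous_closed_preimage cont_d) auto
      have cover: "closed_segment 0 h \<subseteq> ?A \<union> ?B"
      proof
        fix \<tau> assume "\<tau> \<in> closed_segment 0 h"
        then show "\<tau> \<in> ?A \<union> ?B" using d_small[of \<tau>]
          by (cases "\<forall>j<s. d j \<tau> < \<delta>/2") (simp, force simp: not_less)
      qed
      have disj: "?A \<inter> ?B \<inter> closed_segment 0 h = {}" using lh.\<delta> by force
      have "0 \<in> ?A \<inter> closed_segment 0 h" using lh.\<delta> by (auto simp: d_def stage_point_def)
      moreover have "\<tau> \<in> ?B \<inter> closed_segment 0 h"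
        using that neg by (auto intro!: bexI[of _ i])
      ultimately show False
        using connected_closedD[OF connected_segment(1) disj cover cA cB] by blast
    qed
    have "k i h = stage (of_real h) g y i" if "i < s" for i
    proof (rule lh.stage_unique[OF _ _ that, of "\<lambda>i. k i h"])
      fix j assume "j < s"
      then show "stage_point (of_real h) y (\<lambda>i. k i h) j \<in> complex_ball N y (\<delta>/2)"
        using k[of h j] dist[of j h] U by (auto simp: complex_ball_def d_def)
      show "k j h = g (stage_point (of_real h) y (\<lambda>i. k i h) j)" using k[of h j] \<open>j < s\<close> by simp
    qed
    then show "z = y + h *\<^sub>R rk_mean (of_real h) g y" by (simp add: z rk_mean_def)
  qed
qed

lemma rk_step_eq_ball:
  assumes loc: "rk_local s a b A N y g \<delta> M (of_real h)"
    and U: "complex_ball N y \<delta> \<subseteq> U" "U \<subseteq> cvec N"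
  shows "rk_step U s a b h g y = y + h *\<^sub>R rk_mean (of_real h) g y"
proof (rule rk_step_eq[OF loc U(2)])
  interpret lh: rk_local s a b A N y g \<delta> M "of_real h" by (rule loc)
  fix \<tau> i assume \<tau>: "\<tau> \<in> closed_segment 0 h" and i: "i < s"
  have "\<bar>\<tau>\<bar> \<le> \<bar>h\<bar>" using \<tau> by (auto simp: closed_segment_eq_real_ivl split: if_splits)
  then have "16 * A * M * \<bar>\<tau>\<bar> \<le> 16 * A * M * \<bar>h\<bar>"
    using lh.M_nonneg A_ge_1 by (intro mult_left_mono) auto
  then have "rk_local s a b A N y g \<delta> M (of_real \<tau>)"
    using lh.small_h lh.center lh.\<delta> lh.chol_g lh.bound_g by unfold_locales auto
  from rk_local.stage_in_ball[OF this i]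
  show "stage_point (of_real \<tau>) y (stage (of_real \<tau>) g y) i \<in> U"
    using lh.half_subset U by blast
qed

end

subsection \<open>The flow as a limit of Euler polygons\<close>

lemma vector_derivative_bound:
  fixes y :: "real \<Rightarrow> 'a::real_normed_vector"
  assumes "convex S" "\<And>\<tau>. \<tau> \<in> S \<Longrightarrow> (y has_vector_derivative y' \<tau>) (at \<tau> within S)"
    and "\<And>\<tau>. \<tau> \<in> S \<Longrightarrow> norm (y' \<tau>) \<le> B" and "t \<in> S" "u \<in> S"
  shows "norm (y t - y u) \<le> B * \<bar>t - u\<bar>"
proof -
  have "norm (y t - y u) \<le> B * norm (t - u)"
  proof (rule differentiable_bound[OF assms(1)])
    show "(y has_derivative (\<lambda>h. h *\<^sub>R y' \<tau>)) (at \<tau> within S)" if "\<tau> \<in> S" for \<tau>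
      using assms(2)[OF that] by (simp add: has_vector_derivative_def)
    show "onorm (\<lambda>h. h *\<^sub>R y' \<tau>) \<le> B" if "\<tau> \<in> S" for \<tau>
      by (rule onorm_le) (use assms(3)[OF that] in \<open>simp add: mult.commute[of B] mult_left_mono\<close>)
  qed (use assms in auto)
  then show ?thesis by simp
qed

lemma integral_in_cvec:
  fixes c :: "real \<Rightarrow> cseq"
  assumes "c integrable_on S" "\<And>t. t \<in> S \<Longrightarrow> c t \<in> cvec N"
  shows "integral S c \<in> cvec N"
  unfolding cvec_def
proof (intro CollectI allI impI)
  fix i assume "i \<ge> N"
  have "coord (integral S c) i = integral S (\<lambda>t. coord (c t) i)"
    using integral_linear[OF assms(1) bounded_linear_coord[of i]] by (simp add: o_def)
  also have "\<dots> = integral S (\<lambda>t. 0)"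
    by (rule integral_cong) (use assms(2) \<open>i \<ge> N\<close> in \<open>auto simp: cvec_def\<close>)
  finally show "coord (integral S c) i = 0" by simp
qed

text \<open>Picard's theorem on a unit time interval. The interval can be fixed because the step
  size is absorbed into the field; a Lipschitz constant 1/2 of \<open>G\<close> is then a
  contraction constant for the integral operator.\<close>

lemma ode_solution_exists:
  assumes y0: "y0 \<in> cvec N" and "M \<ge> 0"
    and D: "D = {z \<in> cvec N. norm (z - y0) \<le> M}"
    and G: "\<And>z. z \<in> D \<Longrightarrow> G z \<in> cvec N" and M: "\<And>z. z \<in> D \<Longrightarrow> norm (G z) \<le> M"
    and lip: "\<And>z w. z \<in> D \<Longrightarrow> w \<in> D \<Longrightarrow> norm (G z - G w) \<le> 1/2 * norm (z - w)"
  obtains Y :: "real \<Rightarrow> cseq" where "Y 0 = y0" "\<And>t. t \<in> {0..1} \<Longrightarrow> Y t \<in> D"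
    "\<And>t. t \<in> {0..1} \<Longrightarrow> (Y has_vector_derivative G (Y t)) (at t within {0..1})"
proof -
  define X :: "(real, cseq) bcontfun set" where "X = PiC UNIV (\<lambda>_. D)"
  have memX: "Y \<in> X \<longleftrightarrow> (\<forall>t. apply_bcontfun Y t \<in> D)" for Y
    by (auto simp: X_def mem_PiC_iff)
  have "closed D"
  proof -
    have "D = cvec N \<inter> cball y0 M" by (auto simp: D dist_norm norm_minus_commute)
    then show ?thesis by (simp add: closed_Int closed_cvec)
  qed
  then have "complete X" unfolding complete_eq_closed X_def by (intro closed_PiC) auto
  have "y0 \<in> D" using y0 \<open>M \<ge> 0\<close> by (simp add: D)
  then have "const_bcontfun y0 \<in> X" by (simp add: memX const_bcontfun.rep_eq)
  then have "X \<noteq> {}" by blast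
  \<comment> \<open>Curves live on the whole real line, so that they are elements of a complete
    space of bounded continuous functions. Clamping the time makes the images under the integral
    operator constant outside the unit interval, hence bounded.\<close>
  define clamp :: "real \<Rightarrow> real" where "clamp t = max 0 (min 1 t)" for t
  have clamp: "clamp t \<in> {0..1}" for t by (auto simp: clamp_def)
  have contG: "continuous_on D G"
    by (rule lipschitz_on_continuous_on[OF lipschitz_onI[where L = "1/2"]])
      (use lip in \<open>auto simp: dist_norm\<close>)
  have contGY: "continuous_on T (\<lambda>u. G (apply_bcontfun Y u))" if "Y \<in> X" for Y T
    by (rule continuous_on_compose2[OF contG continuous_on_apply_bcontfun]) (use that memX in auto)
  define P where "P Y = (\<lambda>t. y0 + integral {0..clamp t} (\<lambda>u. G (apply_bcontfun Y u)))" for Y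
  have P_D: "P Y t \<in> D" if "Y \<in> X" for Y t
  proof -
    have int: "(\<lambda>u. G (apply_bcontfun Y u)) integrable_on {0..clamp t}"
      by (rule integrable_continuous_interval[OF contGY[OF that]])
    have "norm (integral {0..clamp t} (\<lambda>u. G (apply_bcontfun Y u))) \<le> M * (clamp t - 0)"
      by (rule integral_bound[OF _ contGY[OF that]]) (use clamp[of t] that memX M in auto)
    also have "\<dots> \<le> M" using clamp[of t] \<open>M \<ge> 0\<close> by (simp add: mult_left_le)
    finally have "norm (P Y t - y0) \<le> M" by (simp add: P_def)
    moreover have "P Y t \<in> cvec N"
      unfolding P_def by (intro cvec_intros y0 integral_in_cvec[OF int]) (use that memX G in auto)
    ultimately show ?thesis by (simp add: D)
  qed
  have P_bcontfun: "P Y \<in> bcontfun" if "Y \<in> X" for Y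
  proof (rule bcontfun_normI)
    have "continuous_on {0..1} (\<lambda>t. integral {0..t} (\<lambda>u. G (apply_bcontfun Y u)))"
      by (rule indefinite_integral_continuous_1[OF integrable_continuous_interval[OF contGY[OF that]]])
    then have "continuous_on UNIV (\<lambda>t. integral {0..clamp t} (\<lambda>u. G (apply_bcontfun Y u)))"
      by (rule continuous_on_compose2) (use clamp in \<open>auto simp: clamp_def intro!: continuous_intros\<close>)
    then show "continuous_on UNIV (P Y)" unfolding P_def by (intro continuous_intros)
    show "norm (P Y t) \<le> norm y0 + M" for t
      using P_D[OF that, of t] norm_triangle_ineq[of y0 "P Y t - y0"] by (simp add: D)
  qed
  define Q where "Q Y = Bcontfun (P Y)" for Y
  have Q: "apply_bcontfun (Q Y) = P Y" if "Y \<in> X" for Y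
    by (simp add: Q_def Bcontfun_inverse P_bcontfun that)
  have "\<exists>!Y. Y \<in> X \<and> Q Y = Y"
  proof (rule Banach_fix[OF \<open>complete X\<close> \<open>X \<noteq> {}\<close>, of "1/2"])
    show "Q ` X \<subseteq> X" using P_D Q by (auto simp: memX)
    fix Y Z assume YZ: "Y \<in> X" "Z \<in> X"
    show "dist (Q Y) (Q Z) \<le> 1/2 * dist Y Z"
    proof (rule dist_bound)
      fix t
      let ?g = "\<lambda>u. G (apply_bcontfun Y u) - G (apply_bcontfun Z u)"
      have "P Y t - P Z t = integral {0..clamp t} ?g"
        unfolding P_def
        by (simp add: integral_diff integrable_continuous_interval contGY YZ)
      also have "norm \<dots> \<le> (1/2 * dist Y Z) * (clamp t - 0)"
      proof (rule integral_bound)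
        show "continuous_on {0..clamp t} ?g" by (intro continuous_intros contGY YZ)
        fix u
        have "norm (?g u) \<le> 1/2 * dist (apply_bcontfun Y u) (apply_bcontfun Z u)"
          unfolding dist_norm by (rule lip) (use YZ memX in auto)
        also have "\<dots> \<le> 1/2 * dist Y Z" by (intro mult_left_mono dist_bounded) auto
        finally show "norm (?g u) \<le> 1/2 * dist Y Z" .
      qed (use clamp[of t] in auto)
      also have "\<dots> \<le> 1/2 * dist Y Z" using clamp[of t] by (simp add: mult_left_le)
      finally show "dist (apply_bcontfun (Q Y) t) (apply_bcontfun (Q Z) t) \<le> 1/2 * dist Y Z"
        by (simp add: dist_norm Q YZ)
    qed
  qed auto
  then obtain Y where Y: "Y \<in> X" "Q Y = Y" by blast
  then have eq: "apply_bcontfun Y t = P Y t" for t using Q by metis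
  show ?thesis
  proof (rule that[of "apply_bcontfun Y"])
    show "apply_bcontfun Y 0 = y0" by (subst eq) (simp add: P_def clamp_def)
    show "apply_bcontfun Y t \<in> D" for t using Y(1) by (simp add: memX)
    fix t :: real assume t: "t \<in> {0..1}"
    have "((\<lambda>t. y0 + integral {0..t} (\<lambda>u. G (apply_bcontfun Y u))) has_vector_derivative
        0 + G (apply_bcontfun Y t)) (at t within {0..1})"
      by (intro has_vector_derivative_add has_vector_derivative_const
          integral_has_vector_derivative[OF contGY[OF Y(1)] t])
    then show "(apply_bcontfun Y has_vector_derivative G (apply_bcontfun Y t)) (at t within {0..1})"
      unfolding has_vector_derivative_def add_0
      by (rule has_derivative_transform[OF t, rotated]) (subst eq, simp add: P_def clamp_def)
  qed
qed

text \<open>Explicit polygon with \<open>n\<close> substeps of complex size \<open>h / n\<close>. It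
  is a finite composition, hence jointly holomorphic in \<open>h\<close> and
  \<open>y\<close>.\<close>

primrec euler :: "complex \<Rightarrow> (cseq \<Rightarrow> cseq) \<Rightarrow> cseq \<Rightarrow> nat \<Rightarrow> nat \<Rightarrow> cseq" where
  "euler h g y n 0 = y"
| "euler h g y n (Suc j) = euler h g y n j + cscale h ((1 / real n) *\<^sub>R g (euler h g y n j))"

definition euler_mean :: "complex \<Rightarrow> (cseq \<Rightarrow> cseq) \<Rightarrow> cseq \<Rightarrow> nat \<Rightarrow> cseq" where
  "euler_mean h g y n = (1 / real n) *\<^sub>R (\<Sum>j<n. g (euler h g y n j))"

text \<open>The counterpart of \<open>rk_mean\<close> for the exact flow: (flow - y) / h, also at
  \<open>h = 0\<close> and for complex \<open>h\<close>. The index \<open>Suc n\<close> avoids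
  division by 0.\<close>

definition flow_mean :: "complex \<Rightarrow> (cseq \<Rightarrow> cseq) \<Rightarrow> cseq \<Rightarrow> cseq" where
  "flow_mean h g y = lim (\<lambda>n. euler_mean h g y (Suc n))"

lemma euler_eq: "euler h g y n j = y + cscale h ((1 / real n) *\<^sub>R (\<Sum>i<j. g (euler h g y n i)))"
  by (induction j) (simp_all add: cscale_add_right scaleR_add_right algebra_simps)

lemma euler_end: "euler h g y n n = y + cscale h (euler_mean h g y n)"
  unfolding euler_mean_def by (rule euler_eq)

locale flow_local =
  fixes N :: nat and y :: cseq and g :: "cseq \<Rightarrow> cseq" and \<delta> M :: real and h :: complex
  assumes center: "y \<in> cvec N" and \<delta>: "\<delta> > 0"
    and chol_g: "chol N (complex_ball N y \<delta>) g"
    and bound_g: "\<And>z. z \<in> complex_ball N y \<delta> \<Longrightarrow> norm (g z) \<le> M"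
    and small_h: "16 * M * cmod h \<le> \<delta>"
begin

lemma M_nonneg: "M \<ge> 0"
  by (rule order_trans[OF norm_ge_zero bound_g[of y]]) (simp add: complex_ball_def center \<delta>)

lemma half_subset: "complex_ball N y (\<delta>/2) \<subseteq> complex_ball N y \<delta>"
  using \<delta> by (auto simp: complex_ball_def)

lemma g_in_cvec: "z \<in> complex_ball N y \<delta> \<Longrightarrow> g z \<in> cvec N"
  by (rule jhol_maps_cvec[OF chol_g UNIV_I]) (auto simp: complex_ball_def)

lemma lipschitz_scaled:
  assumes "z \<in> complex_ball N y (\<delta>/2)" "w \<in> complex_ball N y (\<delta>/2)"
  shows "norm (cscale h (g z) - cscale h (g w)) \<le> 1/2 * norm (z - w)"
proof -
  have "norm (cscale h (g z) - cscale h (g w)) \<le> cmod h * (8 * M / \<delta> * norm (z - w))"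
    unfolding cscale_diff_right[symmetric] norm_cscale
    by (rule mult_left_mono[OF chol_lipschitz_half_ball[OF chol_g bound_g assms]]) auto
  also have "\<dots> = (16 * M * cmod h) * norm (z - w) / (2 * \<delta>)" by (simp add: mult_ac)
  also have "\<dots> \<le> \<delta> * norm (z - w) / (2 * \<delta>)"
    by (intro divide_right_mono mult_right_mono small_h) (use \<delta> in auto)
  finally show ?thesis using \<delta> by simp
qed

lemma euler_in_ball:
  assumes "j \<le> n"
  shows "euler h g y n j \<in> complex_ball N y (\<delta>/2) \<and> norm (euler h g y n j - y) \<le> real j / real n * (cmod h * M)"
  using assms
proof (induction j)
  case 0
  then show ?case using center \<delta> by (simp add: complex_ball_def)
next
  case (Suc j)
  then have IH: "euler h g y n j \<in> complex_ball N y \<delta>"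
    "norm (euler h g y n j - y) \<le> real j / real n * (cmod h * M)" using half_subset by auto
  have cv: "euler h g y n (Suc j) \<in> cvec N"
    using IH(1) g_in_cvec by (auto simp: complex_ball_def intro!: cvec_intros)
  have "norm (euler h g y n (Suc j) - y) \<le> norm (euler h g y n j - y) +
      norm (cscale h ((1 / real n) *\<^sub>R g (euler h g y n j)))"
    using norm_triangle_ineq[of "euler h g y n j - y" "cscale h ((1 / real n) *\<^sub>R g (euler h g y n j))"]
    by (simp add: algebra_simps)
  also have "\<dots> \<le> real j / real n * (cmod h * M) + cmod h * (1 / real n * M)"
    unfolding norm_cscale norm_scaleR
    by (intro add_mono IH mult_mono) (use bound_g[OF IH(1)] in auto)
  also have "\<dots> = real (Suc j) / real n * (cmod h * M)" by (simp add: algebra_simps add_divide_distrib)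
  finally have *: "norm (euler h g y n (Suc j) - y) \<le> real (Suc j) / real n * (cmod h * M)" .
  also have "\<dots> \<le> 1 * (cmod h * M)" using Suc.prems M_nonneg by (intro mult_right_mono) auto
  also have "\<dots> < \<delta>/2" using small_h \<delta> by (simp add: mult_ac)
  finally show ?case using * cv by (simp add: complex_ball_def)
qed

lemma euler_mean_center: "norm (euler_mean h g y (Suc n) - g y) \<le> 4 * M / \<delta> * (cmod h * M)"
proof -
  let ?n = "Suc n" and ?e = "\<lambda>j. g (euler h g y (Suc n) j)"
  have step: "norm (?e j - g y) \<le> 4 * M / \<delta> * (cmod h * M)" if "j < ?n" for j
  proof -
    have e: "euler h g y ?n j \<in> complex_ball N y \<delta>"
      "norm (euler h g y ?n j - y) \<le> real j / real ?n * (cmod h * M)"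
      using euler_in_ball[of j ?n] that half_subset by auto
    have "norm (?e j - g y) \<le> 4 * M / \<delta> * norm (euler h g y ?n j - y)"
      by (rule chol_lipschitz_center[OF chol_g bound_g center e(1)])
    also have "\<dots> \<le> 4 * M / \<delta> * (1 * (cmod h * M))"
      using that M_nonneg \<delta> by (intro mult_left_mono order_trans[OF e(2)] mult_right_mono) auto
    finally show ?thesis by simp
  qed
  have "euler_mean h g y ?n - g y = (1 / real ?n) *\<^sub>R (\<Sum>j<?n. ?e j - g y)"
    by (simp add: euler_mean_def sum_subtractf scaleR_diff_right sum_constant_scaleR del: sum.lessThan_Suc)
  also have "norm \<dots> \<le> (1 / real ?n) * (real ?n * (4 * M / \<delta> * (cmod h * M)))"
    unfolding norm_scaleR
    using sum_norm_bound[of "{..<?n}" "\<lambda>j. ?e j - g y", OF step] by (intro mult_mono) auto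
  finally show ?thesis by simp
qed

text \<open>Complex time is made real by scaling the field: the value at time 1 of the solution for
  the field \<open>cscale h (g z)\<close> plays the role of the flow at the complex time
  \<open>h\<close>.\<close>

lemma solution_exists:
  obtains Y :: "real \<Rightarrow> cseq" where "Y 0 = y" "\<And>t. t \<in> {0..1} \<Longrightarrow> Y t \<in> complex_ball N y (\<delta>/2)"
    "\<And>t. t \<in> {0..1} \<Longrightarrow> (Y has_vector_derivative cscale h (g (Y t))) (at t within {0..1})"
proof -
  define D where "D = {z \<in> cvec N. norm (z - y) \<le> cmod h * M}"
  have "cmod h * M < \<delta>/2" using small_h \<delta> by (simp add: mult_ac)
  then have sub: "D \<subseteq> complex_ball N y (\<delta>/2)" by (auto simp: D_def complex_ball_def)
  show ?thesis
  proof (rule ode_solution_exists[OF center _ D_def])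
    show "0 \<le> cmod h * M" using M_nonneg by simp
    show "cscale h (g z) \<in> cvec N" if "z \<in> D" for z
      using that sub half_subset g_in_cvec by (blast intro: cvec_cscale)
    show "norm (cscale h (g z)) \<le> cmod h * M" if "z \<in> D" for z
      unfolding norm_cscale using that sub half_subset by (intro mult_left_mono bound_g) auto
    show "norm (cscale h (g z) - cscale h (g w)) \<le> 1/2 * norm (z - w)" if "z \<in> D" "w \<in> D" for z w
      using that sub by (intro lipschitz_scaled) auto
  qed (use sub that in blast)
qed

text \<open>The scaled field is bounded by \<open>K\<close> and has Lipschitz constant 1/2, so a
  substep of length \<open>r = 1 / n\<close> has local error at most \<open>K * r * r / 2\<close>
  and amplifies earlier errors by \<open>1 + r / 2\<close>. The bound depends on \<open>h\<close>,
  \<open>M\<close> and \<open>n\<close> only, not on the solution.\<close>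

lemma euler_error:
  assumes Y0: "Y 0 = y" and Y: "\<And>t. t \<in> {0..1} \<Longrightarrow> Y t \<in> complex_ball N y (\<delta>/2)"
    and deriv: "\<And>t. t \<in> {0..1} \<Longrightarrow> (Y has_vector_derivative cscale h (g (Y t))) (at t within {0..1})"
    and "n \<ge> 1"
  shows "norm (Y 1 - euler h g y n n) \<le> cmod h * M / real n"
proof -
  define L where "L = cmod h * (8 * M / \<delta>)"
  define K where "K = cmod h * M"
  have K: "K \<ge> 0" using M_nonneg by (simp add: K_def)
  let ?G = "\<lambda>z. cscale h (g z)"
  have GK: "norm (?G (Y t)) \<le> K" if "t \<in> {0..1}" for t
    unfolding norm_cscale K_def using Y[OF that] half_subset by (intro mult_left_mono bound_g) auto
  have lip: "norm (?G z - ?G w) \<le> 1/2 * norm (z - w)"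
    if "z \<in> complex_ball N y (\<delta>/2)" "w \<in> complex_ball N y (\<delta>/2)" for z w
    by (rule lipschitz_scaled[OF that])
  have n: "real n > 0" using \<open>n \<ge> 1\<close> by simp
  define r where "r = 1 / real n"
  have r: "r > 0" "r * real n = 1" using n by (auto simp: r_def)
  \<comment> \<open>The right-hand side solves e (Suc j) = (1 + r / 2) * e j + K * r * r / 2 with e
    0 = 0.\<close>
  have err: "norm (Y (real j * r) - euler h g y n j) \<le> K * r * ((1 + r/2) ^ j - 1)" if "j \<le> n" for j
    using that
  proof (induction j)
    case (Suc j)
    define t where "t = real j * r"
    have t': "real (Suc j) * r = t + r" by (simp add: t_def algebra_simps)
    have "real (Suc j) * r \<le> real n * r" using Suc.prems r by (intro mult_right_mono) auto
    then have tr: "t + r \<le> 1" unfolding t' using r by (simp add: mult.commute)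
    have "0 \<le> t" using r by (simp add: t_def)
    note tr = this tr
    then have sub: "{t..t+r} \<subseteq> {0..1}" by auto
    have Ye: "euler h g y n j \<in> complex_ball N y (\<delta>/2)" using euler_in_ball[of j n] Suc.prems by simp
    \<comment> \<open>The mean value inequality for \<open>Y\<close> minus its tangent direction at
      \<open>t\<close>; the derivative of this difference is small because \<open>Y\<close> moves by
      at most \<open>K * r\<close>.\<close>
    have "norm ((Y (t + r) - (t + r) *\<^sub>R ?G (Y t)) - (Y t - t *\<^sub>R ?G (Y t))) \<le> (1/2 * (K * r)) * \<bar>(t + r) - t\<bar>"
    proof (rule vector_derivative_bound[where S = "{t..t+r}"])
      fix u assume u: "u \<in> {t..t+r}"
      have "((\<lambda>u. u *\<^sub>R ?G (Y t)) has_vector_derivative ?G (Y t)) (at u within {t..t+r})"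
        unfolding has_vector_derivative_def
        by (rule bounded_linear_imp_has_derivative[OF bounded_linear_scaleR_left])
      then show "((\<lambda>u. Y u - u *\<^sub>R ?G (Y t)) has_vector_derivative ?G (Y u) - ?G (Y t)) (at u within {t..t+r})"
        by (intro has_vector_derivative_diff has_vector_derivative_within_subset[OF deriv sub])
          (use u sub in auto)
      have "norm (Y u - Y t) \<le> K * \<bar>u - t\<bar>"
        by (rule vector_derivative_bound[OF convex_real_interval(5) deriv GK]) (use u sub tr r in auto)
      also have "\<dots> \<le> K * r" using u K by (intro mult_left_mono) auto
      finally have "norm (Y u - Y t) \<le> K * r" .
      then show "norm (?G (Y u) - ?G (Y t)) \<le> 1/2 * (K * r)"
        using lip[OF Y Y, of u t] u sub tr r by fastforce
    qed (use r in auto)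
    then have A: "norm (Y (t + r) - Y t - r *\<^sub>R ?G (Y t)) \<le> K * r * r / 2"
      using r by (simp add: algebra_simps)
    have "norm (?G (Y t) - ?G (euler h g y n j)) \<le> 1/2 * norm (Y t - euler h g y n j)"
      by (rule lip[OF Y Ye]) (use tr r in auto)
    then have B: "norm (r *\<^sub>R (?G (Y t) - ?G (euler h g y n j))) \<le> r/2 * norm (Y t - euler h g y n j)"
      using r by simp
    have "Y (t + r) - euler h g y n (Suc j) = (Y (t + r) - Y t - r *\<^sub>R ?G (Y t)) +
        (Y t - euler h g y n j) + r *\<^sub>R (?G (Y t) - ?G (euler h g y n j))"
      by (simp add: cscale_scaleR r_def algebra_simps)
    also have "norm \<dots> \<le> K * r * r / 2 + norm (Y t - euler h g y n j) + r/2 * norm (Y t - euler h g y n j)"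
      by (intro norm_triangle_le add_mono A B order_refl)
    also have "\<dots> = K * r * r / 2 + (1 + r/2) * norm (Y t - euler h g y n j)" by (simp add: algebra_simps)
    also have "\<dots> \<le> K * r * r / 2 + (1 + r/2) * (K * r * ((1 + r/2) ^ j - 1))"
      using Suc r by (intro add_left_mono mult_left_mono) (auto simp: t_def)
    also have "\<dots> = K * r * ((1 + r/2) ^ Suc j - 1)" by (simp add: algebra_simps)
    finally show ?case unfolding t' .
  qed (simp add: Y0)
  have "(1 + r/2) ^ n \<le> exp (r/2) ^ n" using r by (intro power_mono) (auto simp: exp_ge_add_one_self)
  also have "\<dots> = exp (1/2)" using r by (simp add: exp_of_nat_mult[symmetric] mult.commute)
  also have "\<dots> \<le> 2" using exp_bound_half[of "1/2 :: real"] by simp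
  finally have "(1 + r/2) ^ n - 1 \<le> 1" by simp
  then have "K * r * ((1 + r/2) ^ n - 1) \<le> K * r * 1" using K r by (intro mult_left_mono) auto
  then show ?thesis using err[of n] r by (simp add: K_def r_def mult.commute)
qed

text \<open>The rate \<open>M / (n + 1)\<close> does not depend on \<open>y\<close> or
  \<open>h\<close>; this uniformity makes the limit holomorphic. The second part says that every
  solution confined to the half ball ends at the Euler limit, and so identifies solutions with
  \<open>flow_mean\<close>.\<close>

lemma euler_mean_limit:
  shows "norm (euler_mean h g y (Suc n) - flow_mean h g y) \<le> M / real (Suc n)" (is ?A)
    and "Y 0 = y \<Longrightarrow> (\<And>t. t \<in> {0..1} \<Longrightarrow> Y t \<in> complex_ball N y (\<delta>/2)) \<Longrightarrow>
      (\<And>t. t \<in> {0..1} \<Longrightarrow> (Y has_vector_derivative cscale h (g (Y t))) (at t within {0..1})) \<Longrightarrow>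
      Y 1 = y + cscale h (flow_mean h g y)"
proof -
  have ex: "\<exists>p. \<forall>n. norm (euler_mean h g y (Suc n) - p) \<le> M / real (Suc n)"
  \<comment> \<open>Division by \<open>h\<close> recovers the mean from the end point. At
    \<open>h = 0\<close> the polygon rests at \<open>y\<close> and all means equal
    \<open>g y\<close>.\<close>
  proof (cases "h = 0")
    case True
    have "euler h g y n j = y" for n j by (induction j) (simp_all add: True)
    then have "euler_mean h g y (Suc n) = g y" for n
      unfolding euler_mean_def by (simp add: sum_constant_scaleR del: sum.lessThan_Suc)
    then show ?thesis using M_nonneg by (intro exI[of _ "g y"]) simp
  next
    case False
    obtain Y where Y: "Y 0 = y" "\<And>t. t \<in> {0..1} \<Longrightarrow> Y t \<in> complex_ball N y (\<delta>/2)"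
      "\<And>t. t \<in> {0..1} \<Longrightarrow> (Y has_vector_derivative cscale h (g (Y t))) (at t within {0..1})"
      using solution_exists by blast
    have "norm (euler_mean h g y (Suc n) - cscale (1 / h) (Y 1 - y)) \<le> M / real (Suc n)" for n
    proof -
      have "cscale h (euler_mean h g y (Suc n) - cscale (1 / h) (Y 1 - y)) =
          euler h g y (Suc n) (Suc n) - Y 1"
        unfolding euler_end using False by (simp add: cscale_diff_right cscale_cscale)
      then have "cmod h * norm (euler_mean h g y (Suc n) - cscale (1 / h) (Y 1 - y)) \<le>
          cmod h * (M / real (Suc n))"
        using euler_error[OF Y, of "Suc n"] norm_cscale norm_minus_commute
        by (metis One_nat_def Suc_le_mono le0 times_divide_eq_right)
      then show ?thesis by (rule mult_left_le_imp_le) (use False in simp)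
    qed
    then show ?thesis by blast
  qed
  then obtain p where p: "\<And>n. norm (euler_mean h g y (Suc n) - p) \<le> M / real (Suc n)" by blast
  have zero: "(\<lambda>n. M / real (Suc n)) \<longlonglongrightarrow> 0"
    by (rule real_tendsto_divide_at_top[OF tendsto_const filterlim_compose[OF filterlim_real_sequentially filterlim_Suc]])
  have "(\<lambda>n. euler_mean h g y (Suc n) - p) \<longlonglongrightarrow> 0"
    by (rule Lim_null_comparison[OF _ zero]) (use p in simp)
  then have lim: "(\<lambda>n. euler_mean h g y (Suc n)) \<longlonglongrightarrow> p" by (simp add: LIM_zero_iff)
  then have P: "flow_mean h g y = p" by (simp add: flow_mean_def limI)
  then show ?A using p by simp
  assume Y: "Y 0 = y" "\<And>t. t \<in> {0..1} \<Longrightarrow> Y t \<in> complex_ball N y (\<delta>/2)"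
    "\<And>t. t \<in> {0..1} \<Longrightarrow> (Y has_vector_derivative cscale h (g (Y t))) (at t within {0..1})"
  have "(\<lambda>n. cmod h * (M / real (Suc n))) \<longlonglongrightarrow> 0" by (rule tendsto_mult_right_zero[OF zero])
  then have "(\<lambda>n. Y 1 - euler h g y (Suc n) (Suc n)) \<longlonglongrightarrow> 0"
    by (rule Lim_null_comparison[rotated]) (use euler_error[OF Y, of "Suc _"] in \<open>simp del: euler.simps\<close>)
  then have 1: "(\<lambda>n. euler h g y (Suc n) (Suc n)) \<longlonglongrightarrow> Y 1"
    using tendsto_diff[OF tendsto_const[of "Y 1"], of "\<lambda>n. Y 1 - euler h g y (Suc n) (Suc n)" 0 sequentially]
    by (simp del: euler.simps)
  have "(\<lambda>n. norm (euler h g y (Suc n) (Suc n) - (y + cscale h p))) \<longlonglongrightarrow> 0"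
    unfolding euler_end using tendsto_mult_right_zero[OF tendsto_norm_zero[OF \<open>(\<lambda>n. euler_mean h g y (Suc n) - p) \<longlonglongrightarrow> 0\<close>], of "cmod h"]
    by (simp add: norm_cscale flip: cscale_diff_right)
  then have "(\<lambda>n. euler h g y (Suc n) (Suc n)) \<longlonglongrightarrow> y + cscale h p"
    by (rule LIM_zero_cancel[OF tendsto_norm_zero_cancel])
  with 1 show "Y 1 = y + cscale h (flow_mean h g y)" unfolding P by (rule LIMSEQ_unique)
qed

lemma euler_mean_LIMSEQ: "(\<lambda>n. euler_mean h g y (Suc n)) \<longlonglongrightarrow> flow_mean h g y"
proof -
  have zero: "(\<lambda>n. M / real (Suc n)) \<longlonglongrightarrow> 0"
    by (rule real_tendsto_divide_at_top[OF tendsto_const filterlim_compose[OF filterlim_real_sequentially filterlim_Suc]])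
  have "(\<lambda>n. euler_mean h g y (Suc n) - flow_mean h g y) \<longlonglongrightarrow> 0"
    by (rule Lim_null_comparison[OF _ zero]) (use euler_mean_limit(1) in simp)
  then show ?thesis by (simp add: LIM_zero_iff)
qed

lemma flow_mean_center: "norm (flow_mean h g y - g y) \<le> 4 * M / \<delta> * (cmod h * M)"
  by (rule LIMSEQ_le_const2[OF tendsto_norm[OF tendsto_diff[OF euler_mean_LIMSEQ tendsto_const]]])
    (intro exI allI impI euler_mean_center)

end

section \<open>Holomorphy of the flow, and agreement with the real solution curve\<close>

lemma flow_localI:
  assumes "chol N (complex_ball N x \<rho>) g" "\<And>z. z \<in> complex_ball N x \<rho> \<Longrightarrow> norm (g z) \<le> M"
    and "\<delta> > 0" "16 * M * cmod h \<le> \<delta>" "y \<in> complex_ball N x (\<rho> - \<delta>)"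
  shows "flow_local N y g \<delta> M h"
proof unfold_locales
  have sub: "complex_ball N y \<delta> \<subseteq> complex_ball N x \<rho>"
    by (rule complex_ball_mono) (use assms(5) in \<open>simp add: complex_ball_def\<close>)
  show "chol N (complex_ball N y \<delta>) g" by (rule jhol_subset[OF assms(1) order_refl sub])
  show "norm (g z) \<le> M" if "z \<in> complex_ball N y \<delta>" for z using assms(2) sub that by blast
qed (use assms in \<open>auto simp: complex_ball_def\<close>)

lemma jhol_flow_mean:
  assumes f: "chol N (complex_ball N x \<rho>) f"
    and M: "\<And>z. z \<in> complex_ball N x \<rho> \<Longrightarrow> norm (f z) \<le> M"
    and "\<delta> > 0" and small: "\<And>h. h \<in> D \<Longrightarrow> 16 * M * cmod h \<le> \<delta>"
  shows "jhol N D (complex_ball N x (\<rho> - \<delta>)) (\<lambda>h. flow_mean h f)"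
proof -
  have loc: "flow_local N y f \<delta> M h" if "h \<in> D" "y \<in> complex_ball N x (\<rho> - \<delta>)" for h y
    by (rule flow_localI[OF f M]) (use that small \<open>\<delta> > 0\<close> in auto)
  have in_ball: "euler h f y n j \<in> complex_ball N x \<rho>"
    if "h \<in> D" "y \<in> complex_ball N x (\<rho> - \<delta>)" "j \<le> n" for h y n j
  proof -
    have "complex_ball N y (\<delta>/2) \<subseteq> complex_ball N x \<rho>"
      by (rule complex_ball_mono) (use that \<open>\<delta> > 0\<close> in \<open>simp add: complex_ball_def\<close>)
    then show ?thesis
      using flow_local.euler_in_ball[OF loc[OF that(1,2)] that(3)] by blast
  qed
  have fe: "jhol N D (complex_ball N x (\<rho> - \<delta>)) (\<lambda>h y. f (euler h f y n j))"
    if "jhol N D (complex_ball N x (\<rho> - \<delta>)) (\<lambda>h y. euler h f y n j)" "j \<le> n" for n j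
    by (rule jhol_compose[OF chol_jhol[OF f] that(1)]) (use in_ball that in blast)
  have e: "jhol N D (complex_ball N x (\<rho> - \<delta>)) (\<lambda>h y. euler h f y n j)" if "j \<le> n" for n j
    using that
  proof (induction j)
    case (Suc j)
    then show ?case unfolding euler.simps by (intro jhol_intros fe) auto
  qed (simp add: jhol_ident)
  show ?thesis
  proof (rule jhol_uniform_limit)
    show "jhol N D (complex_ball N x (\<rho> - \<delta>)) (\<lambda>h y. euler_mean h f y (Suc n))" for n
      unfolding euler_mean_def by (intro jhol_intros fe e) auto
    show "norm (euler_mean h f y (Suc n) - flow_mean h f y) \<le> M / real (Suc n)"
      if "h \<in> D" "y \<in> complex_ball N x (\<rho> - \<delta>)" for h y n
      by (rule flow_local.euler_mean_limit(1)[OF loc[OF that]])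
    show "(\<lambda>n. M / real (Suc n)) \<longlonglongrightarrow> 0"
      by (rule real_tendsto_divide_at_top[OF tendsto_const filterlim_compose[OF filterlim_real_sequentially filterlim_Suc]])
  qed
qed

lemma flow_local_smaller:
  assumes "flow_local N y g \<delta> M h" "cmod h' \<le> cmod h"
  shows "flow_local N y g \<delta> M h'"
proof -
  interpret flow_local N y g \<delta> M h by (rule assms(1))
  show ?thesis
  proof unfold_locales
    have "16 * M * cmod h' \<le> 16 * M * cmod h"
      using assms(2) M_nonneg by (intro mult_left_mono) auto
    then show "16 * M * cmod h' \<le> \<delta>" using small_h by simp
  qed (use center \<delta> chol_g bound_g in auto)
qed

text \<open>\<open>flow_mean\<close> is constructed for each step size separately, so it is not
  evident that the end points form one solution. If \<open>Y\<close> is the solution for step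
  \<open>h\<close>, then \<open>t \<mapsto> Y (\<sigma> * t)\<close> is the solution for step
  \<open>\<sigma> * h\<close>; hence \<open>Y \<sigma>\<close> is the end point belonging to
  \<open>\<sigma> * h\<close>.\<close>

lemma flow_curve:
  assumes loc: "flow_local N y g \<delta> M (of_real h)"
  defines "c \<equiv> \<lambda>\<tau>. y + \<tau> *\<^sub>R flow_mean (of_real \<tau>) g y"
  assumes \<tau>: "\<tau> \<in> closed_segment 0 h"
  shows "c \<tau> \<in> complex_ball N y (\<delta>/2)"
    and "(c has_vector_derivative g (c \<tau>)) (at \<tau> within closed_segment 0 h)"
proof -
  interpret l: flow_local N y g \<delta> M "of_real h" by (rule loc)
  obtain Y where Y: "Y 0 = y" "\<And>t. t \<in> {0..1} \<Longrightarrow> Y t \<in> complex_ball N y (\<delta>/2)"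
    "\<And>t. t \<in> {0..1} \<Longrightarrow> (Y has_vector_derivative cscale (of_real h) (g (Y t))) (at t within {0..1})"
    by (rule l.solution_exists) blast
  have Yc: "Y \<sigma> = c (\<sigma> * h)" if \<sigma>: "\<sigma> \<in> {0..1}" for \<sigma>
  proof -
    interpret s: flow_local N y g \<delta> M "of_real (\<sigma> * h)"
      by (rule flow_local_smaller[OF loc])
        (use \<sigma> in \<open>auto simp: norm_mult intro: mult_left_le_one_le\<close>)
    define Z where "Z t = Y (\<sigma> * t)" for t
    have im: "(\<lambda>t. \<sigma> * t) ` {0..1} \<subseteq> {0..1}" using \<sigma> by (auto simp: mult_le_one)
    have "Z 1 = y + cscale (of_real (\<sigma> * h)) (flow_mean (of_real (\<sigma> * h)) g y)"
    proof (rule s.euler_mean_limit(2))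
      show "Z 0 = y" by (simp add: Z_def Y)
      fix t :: real assume t: "t \<in> {0..1}"
      then have st: "\<sigma> * t \<in> {0..1}" using im by blast
      then show "Z t \<in> complex_ball N y (\<delta>/2)" by (simp add: Z_def Y)
      have "((\<lambda>t. \<sigma> * t) has_vector_derivative \<sigma>) (at t within {0..1})"
        unfolding has_real_derivative_iff_has_vector_derivative[symmetric]
        by (auto intro!: derivative_eq_intros)
      from vector_diff_chain_within[OF this has_vector_derivative_within_subset[OF Y(3)[OF st] im]]
      have "(Y \<circ> (\<lambda>t. \<sigma> * t) has_vector_derivative \<sigma> *\<^sub>R cscale (of_real h) (g (Y (\<sigma> * t)))) (at t within {0..1})" .
      moreover have "\<sigma> *\<^sub>R cscale (of_real h) (g (Y (\<sigma> * t))) = cscale (of_real (\<sigma> * h)) (g (Z t))"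
        by (simp only: cscale_of_real Z_def scaleR_scaleR)
      ultimately show "(Z has_vector_derivative cscale (of_real (\<sigma> * h)) (g (Z t))) (at t within {0..1})"
        by (simp add: Z_def[abs_def] o_def)
    qed
    then show ?thesis by (simp add: Z_def c_def cscale_of_real del: of_real_mult)
  qed
  show "c \<tau> \<in> complex_ball N y (\<delta>/2)"
  proof (cases "h = 0")
    case True
    then show ?thesis using \<tau> l.center l.\<delta> by (simp add: c_def complex_ball_def)
  next
    case False
    then have "\<tau> / h \<in> {0..1}" using \<tau>
      by (auto simp: closed_segment_eq_real_ivl divide_simps split: if_splits)
    then show ?thesis using Yc[of "\<tau> / h"] Y(2)[of "\<tau> / h"] False by simp
  qed
  show "(c has_vector_derivative g (c \<tau>)) (at \<tau> within closed_segment 0 h)"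
  proof (cases "h = 0")
    \<comment> \<open>The segment is a single point, and differentiation within it is
      trivial.\<close>
    case True
    then show ?thesis
      using \<tau> by (simp add: has_vector_derivative_def has_derivative_bot bounded_linear_scaleR_left at_within_def)
  next
    case False
    have ivl: "\<tau> / h \<in> {0..1}" if "\<tau> \<in> closed_segment 0 h" for \<tau>
      using that False by (auto simp: closed_segment_eq_real_ivl divide_simps split: if_splits)
    have "((\<lambda>\<tau>. \<tau> / h) has_vector_derivative 1 / h) (at \<tau> within closed_segment 0 h)"
      unfolding has_real_derivative_iff_has_vector_derivative[symmetric]
      using False by (auto intro!: derivative_eq_intros)
    from vector_diff_chain_within[OF this has_vector_derivative_within_subset[OF Y(3)[OF ivl[OF \<tau>]]]]
    have "(Y \<circ> (\<lambda>\<tau>. \<tau> / h) has_vector_derivative (1/h) *\<^sub>R cscale (of_real h) (g (Y (\<tau> / h))))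
        (at \<tau> within closed_segment 0 h)"
      using ivl by blast
    then have "(Y \<circ> (\<lambda>\<tau>. \<tau> / h) has_vector_derivative g (c \<tau>)) (at \<tau> within closed_segment 0 h)"
      using False Yc[OF ivl[OF \<tau>]] by (simp add: cscale_of_real)
    then show ?thesis
      unfolding has_vector_derivative_def
      by (rule has_derivative_transform[OF \<tau>, rotated]) (use Yc ivl False in auto)
  qed
qed

text \<open>The bound on all of \<open>U\<close> confines every competing solution to the half ball.
  There the maximal distance \<open>K\<close> to the constructed solution satisfies
  \<open>K \<le> K / 2\<close> by the Lipschitz estimate. As in \<open>rk_step_eq\<close>,
  \<open>U\<close> may consist of real points only.\<close>

lemma flow_eq:
  assumes loc: "flow_local N y g \<delta> M (of_real h)" and U: "U \<subseteq> cvec N"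
    and bound_U: "\<And>z. z \<in> U \<Longrightarrow> norm (g z) \<le> M"
    and stays: "\<And>\<tau>. \<tau> \<in> closed_segment 0 h \<Longrightarrow> y + \<tau> *\<^sub>R flow_mean (of_real \<tau>) g y \<in> U"
  shows "flow U h g y = y + h *\<^sub>R flow_mean (of_real h) g y"
proof -
  interpret l: flow_local N y g \<delta> M "of_real h" by (rule loc)
  define c where "c = (\<lambda>\<tau>. y + \<tau> *\<^sub>R flow_mean (of_real \<tau>) g y)"
  let ?I = "closed_segment 0 h"
  have c: "c \<tau> \<in> complex_ball N y (\<delta>/2)" "(c has_vector_derivative g (c \<tau>)) (at \<tau> within ?I)"
    if "\<tau> \<in> ?I" for \<tau>
    unfolding c_def by (rule flow_curve[OF loc that])+
  have \<tau>: "\<bar>\<tau>\<bar> \<le> \<bar>h\<bar>" if "\<tau> \<in> ?I" for \<tau>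
    using that by (auto simp: closed_segment_eq_real_ivl split: if_splits)
  show ?thesis
    unfolding flow_def
  proof (rule the_equality)
    show "\<exists>u. u 0 = y \<and> u h = y + h *\<^sub>R flow_mean (of_real h) g y \<and>
        (\<forall>\<tau>\<in>?I. u \<tau> \<in> U \<and> (u has_vector_derivative g (u \<tau>)) (at \<tau> within ?I))"
      using c(2) stays by (intro exI[of _ c] conjI ballI) (simp_all add: c_def)
  next
    fix z assume "\<exists>u. u 0 = y \<and> u h = z \<and>
        (\<forall>\<tau>\<in>?I. u \<tau> \<in> U \<and> (u has_vector_derivative g (u \<tau>)) (at \<tau> within ?I))"
    then obtain u where u: "u 0 = y" "u h = z" "\<And>\<tau>. \<tau> \<in> ?I \<Longrightarrow> u \<tau> \<in> U"
      "\<And>\<tau>. \<tau> \<in> ?I \<Longrightarrow> (u has_vector_derivative g (u \<tau>)) (at \<tau> within ?I)" by blast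
    have u_ball: "u \<tau> \<in> complex_ball N y (\<delta>/2)" if "\<tau> \<in> ?I" for \<tau>
    proof -
      have "norm (u \<tau> - u 0) \<le> M * \<bar>\<tau> - 0\<bar>"
        by (rule vector_derivative_bound[OF convex_closed_segment u(4)]) (use u bound_U that in auto)
      also have "\<dots> \<le> M * \<bar>h\<bar>" using \<tau>[OF that] l.M_nonneg by (intro mult_left_mono) auto
      also have "\<dots> < \<delta>/2" using l.small_h l.\<delta> by (simp add: mult_ac)
      finally show ?thesis using u U that by (auto simp: complex_ball_def)
    qed
    define d where "d \<tau> = u \<tau> - c \<tau>" for \<tau>
    have d': "(d has_vector_derivative g (u \<tau>) - g (c \<tau>)) (at \<tau> within ?I)" if "\<tau> \<in> ?I" for \<tau>
      unfolding d_def[abs_def] by (rule has_vector_derivative_diff[OF u(4)[OF that] c(2)[OF that]])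
    have "continuous_on ?I (\<lambda>\<tau>. norm (d \<tau>))"
      by (intro continuous_on_norm continuous_on_vector_derivative[OF d'])
    then obtain \<tau>0 where \<tau>0: "\<tau>0 \<in> ?I" "\<And>\<tau>. \<tau> \<in> ?I \<Longrightarrow> norm (d \<tau>) \<le> norm (d \<tau>0)"
      using continuous_attains_sup[OF compact_segment, of 0 h "\<lambda>\<tau>. norm (d \<tau>)"] by auto
    define K where "K = norm (d \<tau>0)"
    have d0: "d 0 = 0" by (simp add: d_def u c_def)
    have "norm (d \<tau>0 - d 0) \<le> 8 * M / \<delta> * K * \<bar>\<tau>0 - 0\<bar>"
    proof (rule vector_derivative_bound[OF convex_closed_segment d'])
      fix \<tau> assume t: "\<tau> \<in> ?I"
      have "norm (g (u \<tau>) - g (c \<tau>)) \<le> 8 * M / \<delta> * norm (u \<tau> - c \<tau>)"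
        by (rule chol_lipschitz_half_ball[OF l.chol_g l.bound_g u_ball[OF t] c(1)[OF t]])
      also have "\<dots> \<le> 8 * M / \<delta> * K"
        using \<tau>0(2)[OF t] l.M_nonneg l.\<delta> by (intro mult_left_mono) (auto simp: K_def d_def)
      finally show "norm (g (u \<tau>) - g (c \<tau>)) \<le> 8 * M / \<delta> * K" .
    qed (use \<tau>0 in auto)
    also have "\<dots> \<le> 8 * M / \<delta> * K * \<bar>h\<bar>"
      using \<tau>[OF \<tau>0(1)] l.M_nonneg l.\<delta> by (intro mult_left_mono) (auto simp: K_def)
    also have "\<dots> = (16 * M * \<bar>h\<bar>) * K / (2 * \<delta>)" by (simp add: mult_ac)
    also have "\<dots> \<le> \<delta> * K / (2 * \<delta>)"
      using l.small_h l.\<delta> by (intro divide_right_mono mult_right_mono) (auto simp: K_def)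
    finally have "K \<le> K / 2" using l.\<delta> by (simp add: K_def d0)
    then have "K = 0" by (simp add: K_def)
    then have "d h = 0" using \<tau>0(2)[of h] by (simp add: K_def)
    then show "z = y + h *\<^sub>R flow_mean (of_real h) g y" by (simp add: d_def c_def u)
  qed
qed

text \<open>The semigroup property in the form used later: it cuts the trajectory over time
  \<open>T\<close> into \<open>S\<close> steps of size \<open>h\<close>.\<close>

lemma flow_step_of_solution:
  assumes loc: "flow_local N (c t0) g \<delta> M (of_real h)" and "h > 0"
    and ball: "\<And>t. t \<in> {t0..t0 + h} \<Longrightarrow> c t \<in> complex_ball N (c t0) (\<delta>/2)"
    and deriv: "\<And>t. t \<in> {t0..t0 + h} \<Longrightarrow> (c has_vector_derivative g (c t)) (at t within {t0..t0 + h})"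
  shows "c (t0 + h) = c t0 + h *\<^sub>R flow_mean (of_real h) g (c t0)"
proof -
  interpret flow_local N "c t0" g \<delta> M "of_real h" by (rule loc)
  define Y where "Y t = c (t0 + h * t)" for t
  have "Y 1 = c t0 + cscale (of_real h) (flow_mean (of_real h) g (c t0))"
  proof (rule euler_mean_limit(2))
    show "Y 0 = c t0" by (simp add: Y_def)
    have im: "(\<lambda>t. t0 + h * t) ` {0..1} \<subseteq> {t0..t0 + h}"
      using \<open>h > 0\<close> by (auto simp: mult_left_le)
    fix t :: real assume t: "t \<in> {0..1}"
    then have st: "t0 + h * t \<in> {t0..t0 + h}" using im by blast
    then show "Y t \<in> complex_ball N (c t0) (\<delta>/2)" by (simp add: Y_def ball)
    have "((\<lambda>t. t0 + h * t) has_vector_derivative h) (at t within {0..1})"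
      unfolding has_real_derivative_iff_has_vector_derivative[symmetric]
      by (auto intro!: derivative_eq_intros)
    from vector_diff_chain_within[OF this has_vector_derivative_within_subset[OF deriv[OF st] im]]
    show "(Y has_vector_derivative cscale (of_real h) (g (Y t))) (at t within {0..1})"
      by (simp add: Y_def[abs_def] o_def cscale_of_real)
  qed
  then show ?thesis by (simp add: Y_def cscale_of_real)
qed

section \<open>Real step sizes preserve real points; smaller step sizes\<close>

lemma (in flow_local) flow_mean_in_rvec:
  assumes "y \<in> rvec N" "h = of_real t" and real: "\<And>z. z \<in> complex_ball N y \<delta> \<Longrightarrow> z \<in> rvec N \<Longrightarrow> g z \<in> rvec N"
  shows "flow_mean h g y \<in> rvec N"
proof -
  have e: "euler h g y n j \<in> rvec N" if "j \<le> n" for n j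
    using that
  proof (induction j)
    case (Suc j)
    have "euler h g y n j \<in> complex_ball N y \<delta>" using euler_in_ball[of j n] Suc half_subset by auto
    then show ?case using Suc real
      unfolding euler.simps assms(2) cscale_of_real by (intro rvec_intros) (auto simp: assms(2))
  qed (simp add: assms)
  have "euler_mean h g y (Suc n) \<in> rvec N" for n
    unfolding euler_mean_def
  proof (intro rvec_intros real)
    fix j assume "j \<in> {..<Suc n}"
    then show "euler h g y (Suc n) j \<in> complex_ball N y \<delta>" "euler h g y (Suc n) j \<in> rvec N"
      using euler_in_ball[of j "Suc n"] half_subset e by auto
  qed
  then show ?thesis by (rule closed_sequentially[OF closed_rvec _ euler_mean_LIMSEQ])
qed

lemma (in rk_local) stage_in_rvec:
  assumes "y \<in> rvec N" "h = of_real t" and real: "\<And>z. z \<in> complex_ball N y \<delta> \<Longrightarrow> z \<in> rvec N \<Longrightarrow> g z \<in> rvec N"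
    and "i < s"
  shows "stage h g y i \<in> rvec N"
proof -
  have "stage_iter h g y l i \<in> rvec N" if "i < s" for l i
    using that
  proof (induction l arbitrary: i)
    case (Suc l)
    have "stage_point h y (stage_iter h g y l) i \<in> complex_ball N y \<delta>"
      using stage_iter_in_ball[OF Suc.prems] half_subset by blast
    moreover have "stage_point h y (stage_iter h g y l) i \<in> rvec N"
      unfolding stage_point_def assms(2) cscale_of_real
      using Suc.IH by (intro rvec_intros assms(1)) (auto simp: assms(2))
    ultimately show ?case using real by simp
  qed (simp add: rvec_intros)
  then show ?thesis using \<open>i < s\<close> closed_sequentially[OF closed_rvec _ stage_iter_limit] by blast
qed

lemma (in rk_local) flow_local: "flow_local N y g \<delta> M h"
proof unfold_locales
  have "1 * (16 * M * cmod h) \<le> A * (16 * M * cmod h)"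
    using A_ge_1 M_nonneg by (intro mult_right_mono) auto
  then show "16 * M * cmod h \<le> \<delta>" using small_h by (simp add: mult_ac)
qed (use center \<delta> chol_g bound_g in auto)

lemma (in rk) rk_local_smaller:
  assumes "rk_local s a b A N y g \<delta> M h" "cmod h' \<le> cmod h"
  shows "rk_local s a b A N y g \<delta> M h'"
proof -
  interpret l: rk_local s a b A N y g \<delta> M h by (rule assms(1))
  show ?thesis
  proof unfold_locales
    have "16 * A * M * cmod h' \<le> 16 * A * M * cmod h"
      using assms(2) l.M_nonneg A_ge_1 by (intro mult_left_mono) auto
    then show "16 * A * M * cmod h' \<le> \<delta>" using l.small_h by simp
  qed (use l.center l.\<delta> l.chol_g l.bound_g in auto)
qed

subsection \<open>Perturbation of the vector field\<close>

text \<open>This makes the map from field to increment a small perturbation of the identity. The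
  points \<open>Y1 i\<close> and \<open>Y2 i\<close> are the arguments at which two methods evaluate
  their fields; \<open>close\<close> says that they differ by at most \<open>\<alpha>\<close> times
  the difference of the values, with \<open>\<alpha>\<close> proportional to the step size. The
  index set is left open: stages for one step, pairs of step and stage for a composition.\<close>

lemma perturbation:
  fixes Y1 Y2 :: "'i \<Rightarrow> cseq"
  assumes "finite I"
    and g1: "chol N (complex_ball N y \<delta>) g1" and g2: "chol N (complex_ball N y \<delta>) g2"
    and M: "\<And>z. z \<in> complex_ball N y \<delta> \<Longrightarrow> norm (g2 z) \<le> M"
    and e: "\<And>z. z \<in> complex_ball N y \<delta> \<Longrightarrow> norm (g1 z - g2 z) \<le> e"
    and y: "y \<in> cvec N" and "\<delta> > 0"
    and Y1: "\<And>i. i \<in> I \<Longrightarrow> Y1 i \<in> complex_ball N y (\<delta>/2)"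
    and Y2: "\<And>i. i \<in> I \<Longrightarrow> Y2 i \<in> complex_ball N y (\<delta>/2)"
    and near: "\<And>i. i \<in> I \<Longrightarrow> norm (Y1 i - y) \<le> r"
    and close: "\<And>i \<kappa>. i \<in> I \<Longrightarrow> (\<And>j. j \<in> I \<Longrightarrow> norm (g1 (Y1 j) - g2 (Y2 j)) \<le> \<kappa>) \<Longrightarrow>
      norm (Y1 i - Y2 i) \<le> \<alpha> * \<kappa>"
    and \<alpha>: "16 * M * \<alpha> \<le> \<delta>" and i: "i \<in> I"
  shows "norm (g1 (Y1 i) - g2 (Y2 i) - (g1 y - g2 y)) \<le> 4 * e / \<delta> * r + 16 * M * \<alpha> * e / \<delta>"
proof -
  have yb: "y \<in> complex_ball N y \<delta>" using y \<open>\<delta> > 0\<close> by (simp add: complex_ball_def)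
  have M0: "M \<ge> 0" by (rule order_trans[OF norm_ge_zero M[OF yb]])
  have e0: "e \<ge> 0" by (rule order_trans[OF norm_ge_zero e[OF yb]])
  have sub: "complex_ball N y (\<delta>/2) \<subseteq> complex_ball N y \<delta>"
    using \<open>\<delta> > 0\<close> by (auto simp: complex_ball_def)
  have lip: "norm (g2 (Y1 i) - g2 (Y2 i)) \<le> 8 * M / \<delta> * norm (Y1 i - Y2 i)" if "i \<in> I" for i
    by (rule chol_lipschitz_half_ball[OF g2 M Y1[OF that] Y2[OF that]])
  \<comment> \<open>The values differ by \<open>e\<close> at the same argument, plus half of the
    largest difference through the displacement; so by at most \<open>2 * e\<close>.\<close>
  have d: "norm (g1 (Y1 i) - g2 (Y2 i)) \<le> 2 * e" if "i \<in> I" for i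
  proof (rule half_contraction_bound[OF \<open>finite I\<close> that, of "\<lambda>i. norm (g1 (Y1 i) - g2 (Y2 i))"])
    fix i \<kappa> assume i: "i \<in> I" and \<kappa>: "\<And>j. j \<in> I \<Longrightarrow> norm (g1 (Y1 j) - g2 (Y2 j)) \<le> \<kappa>"
    have \<kappa>0: "\<kappa> \<ge> 0" by (rule order_trans[OF norm_ge_zero \<kappa>[OF i]])
    have "norm (g2 (Y1 i) - g2 (Y2 i)) \<le> 8 * M / \<delta> * (\<alpha> * \<kappa>)"
      using M0 \<open>\<delta> > 0\<close> by (intro order_trans[OF lip[OF i]] mult_left_mono close[OF i \<kappa>]) auto
    also have "\<dots> = (16 * M * \<alpha>) * \<kappa> / (2 * \<delta>)" by (simp add: mult_ac)
    also have "\<dots> \<le> \<delta> * \<kappa> / (2 * \<delta>)"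
      using \<alpha> \<kappa>0 \<open>\<delta> > 0\<close> by (intro divide_right_mono mult_right_mono) auto
    finally have "norm (g2 (Y1 i) - g2 (Y2 i)) \<le> \<kappa> / 2" using \<open>\<delta> > 0\<close> by simp
    moreover have "norm (g1 (Y1 i) - g2 (Y1 i)) \<le> e" using Y1[OF i] sub by (intro e) auto
    ultimately show "norm (g1 (Y1 i) - g2 (Y2 i)) \<le> e + \<kappa> / 2"
      using norm_triangle_ineq[of "g1 (Y1 i) - g2 (Y1 i)" "g2 (Y1 i) - g2 (Y2 i)"] by simp
  qed
  \<comment> \<open>Cauchy's estimate for the difference field, which is bounded by
    \<open>e\<close>. This gains the small factor \<open>r / \<delta>\<close>; estimating the two
    values separately would only give a multiple of \<open>e\<close>.\<close>
  have "norm ((g1 (Y1 i) - g2 (Y1 i)) - (g1 y - g2 y)) \<le> 4 * e / \<delta> * norm (Y1 i - y)"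
    by (rule chol_lipschitz_center[where g = "\<lambda>z. g1 z - g2 z", OF jhol_diff[OF g1 g2] e y])
      (simp_all add: subsetD[OF sub Y1[OF i]])
  also have "\<dots> \<le> 4 * e / \<delta> * r"
    using e0 \<open>\<delta> > 0\<close> by (intro mult_left_mono near i) auto
  finally have A: "norm ((g1 (Y1 i) - g2 (Y1 i)) - (g1 y - g2 y)) \<le> 4 * e / \<delta> * r" .
  have "norm (g2 (Y1 i) - g2 (Y2 i)) \<le> 8 * M / \<delta> * (\<alpha> * (2 * e))"
    using M0 \<open>\<delta> > 0\<close> by (intro order_trans[OF lip[OF i]] mult_left_mono close[OF i d]) auto
  then have B: "norm (g2 (Y1 i) - g2 (Y2 i)) \<le> 16 * M * \<alpha> * e / \<delta>" by (simp add: mult_ac)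
  have eq: "g1 (Y1 i) - g2 (Y2 i) - (g1 y - g2 y) =
      ((g1 (Y1 i) - g2 (Y1 i)) - (g1 y - g2 y)) + (g2 (Y1 i) - g2 (Y2 i))" by simp
  show "norm (g1 (Y1 i) - g2 (Y2 i) - (g1 y - g2 y)) \<le> 4 * e / \<delta> * r + 16 * M * \<alpha> * e / \<delta>"
    unfolding eq by (rule norm_triangle_le[OF add_mono[OF A B]])
qed

context rk
begin

text \<open>Since the weights sum to 1, \<open>g y\<close> can be subtracted inside the mean, and
  only the displacement of the stage points remains.\<close>

lemma rk_mean_center:
  assumes "rk_local s a b A N y g \<delta> M h"
  shows "norm (rk_mean h g y - g y) \<le> A * (4 * M / \<delta> * (cmod h * (A * M)))"
proof -
  interpret l: rk_local s a b A N y g \<delta> M h by (rule assms)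
  have "rk_mean h g y - g y = (\<Sum>i<s. b i *\<^sub>R (stage h g y i - g y))"
    using consistent by (simp add: rk_mean_def scaleR_diff_right sum_subtractf flip: scaleR_left.sum)
  moreover have "norm (stage h g y i - g y) \<le> 4 * M / \<delta> * (cmod h * (A * M))" if "i < s" for i
  proof -
    have "norm (g (stage_point h y (stage h g y) i) - g y) \<le>
        4 * M / \<delta> * norm (stage_point h y (stage h g y) i - y)"
      by (rule chol_lipschitz_center[OF l.chol_g l.bound_g l.center
          subsetD[OF l.half_subset l.stage_in_ball[OF that]]])
    then have "norm (stage h g y i - g y) \<le> 4 * M / \<delta> * norm (stage_point h y (stage h g y) i - y)"
      using l.stage_eq[OF that] by simp
    also have "\<dots> \<le> 4 * M / \<delta> * (cmod h * (A * M))"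
      using l.M_nonneg l.\<delta> that
      by (intro mult_left_mono norm_stage_point_center) (auto simp: l.norm_stage)
    finally show ?thesis .
  qed
  ultimately show ?thesis
    using norm_weighted_sum_le[OF weight_sum, of "4 * M / \<delta> * (cmod h * (A * M))"]
      l.M_nonneg l.\<delta> A_ge_1 by simp
qed

text \<open>The composed step written with \<open>rk_mean\<close>, free of definite descriptions;
  \<open>ode_solve_eq_orbit\<close> identifies the two.\<close>

fun rk_orbit :: "real \<Rightarrow> (cseq \<Rightarrow> cseq) \<Rightarrow> cseq \<Rightarrow> nat \<Rightarrow> cseq" where
  "rk_orbit h g y 0 = y"
| "rk_orbit h g y (Suc l) = rk_orbit h g y l + h *\<^sub>R rk_mean (of_real h) g (rk_orbit h g y l)"

text \<open>\<open>perturbation\<close> over the stages, with \<open>\<alpha> = cmod h * A\<close>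
  and displacement at most \<open>\<alpha> * M\<close>: the contributions 4 and 16 add up to 20, and
  the weights give the second factor \<open>A\<close>.\<close>

lemma rk_mean_perturbation:
  assumes l1: "rk_local s a b A N y g1 \<delta> M h" and l2: "rk_local s a b A N y g2 \<delta> M h"
    and e: "\<And>z. z \<in> complex_ball N y \<delta> \<Longrightarrow> norm (g1 z - g2 z) \<le> e"
  shows "norm ((rk_mean h g1 y - rk_mean h g2 y) - (g1 y - g2 y)) \<le> 20 * A\<^sup>2 * M * cmod h * e / \<delta>"
proof -
  interpret l1: rk_local s a b A N y g1 \<delta> M h by (rule l1)
  interpret l2: rk_local s a b A N y g2 \<delta> M h by (rule l2)
  have e0: "e \<ge> 0"
    by (rule order_trans[OF norm_ge_zero e[of y]]) (simp add: complex_ball_def l1.center l1.\<delta>)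
  let ?d = "\<lambda>i. stage h g1 y i - stage h g2 y i - (g1 y - g2 y)"
  have B: "norm (?d i) \<le> 20 * A * M * cmod h * e / \<delta>" if "i < s" for i
  proof -
    let ?Y1 = "stage_point h y (stage h g1 y)" and ?Y2 = "stage_point h y (stage h g2 y)"
    have "norm (g1 (?Y1 i) - g2 (?Y2 i) - (g1 y - g2 y)) \<le>
        4 * e / \<delta> * (cmod h * (A * M)) + 16 * M * (cmod h * A) * e / \<delta>"
    proof (rule perturbation[of "{..<s}" N y \<delta> g1 g2 M e ?Y1 ?Y2])
      fix i \<kappa> assume "i \<in> {..<s}" and \<kappa>: "\<And>j. j \<in> {..<s} \<Longrightarrow> norm (g1 (?Y1 j) - g2 (?Y2 j)) \<le> \<kappa>"
      then have i: "i < s" by simp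
      have "\<kappa> \<ge> 0" by (rule order_trans[OF norm_ge_zero \<kappa>]) (use i in simp)
      then have "norm (?Y1 i - ?Y2 i) \<le> cmod h * (A * \<kappa>)"
      proof (rule norm_stage_point_diff[OF i])
        show "norm (stage h g1 y j - stage h g2 y j) \<le> \<kappa>" if "j < s" for j
          using \<kappa>[of j] that l1.stage_eq[OF that] l2.stage_eq[OF that] by simp
      qed
      then show "norm (?Y1 i - ?Y2 i) \<le> cmod h * A * \<kappa>" by (simp add: mult_ac)
    next
      fix i assume "i \<in> {..<s}"
      then show "norm (?Y1 i - y) \<le> cmod h * (A * M)"
        using l1.M_nonneg by (intro norm_stage_point_center) (auto simp: l1.norm_stage)
    qed (use that l1.small_h in \<open>auto simp: l1.chol_g l2.chol_g l2.bound_g e l1.center l1.\<delta>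
          l1.stage_in_ball l2.stage_in_ball mult_ac\<close>)
    also have "\<dots> = 20 * A * M * cmod h * e / \<delta>" by (simp add: field_simps)
    finally show ?thesis using l1.stage_eq[OF that] l2.stage_eq[OF that] by simp
  qed
  have "(rk_mean h g1 y - rk_mean h g2 y) - (g1 y - g2 y) = (\<Sum>i<s. b i *\<^sub>R ?d i)"
    using consistent
    by (simp add: rk_mean_def scaleR_diff_right sum_subtractf flip: scaleR_left.sum)
  also have "norm \<dots> \<le> A * (20 * A * M * cmod h * e / \<delta>)"
    by (rule norm_weighted_sum_le[OF weight_sum _ B])
      (use l1.M_nonneg e0 A_ge_1 l1.\<delta> in auto)
  finally show ?thesis by (simp add: power2_eq_square mult_ac)
qed

text \<open>With the constant 32 the whole orbit travels at most \<open>\<delta> / 32\<close>, and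
  every point of it keeps a ball of radius \<open>\<delta> / 2\<close> for its own stages.\<close>

lemma rk_orbit_in_ball:
  assumes g: "chol N (complex_ball N y \<delta>) g" and M: "\<And>z. z \<in> complex_ball N y \<delta> \<Longrightarrow> norm (g z) \<le> M"
    and y: "y \<in> cvec N" and "\<delta> > 0" and small: "32 * A * M * (real S * \<bar>h\<bar>) \<le> \<delta>" and "l \<le> S"
  shows "rk_orbit h g y l \<in> cvec N" and "norm (rk_orbit h g y l - y) \<le> real l * \<bar>h\<bar> * (A * M)"
    and "l < S \<Longrightarrow> rk_local s a b A N (rk_orbit h g y l) g (\<delta>/2) M (of_real h)"
proof -
  have M0: "M \<ge> 0"
    by (rule order_trans[OF norm_ge_zero M[of y]]) (simp add: complex_ball_def y \<open>\<delta> > 0\<close>)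
  have AM: "A * M \<ge> 0" using M0 A_ge_1 by simp
  have loc: "rk_local s a b A N (rk_orbit h g y l) g (\<delta>/2) M (of_real h)"
    if "l < S" "rk_orbit h g y l \<in> cvec N" "norm (rk_orbit h g y l - y) \<le> real l * \<bar>h\<bar> * (A * M)" for l
  proof (rule rk_localI[OF g M])
    have "32 * (real l * \<bar>h\<bar> * (A * M)) \<le> 32 * (real S * \<bar>h\<bar> * (A * M))"
      using that AM by (intro mult_left_mono mult_right_mono) auto
    also have "\<dots> \<le> \<delta>" using small by (simp add: mult_ac)
    finally show "rk_orbit h g y l \<in> complex_ball N y (\<delta> - \<delta> / 2)"
      using that \<open>\<delta> > 0\<close> by (simp add: complex_ball_def)
    have "32 * A * M * (1 * \<bar>h\<bar>) \<le> 32 * A * M * (real S * \<bar>h\<bar>)"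
      using that AM by (intro mult_left_mono mult_right_mono) auto
    then show "16 * A * M * cmod (of_real h) \<le> \<delta> / 2" using small by simp
  qed (use \<open>\<delta> > 0\<close> in auto)
  have *: "rk_orbit h g y l \<in> cvec N \<and> norm (rk_orbit h g y l - y) \<le> real l * \<bar>h\<bar> * (A * M)" if "l \<le> S" for l
    using that
  proof (induction l)
    case (Suc l)
    interpret l: rk_local s a b A N "rk_orbit h g y l" g "\<delta>/2" M "of_real h"
      by (rule loc) (use Suc in auto)
    have "norm (rk_orbit h g y (Suc l) - y) \<le> norm (rk_orbit h g y l - y) +
        norm (h *\<^sub>R rk_mean (of_real h) g (rk_orbit h g y l))"
      using norm_triangle_ineq[of "rk_orbit h g y l - y" "h *\<^sub>R rk_mean (of_real h) g (rk_orbit h g y l)"]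
      by (simp add: algebra_simps)
    also have "\<dots> \<le> real l * \<bar>h\<bar> * (A * M) + \<bar>h\<bar> * (A * M)"
      unfolding norm_scaleR using Suc l.norm_rk_mean by (intro add_mono mult_mono) auto
    also have "\<dots> = real (Suc l) * \<bar>h\<bar> * (A * M)" by (simp add: algebra_simps)
    finally show ?case using l.center l.rk_mean_in_cvec by (auto intro!: cvec_intros)
  qed (simp add: y)
  show "rk_orbit h g y l \<in> cvec N" "norm (rk_orbit h g y l - y) \<le> real l * \<bar>h\<bar> * (A * M)"
    using *[OF \<open>l \<le> S\<close>] by auto
  show "l < S \<Longrightarrow> rk_local s a b A N (rk_orbit h g y l) g (\<delta>/2) M (of_real h)"
    using loc *[OF \<open>l \<le> S\<close>] by blast
qed

text \<open>A composition of \<open>S\<close> steps behaves like one Runge-Kutta method with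
  \<open>S * s\<close> stages and step size \<open>S * h\<close>. So \<open>perturbation\<close> is
  applied over pairs (step, stage) with \<open>\<alpha> = S * h * A\<close>, which yields the
  constant of the single step with \<open>h\<close> replaced by \<open>S * h\<close>.\<close>

lemma rk_orbit_perturbation:
  assumes g1: "chol N (complex_ball N y \<delta>) g1" and g2: "chol N (complex_ball N y \<delta>) g2"
    and M1: "\<And>z. z \<in> complex_ball N y \<delta> \<Longrightarrow> norm (g1 z) \<le> M"
    and M2: "\<And>z. z \<in> complex_ball N y \<delta> \<Longrightarrow> norm (g2 z) \<le> M"
    and e: "\<And>z. z \<in> complex_ball N y \<delta> \<Longrightarrow> norm (g1 z - g2 z) \<le> e"
    and y: "y \<in> cvec N" and "\<delta> > 0" and small: "32 * A * M * (real S * h) \<le> \<delta>" and "h > 0" "S \<ge> 1"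
  shows "norm ((1 / (real S * h)) *\<^sub>R (rk_orbit h g1 y S - rk_orbit h g2 y S) - (g1 y - g2 y)) \<le>
    20 * A\<^sup>2 * M * (real S * h) * e / \<delta>"
proof -
  have yb: "y \<in> complex_ball N y \<delta>" using y \<open>\<delta> > 0\<close> by (simp add: complex_ball_def)
  have M0: "M \<ge> 0" by (rule order_trans[OF norm_ge_zero M1[OF yb]])
  have e0: "e \<ge> 0" by (rule order_trans[OF norm_ge_zero e[OF yb]])
  have small': "32 * A * M * (real S * \<bar>h\<bar>) \<le> \<delta>" using small \<open>h > 0\<close> by simp
  note o1 = rk_orbit_in_ball[OF g1 M1 y \<open>\<delta> > 0\<close> small'] and o2 = rk_orbit_in_ball[OF g2 M2 y \<open>\<delta> > 0\<close> small']
  let ?z1 = "rk_orbit h g1 y" and ?z2 = "rk_orbit h g2 y"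
  let ?k1 = "\<lambda>l. stage (of_real h) g1 (?z1 l)" and ?k2 = "\<lambda>l. stage (of_real h) g2 (?z2 l)"
  define Y1 where "Y1 p = stage_point (of_real h) (?z1 (fst p)) (?k1 (fst p)) (snd p)" for p
  define Y2 where "Y2 p = stage_point (of_real h) (?z2 (fst p)) (?k2 (fst p)) (snd p)" for p
  let ?I = "{..<S} \<times> {..<s}"
  have stage_near: "norm (stage_point (of_real h) (rk_orbit h g y l) (stage (of_real h) g (rk_orbit h g y l)) i - y)
      \<le> real S * h * (A * M) \<and>
      stage_point (of_real h) (rk_orbit h g y l) (stage (of_real h) g (rk_orbit h g y l)) i \<in> complex_ball N y (\<delta>/2)"
    if loc: "rk_local s a b A N (rk_orbit h g y l) g (\<delta>/2) M (of_real h)"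
      and near: "norm (rk_orbit h g y l - y) \<le> real l * \<bar>h\<bar> * (A * M)" and "l < S" "i < s" for g l i
  proof -
    interpret l: rk_local s a b A N "rk_orbit h g y l" g "\<delta>/2" M "of_real h" by (rule loc)
    let ?p = "stage_point (of_real h) (rk_orbit h g y l) (stage (of_real h) g (rk_orbit h g y l)) i"
    have "norm (?p - rk_orbit h g y l) \<le> cmod (of_real h) * (A * M)"
      using M0 by (intro norm_stage_point_center \<open>i < s\<close>) (auto simp: l.norm_stage)
    then have "norm (?p - y) \<le> (real l + 1) * (h * (A * M))"
      using near norm_triangle_ineq[of "?p - rk_orbit h g y l" "rk_orbit h g y l - y"] \<open>h > 0\<close>
      by (simp add: algebra_simps)
    also have "\<dots> \<le> real S * (h * (A * M))"
      using \<open>l < S\<close> \<open>h > 0\<close> M0 A_ge_1 by (intro mult_right_mono) auto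
    finally have *: "norm (?p - y) \<le> real S * h * (A * M)" by (simp add: mult_ac)
    moreover have "real S * h * (A * M) < \<delta>/2" using small \<open>\<delta> > 0\<close> by (simp add: mult_ac)
    moreover have "?p \<in> cvec N" using l.stage_in_ball[OF \<open>i < s\<close>] by (simp add: complex_ball_def)
    ultimately show ?thesis by (simp add: complex_ball_def)
  qed
  have n1: "norm (Y1 p - y) \<le> real S * h * (A * M) \<and> Y1 p \<in> complex_ball N y (\<delta>/2)" if "p \<in> ?I" for p
    unfolding Y1_def by (rule stage_near) (use that o1 in auto)
  have n2: "norm (Y2 p - y) \<le> real S * h * (A * M) \<and> Y2 p \<in> complex_ball N y (\<delta>/2)" if "p \<in> ?I" for p
    unfolding Y2_def by (rule stage_near) (use that o2 in auto)
  have k1: "?k1 l i = g1 (Y1 (l, i))" and k2: "?k2 l i = g2 (Y2 (l, i))" if "l < S" "i < s" for l i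
    unfolding Y1_def Y2_def fst_conv snd_conv
    using rk_local.stage_eq[OF o1(3)[of l]] rk_local.stage_eq[OF o2(3)[of l]] that by simp_all
  define D where "D p = g1 (Y1 p) - g2 (Y2 p)" for p
  have step: "(?z1 (Suc l) - ?z2 (Suc l)) - (?z1 l - ?z2 l) = h *\<^sub>R (\<Sum>i<s. b i *\<^sub>R D (l, i))" if "l < S" for l
  proof -
    have "rk_mean (of_real h) g1 (?z1 l) - rk_mean (of_real h) g2 (?z2 l) = (\<Sum>i<s. b i *\<^sub>R D (l, i))"
      unfolding rk_mean_def sum_subtractf[symmetric] scaleR_diff_right[symmetric]
      by (rule sum.cong) (use that k1 k2 in \<open>auto simp: D_def\<close>)
    then show ?thesis by (simp flip: scaleR_diff_right add: add_diff_add)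
  qed
  have P: "norm (D p - (g1 y - g2 y)) \<le>
      4 * e / \<delta> * (real S * h * (A * M)) + 16 * M * (real S * h * A) * e / \<delta>" if "p \<in> ?I" for p
    unfolding D_def
  proof (rule perturbation[of ?I N y \<delta> g1 g2 M e Y1 Y2])
    fix p \<kappa> assume p: "p \<in> ?I" and \<kappa>: "\<And>j. j \<in> ?I \<Longrightarrow> norm (g1 (Y1 j) - g2 (Y2 j)) \<le> \<kappa>"
    obtain l i where li: "p = (l, i)" "l < S" "i < s" using p by auto
    have "\<kappa> \<ge> 0" by (rule order_trans[OF norm_ge_zero \<kappa>[OF p]])
    \<comment> \<open>Since \<open>\<kappa>\<close> bounds the differences of the values in all
      steps simultaneously, the orbits separate only linearly in the number of steps.\<close>
    have z: "norm (?z1 l' - ?z2 l') \<le> real l' * (h * (A * \<kappa>))" if "l' \<le> S" for l'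
      using that
    proof (induction l')
      case (Suc l')
      have "norm (\<Sum>i<s. b i *\<^sub>R D (l', i)) \<le> A * \<kappa>"
        by (rule norm_weighted_sum_le[OF weight_sum \<open>\<kappa> \<ge> 0\<close>]) (use \<kappa> Suc in \<open>auto simp: D_def\<close>)
      then have "norm (h *\<^sub>R (\<Sum>i<s. b i *\<^sub>R D (l', i))) \<le> h * (A * \<kappa>)" using \<open>h > 0\<close> by simp
      moreover have "?z1 (Suc l') - ?z2 (Suc l') = (?z1 l' - ?z2 l') + h *\<^sub>R (\<Sum>i<s. b i *\<^sub>R D (l', i))"
        using step[of l'] Suc by (simp add: algebra_simps)
      ultimately show ?case
        using Suc norm_triangle_ineq[of "?z1 l' - ?z2 l'" "h *\<^sub>R (\<Sum>i<s. b i *\<^sub>R D (l', i))"]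
        by (simp only: of_nat_Suc distrib_right) simp
    qed simp
    have "Y1 p - Y2 p = (?z1 l - ?z2 l) +
        (stage_point (of_real h) (?z1 l) (?k1 l) i - stage_point (of_real h) (?z1 l) (?k2 l) i)"
      by (simp add: Y1_def Y2_def li stage_point_def algebra_simps)
    also have "norm \<dots> \<le> real l * (h * (A * \<kappa>)) + cmod (of_real h) * (A * \<kappa>)"
    proof (intro norm_triangle_le add_mono z norm_stage_point_diff \<open>\<kappa> \<ge> 0\<close> li)
      show "norm (?k1 l j - ?k2 l j) \<le> \<kappa>" if "j < s" for j
        using \<kappa>[of "(l, j)"] k1 k2 li that by simp
    qed (use li in simp)
    also have "\<dots> = (real l + 1) * (h * (A * \<kappa>))" using \<open>h > 0\<close> by (simp add: algebra_simps)
    also have "\<dots> \<le> real S * (h * (A * \<kappa>))"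
      using li \<open>h > 0\<close> A_ge_1 \<open>\<kappa> \<ge> 0\<close> by (intro mult_right_mono) auto
    finally show "norm (Y1 p - Y2 p) \<le> real S * h * A * \<kappa>" by (simp add: mult_ac)
  next
    have "16 * M * (real S * h * A) = (32 * A * M * (real S * h)) / 2" by simp
    also have "\<dots> \<le> \<delta> / 2" using small by (rule divide_right_mono) simp
    finally show "16 * M * (real S * h * A) \<le> \<delta>" using \<open>\<delta> > 0\<close> by simp
  qed (use that n1 n2 g1 g2 M2 e y \<open>\<delta> > 0\<close> in auto)
  define R where "R = 4 * e / \<delta> * (real S * h * (A * M)) + 16 * M * (real S * h * A) * e / \<delta>"
  have R0: "R \<ge> 0" using e0 M0 A_ge_1 \<open>h > 0\<close> \<open>\<delta> > 0\<close> by (auto simp: R_def)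
  have z: "?z1 l - ?z2 l = h *\<^sub>R (\<Sum>l'<l. \<Sum>i<s. b i *\<^sub>R D (l', i))" if "l \<le> S" for l
    using that
  proof (induction l)
    case (Suc l)
    have "?z1 (Suc l) - ?z2 (Suc l) = (?z1 l - ?z2 l) + h *\<^sub>R (\<Sum>i<s. b i *\<^sub>R D (l, i))"
      using step[of l] Suc by (simp add: algebra_simps)
    then show ?case using Suc by (simp add: scaleR_add_right)
  qed simp
  have "(1 / (real S * h)) *\<^sub>R (?z1 S - ?z2 S) - (g1 y - g2 y) =
      (1 / real S) *\<^sub>R (\<Sum>l<S. (\<Sum>i<s. b i *\<^sub>R D (l, i)) - (g1 y - g2 y))"
    using \<open>h > 0\<close> \<open>S \<ge> 1\<close> by (simp add: z sum_subtractf scaleR_diff_right sum_constant_scaleR)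
  also have "(\<lambda>l. (\<Sum>i<s. b i *\<^sub>R D (l, i)) - (g1 y - g2 y)) = (\<lambda>l. \<Sum>i<s. b i *\<^sub>R (D (l, i) - (g1 y - g2 y)))"
    using consistent by (simp add: scaleR_diff_right sum_subtractf flip: scaleR_left.sum)
  also have "norm ((1 / real S) *\<^sub>R (\<Sum>l<S. \<Sum>i<s. b i *\<^sub>R (D (l, i) - (g1 y - g2 y)))) \<le>
      1 / real S * (real S * (A * R))"
    unfolding norm_scaleR
  proof (intro mult_mono)
    have "norm (\<Sum>i<s. b i *\<^sub>R (D (l, i) - (g1 y - g2 y))) \<le> A * R" if "l < S" for l
      by (rule norm_weighted_sum_le[OF weight_sum R0]) (use P that in \<open>auto simp: R_def\<close>)
    then show "norm (\<Sum>l<S. \<Sum>i<s. b i *\<^sub>R (D (l, i) - (g1 y - g2 y))) \<le> real S * (A * R)"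
      using sum_norm_bound[of "{..<S}" "\<lambda>l. \<Sum>i<s. b i *\<^sub>R (D (l, i) - (g1 y - g2 y))" "A * R"] by simp
  qed auto
  also have "\<dots> = A * R" using \<open>S \<ge> 1\<close> by simp
  also have "\<dots> = 20 * A\<^sup>2 * M * (real S * h) * e / \<delta>" by (simp add: R_def power2_eq_square field_simps)
  finally show ?thesis .
qed

end

subsection \<open>The inverse modified field\<close>

text \<open>The added term is the defect of one step, divided by \<open>h\<close>. Thus the
  increment from index \<open>n\<close> to \<open>Suc n\<close> is at the same time the defect of
  the field with index \<open>n\<close>.\<close>

primrec (in rk) mod_field :: "(cseq \<Rightarrow> cseq) \<Rightarrow> nat \<Rightarrow> complex \<Rightarrow> cseq \<Rightarrow> cseq" where
  "mod_field f 0 = (\<lambda>h. f)"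
| "mod_field f (Suc n) = (\<lambda>h y. mod_field f n h y + (flow_mean h f y - rk_mean h (mod_field f n h) y))"

locale rk_field = rk +
  fixes N :: nat and x :: cseq and \<rho> :: real and f :: "cseq \<Rightarrow> cseq" and m \<delta> :: real
  assumes chol_f: "chol N (complex_ball N x \<rho>) f"
    and bound_f: "\<And>z. z \<in> complex_ball N x \<rho> \<Longrightarrow> norm (f z) \<le> m"
    and m: "m > 0" and \<delta>: "\<delta> > 0"
begin

text \<open>The step size up to which the iteration contracts by 1/2: for fields bounded by
  \<open>2 * m\<close> the perturbation factor
  \<open>20 * A\<^sup>2 * (2 * m) * cmod h / \<delta>\<close> equals
  \<open>cmod h / (2 * \<eta>)\<close>.\<close>

definition \<eta> :: real where "\<eta> = \<delta> / (80 * A\<^sup>2 * m)"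

text \<open>Every iteration costs one \<open>\<delta>\<close> of radius, so the iterate with index
  \<open>n\<close> is controlled on \<open>B n\<close>. For large \<open>n\<close> this set is empty
  and all claims are vacuous.\<close>

definition B :: "nat \<Rightarrow> cseq set" where "B n = complex_ball N x (\<rho> - real n * \<delta>)"

lemma B_subset_cvec: "B n \<subseteq> cvec N" by (auto simp: B_def complex_ball_def)

lemma B_Suc_subset: "B (Suc n) \<subseteq> B n"
  using \<delta> by (auto simp: B_def complex_ball_def algebra_simps)

lemma B_subset_0: "B n \<subseteq> B 0"
  using \<delta> by (auto simp: B_def complex_ball_def intro: less_le_trans)

lemma ball_subset_B: "y \<in> B (Suc n) \<Longrightarrow> complex_ball N y \<delta> \<subseteq> B n"
  unfolding B_def by (rule complex_ball_mono) (simp add: complex_ball_def algebra_simps)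

lemma A2: "A \<le> A\<^sup>2" "1 \<le> A\<^sup>2"
  using A_ge_1 by (auto simp: power2_eq_square mult_le_cancel_left1 intro: order_trans[of 1 A])

lemma \<eta>: "\<eta> > 0"
  using \<delta> m A_ge_1 by (simp add: \<eta>_def)

lemma contraction_factor: "80 * A\<^sup>2 * m / \<delta> = 1 / \<eta>"
  using \<delta> by (simp add: \<eta>_def)

text \<open>The bound \<open>5 * m\<close> leaves room beyond the \<open>2 * m\<close> of the
  iterates: their Taylor polynomials are only bounded by \<open>4 * m\<close>. The constant 80 in
  \<open>\<eta>\<close> is 16 times 5.\<close>

lemma small_step:
  assumes "cmod h \<le> \<eta>" "M \<le> 5 * m"
  shows "16 * A * M * cmod h \<le> \<delta>"
proof -
  have "16 * A * M * cmod h \<le> 16 * A\<^sup>2 * (5 * m) * \<eta>"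
  proof (cases "M \<ge> 0")
    case True
    then show ?thesis
      using assms A2 A_ge_1 m \<eta> by (intro mult_mono) auto
  next
    case False
    then have "16 * A * M * cmod h \<le> 0" using A_ge_1
      by (simp add: mult_le_0_iff mult_nonneg_nonpos2 mult_nonneg_nonpos mult_nonpos_nonneg)
    also have "\<dots> \<le> 16 * A\<^sup>2 * (5 * m) * \<eta>" using m \<eta> by simp
    finally show ?thesis .
  qed
  also have "\<dots> = \<delta>" using A_ge_1 m by (simp add: \<eta>_def field_simps)
  finally show ?thesis .
qed

lemma flow_local_f:
  assumes "cmod h \<le> \<eta>" "y \<in> B (Suc n)"
  shows "flow_local N y f \<delta> m h"
proof -
  have "real n * \<delta> \<ge> 0" using \<delta> by simp
  then have "y \<in> complex_ball N x (\<rho> - \<delta>)"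
    using assms(2) by (auto simp: B_def complex_ball_def algebra_simps)
  from rk_localI[OF chol_f bound_f \<delta> small_step[OF assms(1)] this] m
  show ?thesis by (intro rk_local.flow_local[of s a b A]) simp
qed

lemma rk_local_B:
  assumes "chol N (B n) g" "\<And>z. z \<in> B n \<Longrightarrow> norm (g z) \<le> M" "cmod h \<le> \<eta>" "M \<le> 5 * m" "y \<in> B (Suc n)"
  shows "rk_local s a b A N y g \<delta> M h"
  using assms(1,2) unfolding B_def
  by (rule rk_localI[OF _ _ \<delta> small_step[OF assms(3,4)]])
    (use assms(5) in \<open>auto simp: B_def algebra_simps\<close>)

text \<open>The claims need each other: the bound makes the perturbation estimate applicable, which
  gives the next increment, and increments of at most \<open>m / 2 ^ Suc n\<close> add up to the
  next bound. Besides being geometrically small, the increment is of order \<open>Suc n\<close> in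
  \<open>h\<close>, which later freezes Taylor coefficients.\<close>

lemma mod_field_properties:
  "jhol N (ball 0 \<eta>) (B n) (mod_field f n) \<and>
   (\<forall>h\<in>ball 0 \<eta>. \<forall>y\<in>B n. norm (mod_field f n h y) \<le> 2 * m - m / 2 ^ n) \<and>
   (\<forall>h\<in>ball 0 \<eta>. \<forall>y\<in>B (Suc n).
      norm (mod_field f (Suc n) h y - mod_field f n h y) \<le> m * (cmod h / (2 * \<eta>)) ^ Suc n)"
proof (induction n)
  case 0
  have "norm (flow_mean h f y - rk_mean h f y) \<le> m * (cmod h / (2 * \<eta>))"
    if h: "h \<in> ball 0 \<eta>" and y: "y \<in> B (Suc 0)" for h y
  proof -
    have "rk_local s a b A N y f \<delta> m h"
      by (rule rk_local_B[of 0]) (use h y m chol_f bound_f in \<open>auto simp: B_def\<close>)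
    from rk_mean_center[OF this]
    have 1: "norm (rk_mean h f y - f y) \<le> A * (4 * m / \<delta> * (cmod h * (A * m)))" .
    have "norm (flow_mean h f y - f y) \<le> 4 * m / \<delta> * (cmod h * m)"
      by (rule flow_local.flow_mean_center[OF flow_local_f[OF _ y]]) (use h in simp)
    then have "norm (flow_mean h f y - rk_mean h f y) \<le>
        4 * m / \<delta> * (cmod h * m) + A * (4 * m / \<delta> * (cmod h * (A * m)))"
      using 1 norm_triangle_ineq4[of "flow_mean h f y - f y" "rk_mean h f y - f y"] by simp
    also have "\<dots> = (4 * m\<^sup>2 * cmod h / \<delta>) * (1 + A\<^sup>2)"
      by (simp add: power2_eq_square algebra_simps add_divide_distrib)
    \<comment> \<open>A generous estimate of \<open>1 + A\<^sup>2\<close>, chosen so that the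
      constant 80 of \<open>contraction_factor\<close> appears.\<close>
    also have "\<dots> \<le> (4 * m\<^sup>2 * cmod h / \<delta>) * (10 * A\<^sup>2)"
      using A2 \<delta> by (intro mult_left_mono) auto
    also have "\<dots> = m * cmod h / 2 * (80 * A\<^sup>2 * m / \<delta>)" by (simp add: power2_eq_square)
    also have "\<dots> = m * (cmod h / (2 * \<eta>))" unfolding contraction_factor by simp
    finally show ?thesis .
  qed
  then show ?case using chol_jhol[OF chol_f] bound_f by (simp add: B_def)
next
  case (Suc n)
  note J = Suc.IH[THEN conjunct1]
  have bd: "norm (mod_field f n h y) \<le> 2 * m - m / 2 ^ n" if "h \<in> ball 0 \<eta>" "y \<in> B n" for h y
    using Suc.IH that by blast
  have incr: "norm (mod_field f (Suc n) h y - mod_field f n h y) \<le> m * (cmod h / (2 * \<eta>)) ^ Suc n"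
    if "h \<in> ball 0 \<eta>" "y \<in> B (Suc n)" for h y
    using Suc.IH that by blast
  have bd2: "norm (mod_field f n h y) \<le> 2 * m" if "h \<in> ball 0 \<eta>" "y \<in> B n" for h y
    using bd[OF that] m by (smt (verit) divide_pos_pos zero_less_power)
  have eqB: "B (Suc n) = complex_ball N x ((\<rho> - real n * \<delta>) - \<delta>)" by (simp add: B_def algebra_simps)
  have "jhol N (ball 0 \<eta>) (B (Suc n)) (\<lambda>h. rk_mean h (mod_field f n h))"
    unfolding eqB
  proof (rule jhol_rk_mean[where M = "2 * m"])
    show "16 * A * (2 * m) * cmod h \<le> \<delta>" if "h \<in> ball 0 \<eta>" for h
      by (rule small_step) (use that m in auto)
  qed (use J bd2 \<delta> in \<open>auto simp: B_def\<close>)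
  moreover have "jhol N (ball 0 \<eta>) (complex_ball N x (\<rho> - \<delta>)) (\<lambda>h. flow_mean h f)"
  proof (rule jhol_flow_mean[OF chol_f bound_f \<delta>])
    fix h :: complex assume h: "h \<in> ball 0 \<eta>"
    have "16 * m * cmod h \<le> 16 * A * m * cmod h"
      using A_ge_1 m by (intro mult_right_mono) auto
    also have "\<dots> \<le> \<delta>" by (rule small_step) (use h m in auto)
    finally show "16 * m * cmod h \<le> \<delta>" .
  qed
  moreover have "B (Suc n) \<subseteq> complex_ball N x (\<rho> - \<delta>)"
  proof -
    have "real n * \<delta> \<ge> 0" using \<delta> by simp
    then show ?thesis by (auto simp: B_def complex_ball_def algebra_simps)
  qed
  ultimately have "jhol N (ball 0 \<eta>) (B (Suc n)) (\<lambda>h. flow_mean h f)"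
    and "jhol N (ball 0 \<eta>) (B (Suc n)) (\<lambda>h. rk_mean h (mod_field f n h))"
    by (auto intro: jhol_subset)
  moreover have "jhol N (ball 0 \<eta>) (B (Suc n)) (mod_field f n)"
    by (rule jhol_subset[OF J order_refl B_Suc_subset])
  ultimately have J': "jhol N (ball 0 \<eta>) (B (Suc n)) (mod_field f (Suc n))"
    by (simp add: jhol_intros)
  have half: "cmod h / (2 * \<eta>) \<le> 1/2" if "h \<in> ball 0 \<eta>" for h
    using that \<eta> by simp
  have bd': "norm (mod_field f (Suc n) h y) \<le> 2 * m - m / 2 ^ Suc n"
    if h: "h \<in> ball 0 \<eta>" and y: "y \<in> B (Suc n)" for h y
  proof -
    have "norm (mod_field f (Suc n) h y) \<le> norm (mod_field f n h y) +
        norm (mod_field f (Suc n) h y - mod_field f n h y)"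
      by (rule norm_triangle_sub)
    also have "\<dots> \<le> (2 * m - m / 2 ^ n) + m * (cmod h / (2 * \<eta>)) ^ Suc n"
      by (intro add_mono bd incr h y) (use y B_Suc_subset in blast)
    also have "\<dots> \<le> (2 * m - m / 2 ^ n) + m * (1/2) ^ Suc n"
      using half[OF h] m \<eta> by (intro add_left_mono mult_left_mono power_mono) auto
    also have "\<dots> = 2 * m - m / 2 ^ Suc n" by (simp add: power_divide field_simps)
    finally show ?thesis .
  qed
  have bd2': "norm (mod_field f (Suc n) h y) \<le> 2 * m" if "h \<in> ball 0 \<eta>" "y \<in> B (Suc n)" for h y
    using bd'[OF that] m by (smt (verit) divide_pos_pos zero_less_power)
  have "norm (mod_field f (Suc (Suc n)) h y - mod_field f (Suc n) h y) \<le> m * (cmod h / (2 * \<eta>)) ^ Suc (Suc n)"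
    if h: "h \<in> ball 0 \<eta>" and y: "y \<in> B (Suc (Suc n))" for h y
  proof -
    let ?F = "\<lambda>n. mod_field f n h"
    define e where "e = m * (cmod h / (2 * \<eta>)) ^ Suc n"
    have hl: "cmod h \<le> \<eta>" using h by simp
    have l1: "rk_local s a b A N y (?F (Suc n)) \<delta> (2 * m) h"
      by (rule rk_local_B[OF jhol_fix[OF J' h] bd2'[OF h] hl _ y]) (use m in auto)
    have l2: "rk_local s a b A N y (?F n) \<delta> (2 * m) h"
      by (rule rk_local_B[of "Suc n", OF jhol_subset[OF jhol_fix[OF J h] order_refl B_Suc_subset] _ hl _ y])
        (use m bd2[OF h] B_Suc_subset in auto)
    have "norm ((rk_mean h (?F (Suc n)) y - rk_mean h (?F n) y) - (?F (Suc n) y - ?F n y)) \<le>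
        20 * A\<^sup>2 * (2 * m) * cmod h * e / \<delta>"
    proof (rule rk_mean_perturbation[OF l1 l2])
      fix z assume "z \<in> complex_ball N y \<delta>"
      then show "norm (?F (Suc n) z - ?F n z) \<le> e"
        unfolding e_def using ball_subset_B[OF y] by (intro incr h) auto
    qed
    also have "\<dots> = (80 * A\<^sup>2 * m / \<delta>) * cmod h / 2 * e" by simp
    also have "\<dots> = m * (cmod h / (2 * \<eta>)) ^ Suc (Suc n)" unfolding contraction_factor by (simp add: e_def)
    finally have "norm ((rk_mean h (?F (Suc n)) y - rk_mean h (?F n) y) - (?F (Suc n) y - ?F n y)) \<le>
        m * (cmod h / (2 * \<eta>)) ^ Suc (Suc n)" .
    \<comment> \<open>The flow cancels between two successive iterations, so the new increment is
      exactly the deviation from the identity estimated above.\<close>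
    moreover have "?F (Suc (Suc n)) y - ?F (Suc n) y =
        - ((rk_mean h (?F (Suc n)) y - rk_mean h (?F n) y) - (?F (Suc n) y - ?F n y))"
      by (subst mod_field.simps(2), subst (3) mod_field.simps(2)) (simp add: algebra_simps)
    ultimately show ?thesis by (simp only: norm_minus_cancel)
  qed
  then show ?case using J' bd' by blast
qed

lemma jhol_mod_field: "jhol N (ball 0 \<eta>) (B n) (mod_field f n)"
  using mod_field_properties by blast

lemma norm_mod_field:
  assumes "h \<in> ball 0 \<eta>" "y \<in> B n"
  shows "norm (mod_field f n h y) \<le> 2 * m"
proof -
  have "norm (mod_field f n h y) \<le> 2 * m - m / 2 ^ n" using mod_field_properties assms by blast
  also have "\<dots> \<le> 2 * m" using m by simp
  finally show ?thesis .
qed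

lemma mod_field_increment:
  "h \<in> ball 0 \<eta> \<Longrightarrow> y \<in> B (Suc n) \<Longrightarrow>
    norm (mod_field f (Suc n) h y - mod_field f n h y) \<le> m * (cmod h / (2 * \<eta>)) ^ Suc n"
  using mod_field_properties by blast

lemma bounded_hcurve_mod_field: "y \<in> B n \<Longrightarrow> bounded_hcurve N \<eta> (2 * m) (\<lambda>h. mod_field f n h y)"
  using jhol_hcurve[OF jhol_mod_field open_ball] B_subset_cvec \<eta> norm_mod_field
  by unfold_locales blast+

text \<open>The increment is of order \<open>Suc n\<close> in \<open>h\<close>, so the coefficients
  up to \<open>n\<close> no longer change.\<close>

lemma tcoef_mod_field_Suc:
  assumes y: "y \<in> B (Suc n)" and "j \<le> n"
  shows "tcoef (\<lambda>h. mod_field f (Suc n) h y) j = tcoef (\<lambda>h. mod_field f n h y) j"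
proof -
  have yn: "y \<in> B n" using y B_Suc_subset by blast
  interpret c: bounded_hcurve N \<eta> "2 * m" "\<lambda>h. mod_field f (Suc n) h y"
    by (rule bounded_hcurve_mod_field[OF y])
  interpret d: bounded_hcurve N \<eta> "2 * m" "\<lambda>h. mod_field f n h y"
    by (rule bounded_hcurve_mod_field[OF yn])
  interpret e: bounded_hcurve N \<eta> "4 * m" "\<lambda>h. mod_field f (Suc n) h y - mod_field f n h y"
  proof
    show "hcurve N (ball 0 \<eta>) (\<lambda>h. mod_field f (Suc n) h y - mod_field f n h y)"
      by (rule hcurve_diff[OF c.hcurve d.hcurve])
    show "norm (mod_field f (Suc n) h y - mod_field f n h y) \<le> 4 * m" if "h \<in> ball 0 \<eta>" for h
      using c.bound[OF that] d.bound[OF that]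
        norm_triangle_ineq4[of "mod_field f (Suc n) h y" "mod_field f n h y"] by linarith
  qed (rule \<eta>)
  have "tcoef (\<lambda>h. mod_field f (Suc n) h y - mod_field f n h y) j = 0"
  proof (rule e.tcoef_eq_0[OF \<eta>, where n = "Suc n"])
    fix h :: real assume "0 < h" "h < \<eta>"
    then have "norm (mod_field f (Suc n) (of_real h) y - mod_field f n (of_real h) y) \<le>
        m * (cmod (of_real h) / (2 * \<eta>)) ^ Suc n"
      by (intro mod_field_increment y) simp
    also have "\<dots> = m / (2 * \<eta>) ^ Suc n * h ^ Suc n"
      using \<open>0 < h\<close> by (simp add: power_divide)
    finally show "norm (mod_field f (Suc n) (of_real h) y - mod_field f n (of_real h) y) \<le>
        m / (2 * \<eta>) ^ Suc n * h ^ Suc n" .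
  qed (use assms in simp)
  then show ?thesis
    using tcoef_diff[OF bounded_hcurve_mod_field[OF y] bounded_hcurve_mod_field[OF yn]] by simp
qed

text \<open>The recursion for the coefficients is matched with the iteration. Let \<open>p\<close>
  be the truncation up to \<open>n\<close>, which is the Taylor polynomial of
  \<open>F = mod_field f n\<close> and differs from it by order \<open>h ^ Suc n\<close>. Replacing
  \<open>F\<close> by \<open>p\<close> in the method changes \<open>rk_mean\<close> by
  \<open>F - p\<close> up to one further power of \<open>h\<close>, so the defect of
  \<open>p\<close> is the next iterate minus \<open>p\<close> to leading order. Its leading
  coefficient is the next Taylor coefficient \<open>L\<close>.\<close>

lemma imde_eq_tcoef:
  assumes U: "U = complex_ball N x \<rho>"
  shows "y \<in> B n \<Longrightarrow> j \<le> n \<Longrightarrow> imde U s a b f j y = tcoef (\<lambda>h. mod_field f n h y) j"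
proof (induction n arbitrary: y j)
  case 0
  then show ?case using bounded_hcurve.tcoef_0[OF bounded_hcurve_mod_field[OF 0(1)]] by simp
next
  case (Suc n)
  note y = Suc.prems(1)
  have yn: "y \<in> B n" using y B_Suc_subset by blast
  show ?case
  proof (cases "j \<le> n")
    case True
    then show ?thesis using Suc.IH[OF yn True] tcoef_mod_field_Suc[OF y True] by simp
  next
    case False
    then have j: "j = Suc n" using Suc.prems by simp
    define F where "F h = mod_field f n (of_real h)" for h :: real
    define F' where "F' h = mod_field f (Suc n) (of_real h)" for h :: real
    define p where "p h z = (\<Sum>j\<le>n. h ^ j *\<^sub>R imde U s a b f j z)" for h z
    define L where "L = tcoef (\<lambda>h. mod_field f (Suc n) h y) (Suc n)"
    have p_eq: "p h z = (\<Sum>j<Suc n. h ^ j *\<^sub>R tcoef (\<lambda>h. mod_field f n h z) j)" if "z \<in> B n" for h z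
      unfolding p_def using Suc.IH[OF that] by (intro sum.cong) auto
    have chol_p: "chol N (B n) (p h)" for h
    proof (rule jhol_cong)
      show "chol N (B n) (\<lambda>z. \<Sum>j<Suc n. h ^ j *\<^sub>R tcoef (\<lambda>h. mod_field f n h z) j)"
        by (intro jhol_intros jhol_tcoef[OF jhol_mod_field \<eta> B_subset_cvec norm_mod_field]) auto
    qed (rule p_eq)
    have F_p: "norm (F h z - p h z) \<le> 4 * m * (\<bar>h\<bar> / \<eta>) ^ Suc n" if "z \<in> B n" "\<bar>h\<bar> \<le> \<eta> / 2" for h z
      using bounded_hcurve.tcoef_remainder_real[OF bounded_hcurve_mod_field[OF that(1)] that(2), of "Suc n"]
      unfolding F_def p_eq[OF that(1)] by simp
    have main: "norm ((1 / h ^ (n + 2)) *\<^sub>R (flow U h f y - rk_step U s a b h (p h) y) - L) \<le>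
        8 * m / \<eta> ^ (n + 2) * \<bar>h\<bar>" if h: "h \<noteq> 0" "\<bar>h\<bar> \<le> \<eta> / 2" for h
    proof -
      define q where "q = \<bar>h\<bar> / \<eta>"
      have q: "0 \<le> q" "q \<le> 1/2" using h \<eta> by (auto simp: q_def)
      have hb: "of_real h \<in> ball (0::complex) \<eta>" and hl: "cmod (of_real h) \<le> \<eta>" using h \<eta> by auto
      have bF: "norm (F h z) \<le> 4 * m" if "z \<in> B n" for z
        using norm_mod_field[OF hb that] m by (simp add: F_def)
      have bp: "norm (p h z) \<le> 4 * m" if "z \<in> B n" for z
      proof -
        have "norm (p h z) \<le> norm (F h z) + norm (F h z - p h z)"
          using norm_triangle_sub[of "p h z" "F h z"] by (simp add: norm_minus_commute)
        also have "\<dots> \<le> 2 * m + 4 * m * q ^ Suc n"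
          using norm_mod_field[OF hb that] F_p[OF that h(2)] by (intro add_mono) (auto simp: F_def q_def)
        \<comment> \<open>The Taylor remainder is at most \<open>2 * m\<close> because
          \<open>q \<le> 1/2\<close>; together \<open>4 * m\<close>, within the room of
          \<open>small_step\<close>.\<close>
        also have "\<dots> \<le> 2 * m + 4 * m * (1/2)"
          using q m power_le_one[of q n] mult_mono[of q "1/2" "q ^ n" 1]
          by (intro add_left_mono mult_left_mono) auto
        finally show ?thesis by simp
      qed
      have lF: "rk_local s a b A N y (F h) \<delta> (4 * m) (of_real h)"
        by (rule rk_local_B[OF _ bF hl _ y]) (use jhol_fix[OF jhol_mod_field hb] m in \<open>auto simp: F_def\<close>)
      have lp: "rk_local s a b A N y (p h) \<delta> (4 * m) (of_real h)"
        by (rule rk_local_B[OF chol_p bp hl _ y]) (use m in auto)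
      have sub: "complex_ball N y \<delta> \<subseteq> U" using ball_subset_B[OF y] B_subset_0[of n] by (auto simp: U B_def)
      have Uc: "U \<subseteq> cvec N" by (auto simp: U complex_ball_def)
      have rk: "rk_step U s a b h (p h) y = y + h *\<^sub>R rk_mean (of_real h) (p h) y"
        by (rule rk_step_eq_ball[OF lp sub Uc])
      have lf: "flow_local N y f \<delta> m (of_real h)" by (rule flow_local_f[OF hl y])
      have fl: "flow U h f y = y + h *\<^sub>R flow_mean (of_real h) f y"
      proof (rule flow_eq[OF lf Uc])
        show "norm (f z) \<le> m" if "z \<in> U" for z using that bound_f by (simp add: U)
        show "y + \<tau> *\<^sub>R flow_mean (of_real \<tau>) f y \<in> U" if "\<tau> \<in> closed_segment 0 h" for \<tau>
          using flow_curve(1)[OF lf that] flow_local.half_subset[OF lf] sub by blast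
      qed
      define E where "E = (rk_mean (of_real h) (F h) y - rk_mean (of_real h) (p h) y) - (F h y - p h y)"
      have "norm E \<le> 20 * A\<^sup>2 * (4 * m) * cmod (of_real h) * (4 * m * q ^ Suc n) / \<delta>"
        unfolding E_def
        by (rule rk_mean_perturbation[OF lF lp]) (use F_p h ball_subset_B[OF y] in \<open>auto simp: q_def\<close>)
      also have "\<dots> = (80 * A\<^sup>2 * m / \<delta>) * \<bar>h\<bar> * (4 * m * q ^ Suc n)" by simp
      also have "\<dots> = 4 * m * q ^ (n + 2)" unfolding contraction_factor by (simp add: q_def)
      finally have E: "norm E \<le> 4 * m * q ^ (n + 2)" .
      define R where "R = F' h y - (\<Sum>j<Suc (Suc n). h ^ j *\<^sub>R tcoef (\<lambda>h. mod_field f (Suc n) h y) j)"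
      have R: "norm R \<le> 4 * m * q ^ (n + 2)"
        using bounded_hcurve.tcoef_remainder_real[OF bounded_hcurve_mod_field[OF y] h(2), of "n + 2"]
        by (simp add: R_def F'_def q_def)
      have "p h y = (\<Sum>j<Suc n. h ^ j *\<^sub>R tcoef (\<lambda>h. mod_field f (Suc n) h y) j)"
        unfolding p_eq[OF yn] using tcoef_mod_field_Suc[OF y] by (intro sum.cong) auto
      then have "F' h y - p h y = R + h ^ Suc n *\<^sub>R L" by (simp add: R_def L_def)
      \<comment> \<open>By definition of the iteration the flow is \<open>F' - F\<close> plus the
        mean for \<open>F\<close>; passing from the mean for \<open>F\<close> to the mean for
        \<open>p\<close> adds \<open>F - p\<close> and the error \<open>E\<close>.\<close>
      moreover have "flow_mean (of_real h) f y - rk_mean (of_real h) (p h) y = (F' h y - p h y) + E"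
        by (simp add: F'_def F_def E_def)
      ultimately have "flow U h f y - rk_step U s a b h (p h) y = h *\<^sub>R (R + h ^ Suc n *\<^sub>R L + E)"
        unfolding fl rk by (simp flip: scaleR_diff_right)
      then have "(1 / h ^ (n + 2)) *\<^sub>R (flow U h f y - rk_step U s a b h (p h) y) - L =
          (1 / h ^ (n + 1)) *\<^sub>R (R + E)"
        using h(1) by (simp add: scaleR_add_right)
      also have "norm \<dots> \<le> 1 / \<bar>h\<bar> ^ (n + 1) * (4 * m * q ^ (n + 2) + 4 * m * q ^ (n + 2))"
        unfolding norm_scaleR using E R
        by (intro mult_mono norm_triangle_le add_mono) (auto simp: power_abs abs_mult)
      also have "\<dots> = 8 * m / \<eta> ^ (n + 2) * \<bar>h\<bar>"
        using h(1) by (simp add: q_def power_divide)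
      finally show ?thesis .
    qed
    have "((\<lambda>h. (1 / h ^ (n + 2)) *\<^sub>R (flow U h f y - rk_step U s a b h (p h) y) - L) \<longlongrightarrow> 0) (at 0)"
    proof (rule Lim_null_comparison)
      show "\<forall>\<^sub>F h in at 0. norm ((1 / h ^ (n + 2)) *\<^sub>R (flow U h f y - rk_step U s a b h (p h) y) - L) \<le>
          8 * m / \<eta> ^ (n + 2) * \<bar>h\<bar>"
        unfolding eventually_at
        by (rule exI[of _ "\<eta> / 2"]) (use \<eta> main in auto)
      show "((\<lambda>h. 8 * m / \<eta> ^ (n + 2) * \<bar>h\<bar>) \<longlongrightarrow> 0) (at 0)"
        by (rule tendsto_mult_right_zero) (auto intro!: tendsto_eq_intros)
    qed
    then have "((\<lambda>h. (1 / h ^ (n + 2)) *\<^sub>R (flow U h f y - rk_step U s a b h (p h) y)) \<longlongrightarrow> L) (at 0)"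
      by (rule LIM_zero_cancel)
    then have "Lim (at 0) (\<lambda>h. (1 / h ^ (n + 2)) *\<^sub>R (flow U h f y - rk_step U s a b h (p h) y)) = L"
      by (rule tendsto_Lim[rotated]) simp
    then show ?thesis unfolding j L_def by (simp only: imde.simps(2) p_def[abs_def])
  qed
qed

lemma mod_field_imde_trunc:
  assumes "y \<in> B n" "\<bar>h\<bar> \<le> \<eta> / 2"
  shows "norm (mod_field f n (of_real h) y - imde_trunc (complex_ball N x \<rho>) s a b f n h y) \<le>
    4 * m * (\<bar>h\<bar> / \<eta>) ^ Suc n"
proof -
  have "imde_trunc (complex_ball N x \<rho>) s a b f n h y =
      (\<Sum>j<Suc n. h ^ j *\<^sub>R tcoef (\<lambda>h. mod_field f n h y) j)"
    unfolding imde_trunc_def using imde_eq_tcoef[OF refl assms(1)] by (intro sum.cong) auto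
  then show ?thesis
    using bounded_hcurve.tcoef_remainder_real[OF bounded_hcurve_mod_field[OF assms(1)] assms(2), of "Suc n"]
    by simp
qed

end

subsection \<open>Comparison of two fields through the training loss\<close>

text \<open>The constant 128 comes from \<open>rk_orbit_in_ball\<close> in
  \<open>orbit_flow_error\<close>: 32, times 2 for a field bounded by \<open>2 * m\<close>, times 2
  for the radius \<open>r2 / 2\<close>.\<close>

locale rk_compare = rk +
  fixes S N :: nat and x :: cseq and r1 r2 m T :: real and f fnet :: "cseq \<Rightarrow> cseq"
  assumes r1: "r1 > 0" and r2: "r2 > 0" and m: "m > 0" and S: "S \<ge> 1" and T: "T > 0" and x: "x \<in> cvec N"
    and chol_f: "chol N (complex_ball N x (r1 + r2)) f"
    and bound_f: "\<And>z. z \<in> complex_ball N x (r1 + r2) \<Longrightarrow> norm (f z) \<le> m"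
    and chol_fnet: "chol N (complex_ball N x (r1 + r2)) fnet"
    and bound_fnet: "\<And>z. z \<in> complex_ball N x (r1 + r2) \<Longrightarrow> norm (fnet z) \<le> m"
    and small_T: "128 * A * m * T \<le> r2"
begin

definition h :: real where "h = T / real S"

definition U :: "cseq set" where "U = complex_ball N x (r1 + r2)"

lemma h: "h > 0" "real S * h = T" "h \<le> T"
proof -
  show "h > 0" "real S * h = T" using S T by (auto simp: h_def)
  have "1 * h \<le> real S * h" using S \<open>h > 0\<close> by (intro mult_right_mono) auto
  then show "h \<le> T" using \<open>real S * h = T\<close> by simp
qed

lemma AmT: "A * m * T \<le> r2 / 128" "m * T \<le> r2 / 128" "A * m * h \<le> r2 / 128" "m * h \<le> r2 / 128"
proof -
  show *: "A * m * T \<le> r2 / 128" using small_T by simp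
  have 1: "z \<le> A * z" if "z \<ge> 0" for z using A_ge_1 that by (simp add: mult_le_cancel_right1)
  then have "m * T \<le> A * (m * T)" using m T by simp
  then show mT: "m * T \<le> r2 / 128" using * by (simp add: mult_ac)
  have "A * m * h \<le> A * m * T" using h(3) A_ge_1 m by (intro mult_left_mono) auto
  then show "A * m * h \<le> r2 / 128" using * by simp
  have "m * h \<le> m * T" using h(3) m by (intro mult_left_mono) auto
  then show "m * h \<le> r2 / 128" using mT by simp
qed

lemma U_subset_cvec: "U \<subseteq> cvec N" by (auto simp: U_def complex_ball_def)

lemma sub_U: "y \<in> complex_ball N x r1 \<Longrightarrow> complex_ball N y r2 \<subseteq> U"
  unfolding U_def by (rule complex_ball_mono) (simp add: complex_ball_def)

text \<open>Along the orbit every point keeps a ball of radius \<open>r2 / 2\<close> inside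
  \<open>U\<close>, so each definite description in the composition has its intended value. The
  travel bound makes the supremum in the loss finite.\<close>

lemma ode_solve_eq_orbit:
  assumes y: "y \<in> complex_ball N x r1"
  shows "ode_solve U s a b S fnet T y = rk_orbit h fnet y S"
    and "norm (rk_orbit h fnet y S - y) \<le> T * (A * m)"
proof -
  have yc: "y \<in> cvec N" using y by (simp add: complex_ball_def)
  have g: "chol N (complex_ball N y r2) fnet"
    by (rule jhol_subset[OF chol_fnet order_refl]) (use sub_U[OF y] in \<open>simp add: U_def\<close>)
  have M: "norm (fnet z) \<le> m" if "z \<in> complex_ball N y r2" for z
    using bound_fnet sub_U[OF y] that by (auto simp: U_def)
  have small: "32 * A * m * (real S * \<bar>h\<bar>) \<le> r2" using h AmT(1) r2 by (simp add: mult_ac)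
  note o = rk_orbit_in_ball[OF g M yc r2 small]
  have "(rk_step U s a b h fnet ^^ l) y = rk_orbit h fnet y l" if "l \<le> S" for l
    using that
  proof (induction l)
    case (Suc l)
    have near: "norm (rk_orbit h fnet y l - y) < r2/2"
    proof -
      have "real l * \<bar>h\<bar> * (A * m) \<le> real S * h * (A * m)"
        using Suc h(1) A_ge_1 m by (intro mult_right_mono) auto
      also have "\<dots> < r2/2" unfolding h(2) using AmT(1) r2 by (simp add: mult_ac)
      finally show ?thesis using o(2)[of l] Suc by linarith
    qed
    have "rk_step U s a b h fnet (rk_orbit h fnet y l) =
        rk_orbit h fnet y l + h *\<^sub>R rk_mean (of_real h) fnet (rk_orbit h fnet y l)"
    proof (rule rk_step_eq_ball[OF o(3) _ U_subset_cvec])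
      have "complex_ball N (rk_orbit h fnet y l) (r2/2) \<subseteq> complex_ball N y r2"
        by (rule complex_ball_mono) (use near in simp)
      then show "complex_ball N (rk_orbit h fnet y l) (r2/2) \<subseteq> U" using sub_U[OF y] by blast
    qed (use Suc in auto)
    then show ?case using Suc by simp
  qed simp
  then show "ode_solve U s a b S fnet T y = rk_orbit h fnet y S"
    by (simp add: ode_solve_def h_def)
  show "norm (rk_orbit h fnet y S - y) \<le> T * (A * m)" using o(2)[of S] h by simp
qed

text \<open>The exact trajectory is sampled at multiples of \<open>h\<close>, so that it can be
  compared step by step with the orbit of the method. The curve \<open>c\<close> measures time in
  steps.\<close>

lemma flow_orbit:
  assumes y: "y \<in> complex_ball N x r1"
  obtains c where "c 0 = y" "flow U T f y = c (real S)"
    "\<And>l. l \<le> S \<Longrightarrow> c (real l) \<in> cvec N \<and> norm (c (real l) - y) \<le> m * T"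
    "\<And>l. l < S \<Longrightarrow> c (real (Suc l)) = c (real l) + h *\<^sub>R flow_mean (of_real h) f (c (real l))"
proof -
  have yc: "y \<in> cvec N" using y by (simp add: complex_ball_def)
  have loc: "flow_local N y f r2 m (of_real T)"
    by (rule flow_localI[OF chol_f bound_f r2]) (use y AmT(2) T r2 in \<open>auto simp: mult_ac\<close>)
  define d where "d \<tau> = y + \<tau> *\<^sub>R flow_mean (of_real \<tau>) f y" for \<tau>
  have I: "closed_segment 0 T = {0..T}" using T by (simp add: closed_segment_eq_real_ivl)
  have d_ball: "d \<tau> \<in> complex_ball N y (r2/2)"
    and d': "(d has_vector_derivative f (d \<tau>)) (at \<tau> within {0..T})" if "\<tau> \<in> {0..T}" for \<tau>
    using flow_curve[OF loc, of \<tau>] that unfolding I d_def[abs_def] by auto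
  have half: "complex_ball N y (r2/2) \<subseteq> U"
    using sub_U[OF y] r2 by (auto simp: complex_ball_def)
  have f_m: "norm (f (d \<tau>)) \<le> m" if "\<tau> \<in> {0..T}" for \<tau>
    using d_ball[OF that] half bound_f by (auto simp: U_def)
  have fl: "flow U T f y = d T"
    unfolding d_def
  proof (rule flow_eq[OF loc U_subset_cvec])
    show "norm (f z) \<le> m" if "z \<in> U" for z using that bound_f by (simp add: U_def)
    show "y + \<tau> *\<^sub>R flow_mean (of_real \<tau>) f y \<in> U" if "\<tau> \<in> closed_segment 0 T" for \<tau>
      using d_ball[of \<tau>] half that unfolding I d_def by blast
  qed
  have lip: "norm (d t - d u) \<le> m * \<bar>t - u\<bar>" if "t \<in> {0..T}" "u \<in> {0..T}" for t u
    by (rule vector_derivative_bound[OF convex_real_interval(5) d' f_m that])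
  have d0: "d 0 = y" by (simp add: d_def)
  have near: "norm (d t - y) \<le> m * T" if "t \<in> {0..T}" for t
  proof -
    have "norm (d t - d 0) \<le> m * \<bar>t - 0\<bar>" by (rule lip) (use that T in auto)
    also have "\<dots> \<le> m * T" using that m by (intro mult_left_mono) auto
    finally show ?thesis by (simp add: d0)
  qed
  define c where "c t = d (t * h)" for t
  have hS: "real l * h \<le> T" if "l \<le> S" for l
  proof -
    have "real l * h \<le> real S * h" using that h(1) by (intro mult_right_mono) auto
    then show ?thesis unfolding h(2) .
  qed
  show ?thesis
  proof (rule that[of c])
    show "c 0 = y" by (simp add: c_def d0)
    show "flow U T f y = c (real S)" by (simp add: c_def fl h)
    show "c (real l) \<in> cvec N \<and> norm (c (real l) - y) \<le> m * T" if "l \<le> S" for l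
      using near[of "real l * h"] d_ball[of "real l * h"] hS[OF that] h(1)
      by (simp add: c_def complex_ball_def)
    fix l assume l: "l < S"
    define t0 where "t0 = real l * h"
    have t0: "t0 \<ge> 0" "t0 + h \<le> T" using h(1) hS[of "Suc l"] l by (auto simp: t0_def algebra_simps)
    have sub: "{t0..t0 + h} \<subseteq> {0..T}" using t0 by auto
    have b0: "d t0 \<in> complex_ball N y (r2/2)" by (rule d_ball) (use t0 h in auto)
    have "d (t0 + h) = d t0 + h *\<^sub>R flow_mean (of_real h) f (d t0)"
    proof (rule flow_step_of_solution)
      show "flow_local N (d t0) f (r2/2) m (of_real h)"
      proof (rule flow_localI[of N y r2])
        show "chol N (complex_ball N y r2) f"
          by (rule jhol_subset[OF chol_f order_refl]) (use sub_U[OF y] in \<open>simp add: U_def\<close>)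
        show "norm (f z) \<le> m" if "z \<in> complex_ball N y r2" for z
          using bound_f sub_U[OF y] that by (auto simp: U_def)
        show "16 * m * cmod (of_real h) \<le> r2/2" using AmT(4) h r2 by simp
      qed (use r2 b0 in auto)
      fix t assume t: "t \<in> {t0..t0 + h}"
      have "norm (d t - d t0) \<le> m * \<bar>t - t0\<bar>" by (rule lip) (use t sub h in auto)
      also have "\<dots> \<le> m * h" using t m by (intro mult_left_mono) auto
      also have "\<dots> < r2/2/2" using AmT(4) r2 by simp
      finally show "d t \<in> complex_ball N (d t0) (r2/2/2)"
        using d_ball[of t] t sub by (auto simp: complex_ball_def)
      show "(d has_vector_derivative f (d t)) (at t within {t0..t0 + h})"
        by (rule has_vector_derivative_within_subset[OF d' sub]) (use t sub in auto)
    qed (rule h)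
    then show "c (real (Suc l)) = c (real l) + h *\<^sub>R flow_mean (of_real h) f (c (real l))"
      by (simp add: c_def t0_def algebra_simps)
  qed
qed

text \<open>A real-valued supremum dominates its set only if the set is bounded. It is, because both
  end points stay within a fixed distance of the start.\<close>

lemma train_loss_bound:
  assumes y: "y \<in> complex_ball N x r1"
  shows "norm (rk_orbit h fnet y S - flow U T f y) \<le>
    T * train_loss (complex_ball N x r1) U s a b S fnet f T"
proof -
  let ?d = "\<lambda>y. norm (ode_solve U s a b S fnet T y - flow U T f y)"
  have "?d z \<le> T * (A * m) + m * T" if z: "z \<in> complex_ball N x r1" for z
  proof -
    obtain c where c: "flow U T f z = c (real S)"
      "\<And>l. l \<le> S \<Longrightarrow> c (real l) \<in> cvec N \<and> norm (c (real l) - z) \<le> m * T"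
      by (rule flow_orbit[OF z]) blast
    show ?thesis
      using ode_solve_eq_orbit[OF z] c(1) c(2)[of S]
        norm_triangle_ineq4[of "rk_orbit h fnet z S - z" "c (real S) - z"] by simp
  qed
  then have "bdd_above (?d ` complex_ball N x r1)" by (intro bdd_aboveI2) auto
  then have "?d y \<le> (SUP y\<in>complex_ball N x r1. ?d y)" by (rule cSUP_upper[OF y])
  then show ?thesis using T ode_solve_eq_orbit[OF y] by (simp add: train_loss_def)
qed

text \<open>One step of \<open>g\<close> at most doubles an earlier error and adds the defect
  \<open>h * \<epsilon>\<close>, so after \<open>l\<close> steps the error is at most
  \<open>(2 ^ l - 1) * (h * \<epsilon>)\<close>. The factor \<open>2 ^ S\<close> is harmless because
  the constants may depend on the solver.\<close>

lemma orbit_flow_error: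
  assumes g: "chol N (complex_ball N x (r1 + r2/2)) g"
    and M: "\<And>z. z \<in> complex_ball N x (r1 + r2/2) \<Longrightarrow> norm (g z) \<le> 2 * m"
    and \<epsilon>: "\<And>z. z \<in> complex_ball N x (r1 + r2/2) \<Longrightarrow>
      norm (flow_mean (of_real h) f z - rk_mean (of_real h) g z) \<le> \<epsilon>"
    and y: "y \<in> complex_ball N x r1"
  shows "norm (rk_orbit h g y S - flow U T f y) \<le> 2 ^ S * (T * \<epsilon>)"
proof -
  have yc: "y \<in> cvec N" using y by (simp add: complex_ball_def)
  obtain c where c: "c 0 = y" "flow U T f y = c (real S)"
    "\<And>l. l \<le> S \<Longrightarrow> c (real l) \<in> cvec N \<and> norm (c (real l) - y) \<le> m * T"
    "\<And>l. l < S \<Longrightarrow> c (real (Suc l)) = c (real l) + h *\<^sub>R flow_mean (of_real h) f (c (real l))"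
    by (rule flow_orbit[OF y]) blast
  have e0: "\<epsilon> \<ge> 0"
    by (rule order_trans[OF norm_ge_zero \<epsilon>[of x]]) (use x r1 r2 in \<open>simp add: complex_ball_def\<close>)
  have sub: "complex_ball N y (r2/2) \<subseteq> complex_ball N x (r1 + r2/2)"
    by (rule complex_ball_mono) (use y in \<open>simp add: complex_ball_def\<close>)
  have gy: "chol N (complex_ball N y (r2/2)) g" by (rule jhol_subset[OF g order_refl sub])
  have My: "norm (g z) \<le> 2 * m" if "z \<in> complex_ball N y (r2/2)" for z using M sub that by blast
  have "real S * \<bar>h\<bar> = T" using h(1,2) by simp
  then have small: "32 * A * (2 * m) * (real S * \<bar>h\<bar>) \<le> r2/2" using AmT(1) by simp
  have "r2/2 > 0" using r2 by simp
  note o = rk_orbit_in_ball[OF gy My yc this small]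
  have near: "norm (rk_orbit h g y l - y) \<le> r2/64" if "l \<le> S" for l
  proof -
    have "real l * \<bar>h\<bar> * (A * (2 * m)) \<le> real S * h * (A * (2 * m))"
      using that h(1) A_ge_1 m by (intro mult_right_mono) auto
    also have "\<dots> \<le> r2/64" unfolding h(2) using AmT(1) by (simp add: mult_ac)
    finally show ?thesis using o(2)[of l] that by linarith
  qed
  let ?Q = "rk_mean (of_real h) g"
  have Q_loc: "rk_local s a b A N z g (r2/4) (2 * m) (of_real h)" if "z \<in> complex_ball N y (r2/4)" for z
    by (rule rk_localI[OF gy My]) (use that AmT(3) r2 h in \<open>auto simp: mult_ac\<close>)
  have Q: "chol N (complex_ball N y (r2/4)) ?Q"
  proof -
    have "jhol N {of_real h} (complex_ball N y (r2/2 - r2/4)) (\<lambda>h. rk_mean h g)"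
      by (rule jhol_rk_mean[OF chol_jhol[OF gy] My]) (use AmT(3) r2 h in \<open>auto simp: mult_ac\<close>)
    then show ?thesis using jhol_fix by fastforce
  qed
  \<comment> \<open>\<open>rk_mean\<close> is itself holomorphic and bounded by
    \<open>A * (2 * m)\<close>, so Cauchy gives its Lipschitz constant. Points within
    \<open>r2 / 16\<close> of \<open>y\<close> are at distance below \<open>r2 / 8\<close>, and
    balls of that radius stay in the domain of radius \<open>r2 / 4\<close>.\<close>
  have lip: "norm (?Q z - ?Q w) \<le> 4 * (A * (2 * m)) / (r2/8) * norm (z - w)"
    if z: "z \<in> complex_ball N y (r2/16)" and w: "w \<in> complex_ball N y (r2/16)" for z w
  proof (rule chol_lipschitz_center)
    have sub: "complex_ball N w (r2/8) \<subseteq> complex_ball N y (r2/4)"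
      by (rule complex_ball_mono) (use w r2 in \<open>simp add: complex_ball_def\<close>)
    show "chol N (complex_ball N w (r2/8)) ?Q" by (rule jhol_subset[OF Q order_refl sub])
    show "norm (?Q v) \<le> A * (2 * m)" if "v \<in> complex_ball N w (r2/8)" for v
      using rk_local.norm_rk_mean[OF Q_loc] sub that by blast
    show "w \<in> cvec N" using w by (simp add: complex_ball_def)
    have "norm (z - w) \<le> norm (z - y) + norm (w - y)"
      using norm_triangle_ineq4[of "z - y" "w - y"] by simp
    then show "z \<in> complex_ball N w (r2/8)" using z w by (simp add: complex_ball_def)
  qed
  have "norm (rk_orbit h g y l - c (real l)) \<le> (2 ^ l - 1) * (h * \<epsilon>)" if "l \<le> S" for l
    using that
  proof (induction l)
    case (Suc l)
    let ?z = "rk_orbit h g y l" and ?w = "c (real l)"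
    have z: "?z \<in> complex_ball N y (r2/16)"
      using near[of l] o(1)[of l] Suc r2 by (simp add: complex_ball_def)
    have w: "?w \<in> complex_ball N y (r2/16)"
      using c(3)[of l] Suc AmT(2) r2 by (simp add: complex_ball_def)
    have wx: "?w \<in> complex_ball N x (r1 + r2/2)"
    proof -
      have "complex_ball N y (r2/16) \<subseteq> complex_ball N y (r2/2)" using r2 by (auto simp: complex_ball_def)
      then show ?thesis using w sub by blast
    qed
    have "h * norm (?Q ?z - ?Q ?w) \<le> h * (4 * (A * (2 * m)) / (r2/8) * norm (?z - ?w))"
      using h(1) by (intro mult_left_mono lip z w) auto
    also have "\<dots> = (64 * (A * m * h) / r2) * norm (?z - ?w)" by (simp add: mult_ac)
    also have "\<dots> \<le> 1 * norm (?z - ?w)"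
      using AmT(3) r2 by (intro mult_right_mono) (auto simp: divide_le_eq)
    finally have A: "norm (h *\<^sub>R (?Q ?z - ?Q ?w)) \<le> norm (?z - ?w)" using h(1) by simp
    have B: "norm (h *\<^sub>R (flow_mean (of_real h) f ?w - ?Q ?w)) \<le> h * \<epsilon>"
      using \<epsilon>[OF wx] h(1) by (simp add: mult_left_mono)
    have "rk_orbit h g y (Suc l) - c (real (Suc l)) =
        (?z - ?w) + h *\<^sub>R (?Q ?z - ?Q ?w) - h *\<^sub>R (flow_mean (of_real h) f ?w - ?Q ?w)"
      using c(4)[of l] Suc by (simp add: algebra_simps)
    also have "norm \<dots> \<le> (norm (?z - ?w) + norm (?z - ?w)) + h * \<epsilon>"
      by (intro norm_triangle_le norm_triangle_le_diff add_mono A B order_refl)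
    also have "\<dots> \<le> 2 * ((2 ^ l - 1) * (h * \<epsilon>)) + h * \<epsilon>" using Suc by simp
    also have "\<dots> = (2 ^ Suc l - 1) * (h * \<epsilon>)" by (simp add: algebra_simps)
    finally show ?case .
  qed (simp add: c)
  then have "norm (rk_orbit h g y S - flow U T f y) \<le> (2 ^ S - 1) * (h * \<epsilon>)" by (simp add: c)
  also have "\<dots> \<le> 2 ^ S * (T * \<epsilon>)" using h e0 by (intro mult_mono mult_right_mono) auto
  finally show ?thesis .
qed

text \<open>The difference of the fields equals the difference of their composed steps divided by
  \<open>T\<close>, at most \<open>w\<close>, up to a perturbation term that is a factor
  \<open>\<theta>\<close> smaller than the difference itself on a slightly larger ball. Iterating
  \<open>J\<close> times shrinks the ball to the centre. The number \<open>J\<close> is free: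
  \<open>J\<close> of size \<open>1 / T\<close> gives an exponentially small term,
  \<open>J = p\<close> a term of order \<open>T ^ p\<close>.\<close>

lemma comparison:
  assumes g: "chol N (complex_ball N x (r1 + r2/2)) g"
    and M: "\<And>z. z \<in> complex_ball N x (r1 + r2/2) \<Longrightarrow> norm (g z) \<le> 2 * m"
    and \<epsilon>: "\<And>z. z \<in> complex_ball N x (r1 + r2/2) \<Longrightarrow>
      norm (flow_mean (of_real h) f z - rk_mean (of_real h) g z) \<le> \<epsilon>"
    and J: "80 * A\<^sup>2 * m * T * real (Suc J) \<le> r1"
  shows "norm (fnet x - g x) \<le> (40 * A\<^sup>2 * m * T * real (Suc J) / r1) ^ J * (4 * m) +
    2 * (train_loss (complex_ball N x r1) U s a b S fnet f T + 2 ^ S * \<epsilon>)"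
proof -
  define w where "w = train_loss (complex_ball N x r1) U s a b S fnet f T + 2 ^ S * \<epsilon>"
  have w: "norm ((1 / T) *\<^sub>R (rk_orbit h fnet y S - rk_orbit h g y S)) \<le> w"
    if y: "y \<in> complex_ball N x r1" for y
  proof -
    have "norm (rk_orbit h fnet y S - rk_orbit h g y S) \<le>
        T * train_loss (complex_ball N x r1) U s a b S fnet f T + 2 ^ S * (T * \<epsilon>)"
      using train_loss_bound[OF y] orbit_flow_error[OF g M \<epsilon> y]
        norm_triangle_ineq4[of "rk_orbit h fnet y S - flow U T f y" "rk_orbit h g y S - flow U T f y"]
      by simp
    also have "\<dots> = T * w" by (simp add: w_def algebra_simps)
    finally show ?thesis using T by (simp add: divide_le_eq mult.commute)
  qed
  have xb: "x \<in> complex_ball N x r1" using x r1 by (simp add: complex_ball_def)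
  have w0: "w \<ge> 0" by (rule order_trans[OF norm_ge_zero w[OF xb]])
  \<comment> \<open>After \<open>J\<close> losses a ball of radius \<open>\<delta>\<close> is left,
    which still contains \<open>x\<close>; hence \<open>Suc J\<close>.\<close>
  define \<delta> where "\<delta> = r1 / real (Suc J)"
  have \<delta>: "\<delta> > 0" using r1 by (simp add: \<delta>_def)
  define \<theta> where "\<theta> = 40 * A\<^sup>2 * m * T / \<delta>"
  have \<theta>: "0 \<le> \<theta>" "\<theta> \<le> 1/2"
    using m T \<delta> J by (auto simp: \<theta>_def \<delta>_def divide_simps mult_ac)
  have small: "32 * A * (2 * m) * (real S * h) \<le> \<delta>"
  proof -
    have "32 * A * (2 * m) * T \<le> 80 * A\<^sup>2 * m * T"
      using A_ge_1 m T by (simp add: power2_eq_square mult_le_cancel_left1 mult_mono)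
    also have "\<dots> \<le> \<delta>" using J by (simp add: \<delta>_def field_simps)
    finally show ?thesis by (simp add: h)
  qed
  have rad: "complex_ball N x (r1 - real j * \<delta>) \<subseteq> complex_ball N x r1" for j
    using \<delta> by (auto simp: complex_ball_def intro: less_le_trans)
  have sub2: "complex_ball N x r1 \<subseteq> complex_ball N x (r1 + r2/2)"
    and sub3: "complex_ball N x r1 \<subseteq> complex_ball N x (r1 + r2)"
    using r2 by (auto simp: complex_ball_def)
  \<comment> \<open>The bound is preserved by e \<mapsto> w + \<theta> * e: since
    \<open>\<theta> \<le> 1/2\<close>, the part \<open>2 * w\<close> reproduces itself while the
    initial part is multiplied by \<open>\<theta>\<close>.\<close>
  have "\<forall>y\<in>complex_ball N x (r1 - real j * \<delta>). norm (fnet y - g y) \<le> \<theta> ^ j * (4 * m) + 2 * w" for j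
  proof (induction j)
    case 0
    show ?case
    proof
      fix y assume "y \<in> complex_ball N x (r1 - real 0 * \<delta>)"
      then have y: "y \<in> complex_ball N x r1" by simp
      have "norm (fnet y - g y) \<le> m + 2 * m"
        using bound_fnet[OF subsetD[OF sub3 y]] M[OF subsetD[OF sub2 y]]
          norm_triangle_ineq4[of "fnet y" "g y"] by linarith
      then show "norm (fnet y - g y) \<le> \<theta> ^ 0 * (4 * m) + 2 * w" using m w0 by simp
    qed
  next
    case (Suc j)
    define e where "e = \<theta> ^ j * (4 * m) + 2 * w"
    show ?case
    proof
      fix y assume "y \<in> complex_ball N x (r1 - real (Suc j) * \<delta>)"
      then have yb: "y \<in> complex_ball N x (r1 - real j * \<delta> - \<delta>)" by (simp add: algebra_simps)
      have y1: "y \<in> complex_ball N x r1"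
        using rad \<open>y \<in> complex_ball N x (r1 - real (Suc j) * \<delta>)\<close> by blast
      have sub: "complex_ball N y \<delta> \<subseteq> complex_ball N x (r1 - real j * \<delta>)"
        by (rule complex_ball_mono) (use yb in \<open>simp add: complex_ball_def\<close>)
      have sub': "complex_ball N y \<delta> \<subseteq> complex_ball N x r1" using sub rad by blast
      have "norm ((1 / (real S * h)) *\<^sub>R (rk_orbit h fnet y S - rk_orbit h g y S) - (fnet y - g y)) \<le>
          20 * A\<^sup>2 * (2 * m) * (real S * h) * e / \<delta>"
      proof (rule rk_orbit_perturbation[OF _ _ _ _ _ _ \<delta> small h(1) S])
        show "chol N (complex_ball N y \<delta>) fnet"
          by (rule jhol_subset[OF chol_fnet order_refl]) (use sub' sub3 in blast)
        show "chol N (complex_ball N y \<delta>) g"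
          by (rule jhol_subset[OF g order_refl]) (use sub' sub2 in blast)
        show "norm (fnet z) \<le> 2 * m" if "z \<in> complex_ball N y \<delta>" for z
          using bound_fnet[of z] sub' sub3 that m by fastforce
        show "norm (g z) \<le> 2 * m" if "z \<in> complex_ball N y \<delta>" for z
          using sub' sub2 that by (intro M) blast
        show "norm (fnet z - g z) \<le> e" if "z \<in> complex_ball N y \<delta>" for z
          unfolding e_def using Suc.IH sub that by blast
        show "y \<in> cvec N" using y1 by (simp add: complex_ball_def)
      qed
      also have "\<dots> = \<theta> * e" by (simp add: \<theta>_def h)
      finally have "norm ((1 / T) *\<^sub>R (rk_orbit h fnet y S - rk_orbit h g y S) - (fnet y - g y)) \<le> \<theta> * e"
        by (simp only: h)
      then have "norm (fnet y - g y) \<le> w + \<theta> * e"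
        using w[OF y1] norm_triangle_ineq4[of "(1 / T) *\<^sub>R (rk_orbit h fnet y S - rk_orbit h g y S)"
            "(1 / T) *\<^sub>R (rk_orbit h fnet y S - rk_orbit h g y S) - (fnet y - g y)"] by simp
      also have "\<theta> * e \<le> \<theta> ^ Suc j * (4 * m) + 1/2 * (2 * w)"
        using \<theta> w0 unfolding e_def distrib_left by (intro add_mono mult_right_mono) auto
      finally show "norm (fnet y - g y) \<le> \<theta> ^ Suc j * (4 * m) + 2 * w" by simp
    qed
  qed
  moreover have "x \<in> complex_ball N x (r1 - real J * \<delta>)"
    using x r1 by (simp add: complex_ball_def \<delta>_def field_simps)
  ultimately have "norm (fnet x - g x) \<le> \<theta> ^ J * (4 * m) + 2 * w" by blast
  moreover have "\<theta> = 40 * A\<^sup>2 * m * T * real (Suc J) / r1" by (simp add: \<theta>_def \<delta>_def)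
  ultimately show ?thesis by (simp add: w_def)
qed

end

subsection \<open>Order conditions\<close>

lemma class_C_const: "class_C N n U (\<lambda>_. v)"
  by (induction n arbitrary: v) (auto intro!: exI[of _ "\<lambda>_. 0"])

lemma bigo_power_bound:
  fixes F :: "real \<Rightarrow> real"
  assumes "F \<in> O[at 0](\<lambda>h. h ^ n)"
  obtains \<epsilon> c where "\<epsilon> > 0" "\<And>h. 0 < h \<Longrightarrow> h < \<epsilon> \<Longrightarrow> \<bar>F h\<bar> \<le> c * h ^ n"
proof -
  from assms obtain c where "\<forall>\<^sub>F h in at 0. norm (F h) \<le> c * norm (h ^ n)"
    by (elim landau_o.bigE)
  then obtain \<epsilon> where \<epsilon>: "\<epsilon> > 0" "\<And>h. h \<noteq> 0 \<Longrightarrow> dist h 0 < \<epsilon> \<Longrightarrow> norm (F h) \<le> c * norm (h ^ n)"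
    unfolding eventually_at by auto
  have "\<bar>F h\<bar> \<le> c * h ^ n" if "0 < h" "h < \<epsilon>" for h
    using \<epsilon>(2)[of h] that by simp
  with \<epsilon>(1) show ?thesis by (rule that)
qed

text \<open>The order hypothesis is tested on a nonzero constant field in dimension 1. A step gives
  \<open>h\<close> times the sum of the weights times \<open>v\<close>, the flow gives
  \<open>h\<close> times \<open>v\<close>, and for \<open>p \<ge> 1\<close> a difference of order
  \<open>h ^ (p + 1)\<close> forces equality.\<close>

lemma rk_order_consistent:
  assumes "rk_order s a b p" "p \<ge> 1"
  shows "(\<Sum>j<s. b j) = 1"
proof -
  define v where "v = cunit 0"
  define U where "U = rvec 1"
  have v: "v \<in> rvec 1" unfolding rvec_def v_def using cunit_in_cvec[of 0 1] by (auto simp: coord_cunit)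
  have nv: "norm v > 0" using norm_bounded[of v 0] unfolding v_def coord_cunit
    by (intro less_le_trans[OF zero_less_one]) simp
  have "smooth_field 1 U (\<lambda>_. v)"
    unfolding smooth_field_def using v by (auto simp: U_def class_C_const)
  moreover have "0 \<in> U" unfolding U_def by (rule rvec_intros)
  ultimately have O: "(\<lambda>h. norm (rk_step U s a b h (\<lambda>_. v) 0 - flow U h (\<lambda>_. v) 0)) \<in> O[at 0](\<lambda>h. h ^ (p + 1))"
    using assms(1) unfolding rk_order_def by blast
  have rk: "rk_step U s a b h (\<lambda>_. v) 0 = h *\<^sub>R (\<Sum>i<s. b i *\<^sub>R v)" for h
    unfolding rk_step_def
  proof (rule the_equality)
    show "\<exists>k. (\<forall>i<s. continuous_on (closed_segment 0 h) (k i)) \<and>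
        (\<forall>\<tau>\<in>closed_segment 0 h. rk_stages U s a \<tau> (\<lambda>_. v) 0 (\<lambda>i. k i \<tau>)) \<and>
        h *\<^sub>R (\<Sum>i<s. b i *\<^sub>R v) = 0 + h *\<^sub>R (\<Sum>i<s. b i *\<^sub>R k i h)"
      by (intro exI[of _ "\<lambda>_ _. v"]) (auto simp: rk_stages_def U_def intro!: rvec_intros v[unfolded One_nat_def])
  qed (auto simp: rk_stages_def)
  have fl: "flow U h (\<lambda>_. v) 0 = h *\<^sub>R v" for h
    unfolding flow_def
  proof (rule the_equality)
    have "((\<lambda>\<tau>. \<tau> *\<^sub>R v) has_vector_derivative v) (at \<tau> within T)" for \<tau> T
      unfolding has_vector_derivative_def
      by (rule bounded_linear_imp_has_derivative[OF bounded_linear_scaleR_left])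
    then show "\<exists>y. y 0 = 0 \<and> y h = h *\<^sub>R v \<and>
        (\<forall>\<tau>\<in>closed_segment 0 h. y \<tau> \<in> U \<and> (y has_vector_derivative v) (at \<tau> within closed_segment 0 h))"
      by (intro exI[of _ "\<lambda>\<tau>. \<tau> *\<^sub>R v"]) (auto simp: U_def intro!: rvec_intros v[unfolded One_nat_def])
  next
    fix z assume "\<exists>y. y 0 = 0 \<and> y h = z \<and>
        (\<forall>\<tau>\<in>closed_segment 0 h. y \<tau> \<in> U \<and> (y has_vector_derivative v) (at \<tau> within closed_segment 0 h))"
    then obtain u where u: "u 0 = 0" "u h = z"
      "\<And>\<tau>. \<tau> \<in> closed_segment 0 h \<Longrightarrow> (u has_vector_derivative v) (at \<tau> within closed_segment 0 h)" by blast
    have "norm ((u h - h *\<^sub>R v) - (u 0 - 0 *\<^sub>R v)) \<le> 0 * \<bar>h - 0\<bar>"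
    proof (rule vector_derivative_bound[OF convex_closed_segment])
      fix \<tau> assume \<tau>: "\<tau> \<in> closed_segment 0 h"
      have "((\<lambda>\<tau>. \<tau> *\<^sub>R v) has_vector_derivative v) (at \<tau> within closed_segment 0 h)"
        unfolding has_vector_derivative_def
        by (rule bounded_linear_imp_has_derivative[OF bounded_linear_scaleR_left])
      then show "((\<lambda>\<tau>. u \<tau> - \<tau> *\<^sub>R v) has_vector_derivative v - v) (at \<tau> within closed_segment 0 h)"
        by (rule has_vector_derivative_diff[OF u(3)[OF \<tau>]])
    qed auto
    then show "z = h *\<^sub>R v" by (simp add: u)
  qed
  define d where "d = \<bar>(\<Sum>j<s. b j) - 1\<bar> * norm v"
  obtain \<epsilon> c where "\<epsilon> > 0" and
    c: "\<And>h. 0 < h \<Longrightarrow> h < \<epsilon> \<Longrightarrow>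
      \<bar>norm (rk_step U s a b h (\<lambda>_. v) 0 - flow U h (\<lambda>_. v) 0)\<bar> \<le> c * h ^ (p + 1)"
    by (rule bigo_power_bound[OF O]) blast
  have le: "d \<le> c * h ^ p" if h: "0 < h" "h < \<epsilon>" for h
  proof -
    have "rk_step U s a b h (\<lambda>_. v) 0 - flow U h (\<lambda>_. v) 0 = (h * ((\<Sum>j<s. b j) - 1)) *\<^sub>R v"
      unfolding rk fl by (simp add: algebra_simps flip: scaleR_left.sum)
    then have "h * d \<le> h * (c * h ^ p)" using c[OF h] h by (simp add: d_def abs_mult mult_ac)
    then show ?thesis using h by simp
  qed
  have "d \<le> 0"
  proof (rule tendsto_lowerbound)
    show "((\<lambda>h. c * h ^ p) \<longlongrightarrow> 0) (at_right 0)"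
      using assms(2) by (auto intro!: tendsto_eq_intros)
    have "\<forall>\<^sub>F h in at_right 0. h \<in> {0<..<\<epsilon>}"
      using \<open>\<epsilon> > 0\<close> by (intro eventually_at_right_real)
    then show "\<forall>\<^sub>F h in at_right 0. d \<le> c * h ^ p"
      by (rule eventually_mono) (rule le, auto)
  qed simp
  then show ?thesis using nv by (simp add: d_def mult_le_0_iff)
qed

text \<open>The order hypothesis concerns real points only, and its constants may depend on the
  field and the point. Passing through Taylor coefficients removes both defects: those below
  \<open>p\<close> vanish at real points, hence everywhere, and Cauchy's estimate then bounds the
  defect with a constant depending only on \<open>m\<close> and \<open>\<eta>\<close>.\<close>

lemma (in rk_field) flow_rk_mean_order:
  assumes order: "rk_order s a b p" and x: "x \<in> rvec N"
    and real: "\<And>z. z \<in> complex_ball N x \<rho> \<Longrightarrow> z \<in> rvec N \<Longrightarrow> f z \<in> rvec N"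
    and y: "y \<in> B 1" and h: "cmod h \<le> \<eta> / 2"
  shows "norm (flow_mean h f y - rk_mean h f y) \<le> 2 * m * (cmod h / \<eta>) ^ p"
proof -
  define E where "E h y = flow_mean h f y - rk_mean h f y" for h y
  have E_eq: "E h y = mod_field f 1 h y - mod_field f 0 h y" for h y by (simp add: E_def)
  have B1: "B 1 \<subseteq> B 0" using B_Suc_subset[of 0] by simp
  have jE: "jhol N (ball 0 \<eta>) (B 1) E"
    unfolding E_eq[abs_def]
    by (intro jhol_diff jhol_mod_field jhol_subset[OF jhol_mod_field order_refl B1])
  have EM: "norm (E h y) \<le> m" if "h \<in> ball 0 \<eta>" "y \<in> B 1" for h y
  proof -
    have "norm (E h y) \<le> m * (cmod h / (2 * \<eta>))"
      using mod_field_increment[of h y 0] that by (simp add: E_def)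
    also have "\<dots> \<le> m * 1" using that m \<eta> by (intro mult_left_mono) auto
    finally show ?thesis by simp
  qed
  have bE: "bounded_hcurve N \<eta> m (\<lambda>h. E h y)" if "y \<in> B 1" for y
    using jhol_hcurve[OF jE open_ball that] B_subset_cvec[of 1] that \<eta> EM by unfold_locales blast+
  have real_zero: "tcoef (\<lambda>h. E h z) k = 0" if z: "z \<in> B 1" "z \<in> rvec N" and "k < p" for z k
  proof -
    \<comment> \<open>\<open>rk_order\<close> speaks of fields on sets of real points, so step and
      flow are taken relative to the real part \<open>V\<close> of the ball; that stages and
      solution stay real is verified below.\<close>
    define V where "V = complex_ball N x \<rho> \<inter> rvec N"
    have V: "V \<subseteq> cvec N" by (auto simp: V_def complex_ball_def)
    have ball: "complex_ball N z \<delta> \<subseteq> complex_ball N x \<rho>"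
      using ball_subset_B[of z 0] z by (simp add: B_def)
    have "smooth_field N V f"
      unfolding smooth_field_def
    proof (intro conjI ballI allI)
      have "V = rvec N \<inter> ball x \<rho>"
        using rvec_subset_cvec by (auto simp: V_def complex_ball_def dist_norm norm_minus_commute)
      then show "openin (top_of_set (rvec N)) V" by (auto simp: openin_open)
      show "f y \<in> rvec N" if "y \<in> V" for y using that real by (simp add: V_def)
      have "loc_bounded_chol N (complex_ball N x \<rho>) f"
        unfolding loc_bounded_chol_def
      proof (intro conjI ballI)
        fix y assume y: "y \<in> complex_ball N x \<rho>"
        have "complex_ball N y (\<rho> - norm (y - x)) \<subseteq> complex_ball N x \<rho>"
          by (rule complex_ball_mono) simp
        then show "\<exists>r>0. \<exists>M. complex_ball N y r \<subseteq> complex_ball N x \<rho> \<and>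
            (\<forall>z\<in>complex_ball N y r. norm (f z) \<le> M)"
          using y bound_f
          by (intro exI[of _ "\<rho> - norm (y - x)"] conjI exI[of _ m]) (auto simp: complex_ball_def)
      qed (use chol_f in \<open>auto simp: complex_ball_def\<close>)
      then show "class_C N n V f" for n unfolding V_def by (rule loc_bounded_chol_class_C)
    qed
    moreover have zV: "z \<in> V" using z B_subset_0[of 1] by (auto simp: V_def B_def)
    ultimately have O: "(\<lambda>h. norm (rk_step V s a b h f z - flow V h f z)) \<in> O[at 0](\<lambda>h. h ^ (p + 1))"
      using order unfolding rk_order_def by blast
    have eq: "rk_step V s a b t f z - flow V t f z = - (t *\<^sub>R E (of_real t) z)" if t: "\<bar>t\<bar> \<le> \<eta>" for t
    proof -
      have lr: "rk_local s a b A N z f \<delta> m (of_real t)"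
        by (rule rk_local_B[of 0]) (use t z m chol_f bound_f in \<open>auto simp: B_def\<close>)
      have lf: "flow_local N z f \<delta> m (of_real t)"
        by (rule flow_local_f[of _ z 0]) (use t z in auto)
      have small: "cmod (of_real \<tau>) \<le> cmod (of_real t)" if "\<tau> \<in> closed_segment 0 t" for \<tau>
        using that by (auto simp: closed_segment_eq_real_ivl split: if_splits)
      have real': "f w \<in> rvec N" if "w \<in> complex_ball N z \<delta>" "w \<in> rvec N" for w
        using that ball real by blast
      have "rk_step V s a b t f z = z + t *\<^sub>R rk_mean (of_real t) f z"
      proof (rule rk_step_eq[OF lr V])
        fix \<tau> i assume \<tau>: "\<tau> \<in> closed_segment 0 t" and i: "i < s"
        interpret l: rk_local s a b A N z f \<delta> m "of_real \<tau>"
          by (rule rk_local_smaller[OF lr small[OF \<tau>]])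
        have "stage (of_real \<tau>) f z j \<in> rvec N" if "j < s" for j
          by (rule l.stage_in_rvec[OF z(2) refl real' that])
        then have "stage_point (of_real \<tau>) z (stage (of_real \<tau>) f z) i \<in> rvec N"
          unfolding stage_point_def cscale_of_real by (intro rvec_intros z(2)) auto
        then show "stage_point (of_real \<tau>) z (stage (of_real \<tau>) f z) i \<in> V"
          using l.stage_in_ball[OF i] l.half_subset ball by (auto simp: V_def)
      qed
      moreover have "flow V t f z = z + t *\<^sub>R flow_mean (of_real t) f z"
      proof (rule flow_eq[OF lf V])
        show "norm (f w) \<le> m" if "w \<in> V" for w using that bound_f by (simp add: V_def)
        fix \<tau> assume \<tau>: "\<tau> \<in> closed_segment 0 t"
        interpret l: flow_local N z f \<delta> m "of_real \<tau>"
          by (rule flow_local_smaller[OF lf small[OF \<tau>]])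
        have "z + \<tau> *\<^sub>R flow_mean (of_real \<tau>) f z \<in> rvec N"
          by (intro rvec_intros z(2) l.flow_mean_in_rvec[OF z(2) refl real'])
        then show "z + \<tau> *\<^sub>R flow_mean (of_real \<tau>) f z \<in> V"
          using flow_curve(1)[OF lf \<tau>] l.half_subset ball by (auto simp: V_def)
      qed
      ultimately show ?thesis by (simp add: E_def algebra_simps)
    qed
    obtain \<epsilon> c where "\<epsilon> > 0" and
      c: "\<And>t. 0 < t \<Longrightarrow> t < \<epsilon> \<Longrightarrow> \<bar>norm (rk_step V s a b t f z - flow V t f z)\<bar> \<le> c * t ^ (p + 1)"
      by (rule bigo_power_bound[OF O]) blast
    show ?thesis
    proof (rule bounded_hcurve.tcoef_eq_0[OF bE[OF z(1)] _ _ \<open>k < p\<close>])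
      show "min \<epsilon> \<eta> > 0" using \<open>\<epsilon> > 0\<close> \<eta> by simp
      fix t :: real assume t: "0 < t" "t < min \<epsilon> \<eta>"
      then have "norm (t *\<^sub>R E (of_real t) z) \<le> c * t ^ (p + 1)"
        using c[of t] eq[of t] by simp
      then have "t * norm (E (of_real t) z) \<le> t * (c * t ^ p)" using t by (simp add: mult_ac)
      then show "norm (E (of_real t) z) \<le> c * t ^ p" using t by simp
    qed
  qed
  have "tcoef (\<lambda>h. E h y) k = 0" if "k < p" for k
    using y unfolding B_def
  proof (rule chol_zero_if_zero_on_rvec[rotated 3])
    show "chol N (complex_ball N x (\<rho> - real 1 * \<delta>)) (\<lambda>y. tcoef (\<lambda>h. E h y) k)"
      using jhol_tcoef[OF jE \<eta> B_subset_cvec EM] by (simp add: B_def)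
  qed (use x real_zero that in \<open>auto simp: B_def\<close>)
  from bounded_hcurve.bound_if_tcoef_0[OF bE[OF y] this h]
  show ?thesis by (simp add: E_def)
qed

section \<open>Choice of the constants, and the two estimates at the centre\<close>

theorem theorem7:
  fixes s S p :: nat and a :: "nat \<Rightarrow> nat \<Rightarrow> real" and b :: "nat \<Rightarrow> real"
    and m r1 r2 :: real
  assumes "r1 > 0" and "r2 > 0" and "m > 0"
    and "S \<ge> 1" and "p \<ge> 1" and "rk_order s a b p"
  shows "\<exists>(K :: real \<Rightarrow> nat) (T0 :: real) (q :: real) (\<gamma> :: real) (c1 :: real) (c2 :: real) (C :: real).
    T0 > 0 \<and> q > 0 \<and> \<gamma> > 0 \<and> c1 > 0 \<and> c2 > 0 \<and> C > 0 \<and>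
    (\<forall>N\<ge>1. \<forall>x\<in>rvec N. \<forall>f fnet. \<forall>T.
       let B = complex_ball N x r1;
           U = complex_ball N x (r1 + r2);
           h = T / real S;
           L = train_loss B U s a b S fnet f T
       in
         real_analytic_ext_on N U f \<longrightarrow> real_analytic_ext_on N U fnet \<longrightarrow>
         (\<forall>y\<in>U. norm (f y) \<le> m) \<longrightarrow> (\<forall>y\<in>U. norm (fnet y) \<le> m) \<longrightarrow>
         0 < T \<longrightarrow> T < T0 \<longrightarrow>
         norm (fnet x - imde_trunc U s a b f (K T) h x)
             \<le> c1 * exp (- \<gamma> / T powr (1 / q)) + C * L \<and>
         norm (fnet x - f x) \<le> c2 * h ^ p + C * L)"
proof -
  \<comment> \<open>The sum dominates each row sum and the weight sum; the summand 1 gives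
    \<open>A \<ge> 1\<close>.\<close>
  define A where "A = 1 + (\<Sum>i<s. \<Sum>j<s. \<bar>a i j\<bar>) + (\<Sum>j<s. \<bar>b j\<bar>)"
  have sums: "(\<Sum>i<s. \<Sum>j<s. \<bar>a i j\<bar>) \<ge> 0" "(\<Sum>j<s. \<bar>b j\<bar>) \<ge> 0" by (auto intro!: sum_nonneg)
  interpret rk s a b A
  proof
    show "A \<ge> 1" using sums by (simp add: A_def)
    show "(\<Sum>j<s. \<bar>a i j\<bar>) \<le> A" if "i < s" for i
    proof -
      have "(\<Sum>j<s. \<bar>a i j\<bar>) \<le> (\<Sum>i<s. \<Sum>j<s. \<bar>a i j\<bar>)"
        using member_le_sum[of i "{..<s}" "\<lambda>i. \<Sum>j<s. \<bar>a i j\<bar>"] that by (simp add: sum_nonneg)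
      then show ?thesis unfolding A_def using sums(2) by linarith
    qed
    show "(\<Sum>j<s. \<bar>b j\<bar>) \<le> A" using sums by (simp add: A_def)
    show "(\<Sum>j<s. b j) = 1" by (rule rk_order_consistent[OF assms(6,5)])
  qed
  have A2: "A\<^sup>2 \<ge> 1" "A \<le> A\<^sup>2"
    using A_ge_1 by (auto simp: power2_eq_square mult_le_cancel_left1 intro: order_trans[of 1 A])
  have Am: "A\<^sup>2 * m > 0" using A_ge_1 assms(3) by simp
  have Am': "80 * A\<^sup>2 * m \<ge> 0" "320 * A\<^sup>2 * m \<ge> 0" using assms(3) by simp_all
  \<comment> \<open>Two radius budgets. With \<open>\<delta> = r2 / 2 / Suc k\<close>, the condition
    \<open>h \<le> \<eta> / 2\<close> follows from
    \<open>320 * A\<^sup>2 * m * (Suc k * T) \<le> r2\<close>; the factor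
    \<open>\<theta> \<le> 1/2\<close> in \<open>comparison\<close> requires
    \<open>80 * A\<^sup>2 * m * (T * Suc k) \<le> r1\<close>. Both hold once
    \<open>Suc k * T \<le> \<kappa>\<close>.\<close>
  define \<kappa> where "\<kappa> = min (r2 / (320 * A\<^sup>2 * m)) (r1 / (80 * A\<^sup>2 * m))"
  have \<kappa>: "\<kappa> > 0" using assms A2 A_ge_1 by (simp add: \<kappa>_def)
  have \<kappa>_r2: "320 * A\<^sup>2 * m * \<kappa> \<le> r2" and \<kappa>_r1: "80 * A\<^sup>2 * m * \<kappa> \<le> r1"
    using Am by (auto simp: \<kappa>_def min_def field_simps split: if_splits)
  \<comment> \<open>The subtraction of 1 turns the bound \<open>\<kappa> / T\<close> for the number
    \<open>Suc k\<close> of losses into one for \<open>k\<close>.\<close>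
  define K where "K T = nat \<lfloor>\<kappa> / T\<rfloor> - 1" for T
  \<comment> \<open>For the second estimate \<open>comparison\<close> is run with
    \<open>J = p\<close>, so \<open>Suc p * T\<close> has to stay below
    \<open>\<kappa>\<close>.\<close>
  define T0 where "T0 = \<kappa> / real (Suc p)"
  have "T0 > 0" using \<kappa> by (simp add: T0_def)
  define \<eta>1 where "\<eta>1 = r2 / 2 / (80 * A\<^sup>2 * m)"
  have \<eta>1: "\<eta>1 > 0" using assms A_ge_1 by (simp add: \<eta>1_def)
  \<comment> \<open>In units of \<open>(1/2) ^ Suc k\<close>: \<open>8 * m\<close> from the initial
    difference in \<open>comparison\<close>, \<open>4 * m\<close> from the Taylor remainder, and the
    last summand from the defect of the iterate. The outer 2 pays for rounding
    \<open>\<kappa> / T\<close>.\<close>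
  define c1 where "c1 = 2 * (12 * m + 2 * 2 ^ S * m)"
  define c2 where "c2 = (40 * A\<^sup>2 * m * real S * real (Suc p) / r1) ^ p * (4 * m) + 4 * 2 ^ S * m / \<eta>1 ^ p"
  have main: "norm (fnet x - imde_trunc (complex_ball N x (r1 + r2)) s a b f (K T) (T / real S) x)
        \<le> c1 * exp (- (\<kappa> * ln 2) / T) + 2 * train_loss (complex_ball N x r1) (complex_ball N x (r1 + r2)) s a b S fnet f T \<and>
      norm (fnet x - f x) \<le> c2 * (T / real S) ^ p +
        2 * train_loss (complex_ball N x r1) (complex_ball N x (r1 + r2)) s a b S fnet f T"
    if x: "x \<in> rvec N" and f: "real_analytic_ext_on N (complex_ball N x (r1 + r2)) f"
      and fnet: "real_analytic_ext_on N (complex_ball N x (r1 + r2)) fnet"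
      and fm: "\<forall>y\<in>complex_ball N x (r1 + r2). norm (f y) \<le> m"
      and fnetm: "\<forall>y\<in>complex_ball N x (r1 + r2). norm (fnet y) \<le> m"
      and T: "0 < T" "T < T0" for N x f fnet T
  proof -
    let ?L = "train_loss (complex_ball N x r1) (complex_ball N x (r1 + r2)) s a b S fnet f T"
    have xc: "x \<in> cvec N" using x rvec_subset_cvec by blast
    have pT: "real (Suc p) * T < \<kappa>" using T(2) by (simp add: T0_def field_simps)
    have "1 * T \<le> real (Suc p) * T" using T by (intro mult_right_mono) auto
    then have T\<kappa>: "T \<le> \<kappa>" using pT by simp
    interpret c: rk_compare s a b A S N x r1 r2 m T f fnet
    proof unfold_locales
      have "128 * A * m * T \<le> 320 * A\<^sup>2 * m * \<kappa>"
        using A2 A_ge_1 assms(3) T T\<kappa> by (intro mult_mono) auto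
      also note \<kappa>_r2
      finally show "128 * A * m * T \<le> r2" .
      show "chol N (complex_ball N x (r1 + r2)) f" "chol N (complex_ball N x (r1 + r2)) fnet"
        using f fnet by (auto simp: real_analytic_ext_on_def intro: chol_if_analytic)
    qed (use assms xc T fm fnetm in auto)
    note h = c.h
    have h_def: "c.h = T / real S" and U_def: "c.U = complex_ball N x (r1 + r2)"
      by (simp_all add: c.h_def c.U_def)
    note comparison = c.comparison[unfolded U_def]
    have fields: "rk_field s a b A N x (r1 + r2) f m \<delta>" if "\<delta> > 0" for \<delta>
      by unfold_locales (use that c.chol_f c.bound_f assms in auto)
    show ?thesis
    proof
      define k where "k = K T"
      have "\<kappa> / T \<ge> 1" using T\<kappa> T by simp
      then have "\<lfloor>\<kappa> / T\<rfloor> \<ge> 1" by simp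
      then have "real (nat \<lfloor>\<kappa> / T\<rfloor>) = of_int \<lfloor>\<kappa> / T\<rfloor>" by simp
      then have "real (nat \<lfloor>\<kappa> / T\<rfloor>) \<le> \<kappa> / T" "real (nat \<lfloor>\<kappa> / T\<rfloor>) \<ge> 1" "real (nat \<lfloor>\<kappa> / T\<rfloor>) \<ge> \<kappa> / T - 1"
        using \<open>\<lfloor>\<kappa> / T\<rfloor> \<ge> 1\<close> by linarith+
      then have k: "real (Suc k) \<le> \<kappa> / T" "real (Suc k) \<ge> \<kappa> / T - 1"
        unfolding k_def K_def by auto
      have kT: "real (Suc k) * T \<le> \<kappa>" using k(1) T by (simp add: field_simps)
      \<comment> \<open>\<open>Suc k\<close> losses lead from radius \<open>r1 + r2\<close> to
        \<open>r1 + r2/2\<close>: \<open>k\<close> for the iterate itself and one more for its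
        defect.\<close>
      define \<delta> where "\<delta> = r2 / 2 / real (Suc k)"
      have \<delta>: "\<delta> > 0" using assms by (simp add: \<delta>_def)
      interpret F: rk_field s a b A N x "r1 + r2" f m \<delta> by (rule fields[OF \<delta>])
      have "r1 + r2 - real (Suc k) * \<delta> = r1 + r2/2" by (simp add: \<delta>_def field_simps)
      then have Fball: "F.B (Suc k) = complex_ball N x (r1 + r2/2)" unfolding F.B_def by (rule arg_cong)
      have sub: "complex_ball N x (r1 + r2/2) \<subseteq> F.B k" using F.B_Suc_subset[of k] by (simp add: Fball)
      have hT: "c.h \<le> F.\<eta> / 2"
      proof -
        have "320 * A\<^sup>2 * m * (real (Suc k) * T) \<le> 320 * A\<^sup>2 * m * \<kappa>"
          by (rule mult_left_mono[OF kT Am'(2)])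
        then have "320 * A\<^sup>2 * m * (real (Suc k) * T) \<le> r2" using \<kappa>_r2 by simp
        moreover have pos: "320 * A\<^sup>2 * m * real (Suc k) > 0" using A_ge_1 assms(3) by simp
        moreover have "F.\<eta> / 2 = r2 / (320 * A\<^sup>2 * m * real (Suc k))"
          unfolding F.\<eta>_def unfolding \<delta>_def by (simp del: of_nat_Suc)
        ultimately have "T \<le> F.\<eta> / 2"
          by (simp only: pos_le_divide_eq) (simp only: mult_ac)
        then show ?thesis using h(3) by simp
      qed
      have hb: "of_real c.h \<in> ball (0::complex) F.\<eta>" using hT h(1) F.\<eta> by simp
      define e where "e = (1/2 :: real) ^ Suc k"
      have "norm (fnet x - mod_field f k (of_real c.h) x) \<le>
          (40 * A\<^sup>2 * m * T * real (Suc k) / r1) ^ k * (4 * m) + 2 * (?L + 2 ^ S * (m * e))"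
      proof (rule comparison)
        show "chol N (complex_ball N x (r1 + r2/2)) (mod_field f k (of_real c.h))"
          by (rule jhol_subset[OF jhol_fix[OF F.jhol_mod_field hb] order_refl sub])
        fix z assume z: "z \<in> complex_ball N x (r1 + r2/2)"
        show "norm (mod_field f k (of_real c.h) z) \<le> 2 * m"
          by (rule F.norm_mod_field[OF hb]) (use z sub in blast)
        \<comment> \<open>The defect of the \<open>k\<close>-th iterate is the increment to the next
          one.\<close>
        have "norm (mod_field f (Suc k) (of_real c.h) z - mod_field f k (of_real c.h) z) \<le>
            m * (cmod (of_real c.h) / (2 * F.\<eta>)) ^ Suc k"
          by (rule F.mod_field_increment[OF hb]) (use z Fball in simp)
        also have "\<dots> \<le> m * (1/2) ^ Suc k"
          using hT h(1) F.\<eta> assms(3) by (intro mult_left_mono power_mono) (auto simp: field_simps)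
        finally show "norm (flow_mean (of_real c.h) f z - rk_mean (of_real c.h) (mod_field f k (of_real c.h)) z) \<le> m * e"
          by (simp add: e_def)
      next
        have "80 * A\<^sup>2 * m * (T * real (Suc k)) \<le> 80 * A\<^sup>2 * m * \<kappa>"
          by (rule mult_left_mono[OF kT[unfolded mult.commute[of _ T]] Am'(1)])
        then show "80 * A\<^sup>2 * m * T * real (Suc k) \<le> r1" using \<kappa>_r1 by simp
      qed
      moreover have "(40 * A\<^sup>2 * m * T * real (Suc k) / r1) ^ k \<le> (1/2) ^ k"
      proof (rule power_mono)
        have "80 * A\<^sup>2 * m * (T * real (Suc k)) \<le> 80 * A\<^sup>2 * m * \<kappa>"
          by (rule mult_left_mono[OF kT[unfolded mult.commute[of _ T]] Am'(1)])
        then show "40 * A\<^sup>2 * m * T * real (Suc k) / r1 \<le> 1/2"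
          using \<kappa>_r1 assms(1) by (simp add: field_simps)
        show "0 \<le> 40 * A\<^sup>2 * m * T * real (Suc k) / r1" using assms T by simp
      qed
      then have "(40 * A\<^sup>2 * m * T * real (Suc k) / r1) ^ k * (4 * m) \<le> 2 * e * (4 * m)"
        using assms(3) by (intro mult_right_mono) (auto simp: e_def)
      moreover have "norm (mod_field f k (of_real c.h) x - imde_trunc (complex_ball N x (r1 + r2)) s a b f k c.h x) \<le> 4 * m * e"
      proof -
        have "x \<in> F.B k" using sub xc assms by (auto simp: complex_ball_def)
        then have "norm (mod_field f k (of_real c.h) x - imde_trunc (complex_ball N x (r1 + r2)) s a b f k c.h x) \<le>
            4 * m * (\<bar>c.h\<bar> / F.\<eta>) ^ Suc k"
          by (rule F.mod_field_imde_trunc) (use hT h in simp)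
        also have "\<dots> \<le> 4 * m * (1/2) ^ Suc k"
          using hT h(1) F.\<eta> assms(3) by (intro mult_left_mono power_mono) (auto simp: field_simps)
        finally show ?thesis by (simp add: e_def)
      qed
      moreover have "norm (fnet x - imde_trunc (complex_ball N x (r1 + r2)) s a b f k c.h x) \<le>
          norm (fnet x - mod_field f k (of_real c.h) x) +
          norm (mod_field f k (of_real c.h) x - imde_trunc (complex_ball N x (r1 + r2)) s a b f k c.h x)"
        using norm_triangle_ineq[of "fnet x - mod_field f k (of_real c.h) x"
            "mod_field f k (of_real c.h) x - imde_trunc (complex_ball N x (r1 + r2)) s a b f k c.h x"] by simp
      ultimately have "norm (fnet x - imde_trunc (complex_ball N x (r1 + r2)) s a b f k c.h x) \<le>
          2 * e * (4 * m) + 2 * (?L + 2 ^ S * (m * e)) + 4 * m * e"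
        by linarith
      also have "\<dots> = (12 * m + 2 * 2 ^ S * m) * e + 2 * ?L" by (simp add: algebra_simps)
      also have "\<dots> \<le> (12 * m + 2 * 2 ^ S * m) * (2 * exp (- (\<kappa> * ln 2) / T)) + 2 * ?L"
      proof (intro add_right_mono mult_left_mono)
        have "e = exp (- ln 2) ^ Suc k" by (simp only: e_def exp_minus exp_ln zero_less_numeral inverse_eq_divide)
        also have "\<dots> = exp (- ln 2 * real (Suc k))" by (rule exp_of_nat2_mult[symmetric])
        \<comment> \<open>\<open>Suc k\<close> is at least \<open>\<kappa> / T - 1\<close>; this
          rounding is the origin of the factor 2.\<close>
        also have "\<dots> \<le> exp (- ln 2 * (\<kappa> / T - 1))" using k(2) by simp
        also have "\<dots> = 2 * exp (- (\<kappa> * ln 2) / T)"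
          by (simp add: algebra_simps exp_add exp_diff exp_minus divide_inverse)
        finally show "e \<le> 2 * exp (- (\<kappa> * ln 2) / T)" .
      qed (use assms in auto)
      finally show "norm (fnet x - imde_trunc (complex_ball N x (r1 + r2)) s a b f (K T) (T / real S) x)
          \<le> c1 * exp (- (\<kappa> * ln 2) / T) + 2 * ?L"
        by (simp add: c1_def k_def h_def algebra_simps)
    next
      \<comment> \<open>A single loss is enough here, since \<open>f\<close> itself is compared; so
        \<open>\<delta> = r2/2\<close> and the step bound \<open>\<eta>1\<close> does not depend on
        \<open>T\<close>.\<close>
      interpret F: rk_field s a b A N x "r1 + r2" f m "r2/2" by (rule fields) (use assms in simp)
      have Fball: "F.B 1 = complex_ball N x (r1 + r2/2)" by (simp add: F.B_def add.commute)
      have F\<eta>: "F.\<eta> = \<eta>1" by (simp add: F.\<eta>_def \<eta>1_def)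
      have hT: "c.h \<le> F.\<eta> / 2"
      proof -
        have "\<kappa> \<le> F.\<eta> / 2" using \<kappa>_r2 Am A_ge_1 by (simp add: F.\<eta>_def field_simps)
        then show ?thesis using h(3) T\<kappa> by simp
      qed
      have sub: "complex_ball N x (r1 + r2/2) \<subseteq> complex_ball N x (r1 + r2)"
        using assms by (auto simp: complex_ball_def)
      have "norm (fnet x - f x) \<le>
          (40 * A\<^sup>2 * m * T * real (Suc p) / r1) ^ p * (4 * m) + 2 * (?L + 2 ^ S * (2 * m * (c.h / \<eta>1) ^ p))"
      proof (rule comparison)
        show "chol N (complex_ball N x (r1 + r2/2)) f" by (rule jhol_subset[OF c.chol_f order_refl sub])
        fix z assume z: "z \<in> complex_ball N x (r1 + r2/2)"
        then show "norm (f z) \<le> 2 * m" using c.bound_f[of z] sub assms(3) by force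
        have "norm (flow_mean (of_real c.h) f z - rk_mean (of_real c.h) f z) \<le>
            2 * m * (cmod (of_real c.h) / F.\<eta>) ^ p"
          by (rule F.flow_rk_mean_order[OF assms(6) x])
            (use f z Fball hT h(1) in \<open>auto simp: real_analytic_ext_on_def\<close>)
        then show "norm (flow_mean (of_real c.h) f z - rk_mean (of_real c.h) f z) \<le> 2 * m * (c.h / \<eta>1) ^ p"
          using h(1) by (simp add: F\<eta>)
      next
        have "80 * A\<^sup>2 * m * (T * real (Suc p)) \<le> 80 * A\<^sup>2 * m * \<kappa>"
          by (rule mult_left_mono[OF less_imp_le[OF pT[unfolded mult.commute[of _ T]]] Am'(1)])
        then show "80 * A\<^sup>2 * m * T * real (Suc p) \<le> r1" using \<kappa>_r1 by simp
      qed
      also have "\<dots> = c2 * c.h ^ p + 2 * ?L"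
      proof -
        \<comment> \<open>Substituting \<open>T = S * h\<close> turns the \<open>p\<close>-th power
          of the contraction factor into a multiple of \<open>h ^ p\<close>.\<close>
        define X where "X = 40 * A\<^sup>2 * m * real S * real (Suc p) / r1"
        have "40 * A\<^sup>2 * m * T * real (Suc p) / r1 = X * c.h"
          using assms(4) by (simp add: h_def X_def)
        then show ?thesis
          unfolding c2_def X_def[symmetric] by (simp add: power_mult_distrib power_divide algebra_simps)
      qed
      finally show "norm (fnet x - f x) \<le> c2 * (T / real S) ^ p + 2 * ?L" by (simp add: h_def)
    qed
  qed
  show ?thesis
  \<comment> \<open>The witnesses are \<open>q = 1\<close>,
    \<open>\<gamma> = \<kappa> * ln 2\<close> from rewriting a power of 1/2 as an exponential, and
    \<open>C = 2\<close>, the coefficient of the loss in \<open>comparison\<close>.\<close>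
  proof (rule exI[of _ K], rule exI[of _ T0], rule exI[of _ 1], rule exI[of _ "\<kappa> * ln 2"],
      rule exI[of _ c1], rule exI[of _ c2], rule exI[of _ 2], intro conjI)
    show "c1 > 0" using assms by (simp add: c1_def add_pos_pos)
    show "c2 > 0"
      unfolding c2_def using assms \<eta>1 by (intro add_nonneg_pos) auto
    show "\<forall>N\<ge>1. \<forall>x\<in>rvec N. \<forall>f fnet. \<forall>T.
       let B = complex_ball N x r1;
           U = complex_ball N x (r1 + r2);
           h = T / real S;
           L = train_loss B U s a b S fnet f T
       in
         real_analytic_ext_on N U f \<longrightarrow> real_analytic_ext_on N U fnet \<longrightarrow>
         (\<forall>y\<in>U. norm (f y) \<le> m) \<longrightarrow> (\<forall>y\<in>U. norm (fnet y) \<le> m) \<longrightarrow>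
         0 < T \<longrightarrow> T < T0 \<longrightarrow>
         norm (fnet x - imde_trunc U s a b f (K T) h x)
             \<le> c1 * exp (- (\<kappa> * ln 2) / T powr (1 / 1)) + 2 * L \<and>
         norm (fnet x - f x) \<le> c2 * h ^ p + 2 * L"
      unfolding Let_def using main by simp
  qed (use \<open>T0 > 0\<close> \<kappa> in auto)
qed

end
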